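(* There exists a convex body $K\subset\mathbb{R}^2$ whose boundary is three times differentiable and positively curved everywhere, but which does not admit a continuous quasigeodesic flow, respectively a continuous billiard evolution.
   Context: A convex body in $\mathbb{R}^2$ is a compact convex set with nonempty interior, regarded as a metric space with the Euclidean distance. The tangent cone at $p\in K$ is $T_pK=\overline{\{\lambda(q-p)\mid q\in K,\ \lambda\ge0\}}$; the tangent cone bundle $TK=\bigcup_pT_pK$ carries the subspace topology from $T\mathbb{R}^2$, and $\pi:TK\to K$ is the projection. Quasigeodesics. Let $\gamma:[a,b]\to K$ be parametrized by arclength and $p\in K\setminus\gamma([a,b])$. Fix $o\in\mathbb{R}^2$. Up to rotation there is a unique curve $\tilde\gamma:[a,b]\to\mathbb{R}^2$ parametrized by arclength with $|o\tilde\gamma(t)|=|p\gamma(t)|$ for all $t$ and such that the segment $o\tilde\gamma(t)$ turns clockwise as $t$ increases; it is called the development of $\gamma$ with respect to $p$. The curve $\gamma$ is a quasigeodesic if for any $t_0\in[a,b]$ there are a neighborhood $U$ of $\gamma(t_0)$ and $\varepsilon>0$ with $\gamma([t_0-\varepsilon,t_0+\varepsilon])\subset U$ such that the development of $\gamma|_{[t_0-\varepsilon,t_0+\varepsilon]}$ with respect to any point in $U$ is convex in the sense that for every $t\in(t_0-\varepsilon,t_0+\varepsilon)$ and every $\tau>0$ the region bounded by the segments $o\tilde\gamma(t\pm\tau)$ and the arc $\tilde\gamma|_{[t-\tau,t+\tau]}$ is convex whenever it is defined. A curve on a general interval is a quasigeodesic if its restrictions to compact subintervals are. Quasigeodesics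 have well-defined right derivatives $\gamma^+(t)$. A (unit speed) billiard trajectory on $K$ is by definition a quasigeodesic of $K$. A quasigeodesic flow (equivalently, billiard flow) on $K$ is a map $\Phi:TK\times\mathbb{R}\to TK$ with $\Phi(\cdot,0)=\mathrm{id}_{TK}$ and $\Phi(\Phi(v,s),t)=\Phi(v,s+t)$ such that for each $v\in TK$ the map $c(t)=\pi(\Phi(v,t))$ is constant or a constant speed curve which becomes a quasigeodesic after reparametrization by arclength, with $c^+(t)=\Phi(v,t)$ for all $t$. $K$ admits a continuous billiard evolution if there is such a $\Phi$ for which $\pi\circ\Phi:TK\times\mathbb{R}\to K$ is continuous with respect to the subspace topology of $TK$. The initial directions of curves $\gamma_i:[0,a)\to K$ (quasigeodesics, up to constant speed) converge in the Alexandrov sense to the initial direction of $\gamma:[0,a)\to K$ if $\gamma_i(0)\to\gamma(0)$ and the initial direction of the limit of any pointwise convergent subsequence of the $\gamma_i$ coincides with the initial direction of $\gamma$. We say $v_i\in TK$ converges to $v\in TK$ in the Alexandrov sense (with respect to $\Phi$) if this holds for the curves $[0,\infty)\ni t\mapsto\pi(\Phi(v_i,t))$ and $[0,\infty)\ni t\mapsto\pi(\Phi(v,t))$. The quasigeodesic flow $\Phi$ is continuous if whenever $v_i\to v$ in the Alexandrov sense, then $\Phi(v_i,t_i)\to\Phi(v,t)$ in the Alexandrov sense for all $t\in[0,\infty)$ and all sequences $t_i\to t$. *)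

theory Defs
  imports "HOL-Analysis.Analysis"
begin

type_synonym plane = "real ^ 2"

definition convex_body :: "plane set \<Rightarrow> bool" where
  "convex_body K \<longleftrightarrow> compact K \<and> convex K \<and> interior K \<noteq> {}"

(* signed curvature of a regular plane curve with first and second derivatives v and a *)
definition curvature :: "plane \<Rightarrow> plane \<Rightarrow> real" where
  "curvature v a = (v $ 1 * a $ 2 - v $ 2 * a $ 1) / norm v ^ 3"

(* A regular three times differentiable closed curve that runs once around the frontier; the third
   derivative need not be continuous.  The sign of the curvature fixes the orientation: for the
   boundary of a convex body, traversed counterclockwise, the curvature cannot be negative. *)
definition D3_positively_curved_boundary :: "plane set \<Rightarrow> bool" where
  "D3_positively_curved_boundary K \<longleftrightarrow>
     (\<exists>L \<beta> \<beta>1 \<beta>2 \<beta>3. 0 < L \<and> (\<forall>t. \<beta> (t + L) = \<beta> t) \<and> inj_on \<beta> {0..<L} \<and> \<beta> ` {0..<L} = frontier K \<and>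
        (\<forall>t::real. (\<beta> has_vector_derivative \<beta>1 t) (at t) \<and>
                   (\<beta>1 has_vector_derivative \<beta>2 t) (at t) \<and>
                   (\<beta>2 has_vector_derivative \<beta>3 t) (at t) \<and>
                   \<beta>1 t \<noteq> 0 \<and> 0 < curvature (\<beta>1 t) (\<beta>2 t)))"

definition tangent_cone :: "plane set \<Rightarrow> plane \<Rightarrow> plane set" where
  "tangent_cone K p = closure {l *\<^sub>R (q - p) | l q. 0 \<le> l \<and> q \<in> K}"

(* An element (p, w) is the vector w based at p; the topology of the bundle is the subspace
   topology of the product, and the projection is fst. *)
definition tangent_bundle :: "plane set \<Rightarrow> (plane \<times> plane) set" where
  "tangent_bundle K = Sigma K (tangent_cone K)"


definition curve_length :: "(real \<Rightarrow> plane) \<Rightarrow> real \<Rightarrow> real \<Rightarrow> ereal" where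
  "curve_length \<gamma> s t =
     Sup {ereal (\<Sum>i<n. dist (\<gamma> (u i)) (\<gamma> (u (Suc i)))) | (n::nat) u. u 0 = s \<and> u n = t \<and> mono_on {..n} u}"

definition arclength_parametrized :: "real set \<Rightarrow> (real \<Rightarrow> plane) \<Rightarrow> bool" where
  "arclength_parametrized J \<gamma> \<longleftrightarrow>
     (\<forall>s\<in>J. \<forall>t\<in>J. s \<le> t \<longrightarrow> curve_length \<gamma> s t = ereal (t - s))"

(* \<delta> is a development, based at z, of \<gamma> restricted to the interval J, with respect to the point p
   off the curve; \<theta> is a continuous choice of the polar angle of \<delta> around z.  Since the segment from
   z to \<delta> turns clockwise, \<theta> is weakly decreasing and \<theta> s - \<theta> t is the angle swept between the times
   s \<le> t.  Such a pair exists, and is unique on J up to a rotation about z (and multiples of 2 pi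
   in \<theta>). *)
definition development ::
  "real set \<Rightarrow> (real \<Rightarrow> plane) \<Rightarrow> plane \<Rightarrow> plane \<Rightarrow> (real \<Rightarrow> plane) \<Rightarrow> (real \<Rightarrow> real) \<Rightarrow> bool" where
  "development J \<gamma> p z \<delta> \<theta> \<longleftrightarrow>
     arclength_parametrized J \<delta> \<and>
     (\<forall>t\<in>J. dist z (\<delta> t) = dist p (\<gamma> t)) \<and>
     continuous_on J \<theta> \<and> antimono_on J \<theta> \<and>
     (\<forall>t\<in>J. \<delta> t = z + dist z (\<delta> t) *\<^sub>R vector [cos (\<theta> t), sin (\<theta> t)])"

(* The union is the region bounded by the two segments from z to \<delta> (t - \<tau>), \<delta> (t + \<tau>) and the arc
   between them.  It is regarded as defined when t - \<tau> and t + \<tau> are parameters of the arc and the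
   segments and the arc form a curvilinear triangle, that is, the angle swept at z is less than pi.
   (For larger angles z would be a reflex vertex, so that not even a reflected billiard path or a
   strictly convex boundary arc would have convex developments with respect to all nearby points.) *)
definition convex_development ::
  "real set \<Rightarrow> plane \<Rightarrow> (real \<Rightarrow> plane) \<Rightarrow> (real \<Rightarrow> real) \<Rightarrow> bool" where
  "convex_development J z \<delta> \<theta> \<longleftrightarrow>
     (\<forall>t \<tau>. 0 < \<tau> \<and> t - \<tau> \<in> J \<and> t + \<tau> \<in> J \<and> \<theta> (t - \<tau>) - \<theta> (t + \<tau>) < pi \<longrightarrow>
        convex (\<Union>s\<in>{t - \<tau>..t + \<tau>}. closed_segment z (\<delta> s)))"

(* Neighbourhoods are taken in K.  At an end point t0 of the parameter interval the restriction is to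
   the part of {t0 - \<epsilon>..t0 + \<epsilon>} lying in that interval.  Developments are based at the origin; as they
   exist and are unique up to rotation, "the development is convex" is rendered existentially. *)
definition quasigeodesic_compact ::
  "plane set \<Rightarrow> real \<Rightarrow> real \<Rightarrow> (real \<Rightarrow> plane) \<Rightarrow> bool" where
  "quasigeodesic_compact K a b \<gamma> \<longleftrightarrow>
     \<gamma> ` {a..b} \<subseteq> K \<and> arclength_parametrized {a..b} \<gamma> \<and>
     (\<forall>t0\<in>{a..b}. \<exists>U \<epsilon>. openin (top_of_set K) U \<and> \<gamma> t0 \<in> U \<and> 0 < \<epsilon> \<and>
        (let J = {a..b} \<inter> {t0 - \<epsilon>..t0 + \<epsilon>} in
           \<gamma> ` J \<subseteq> U \<and>
           (\<forall>p \<in> U - \<gamma> ` J. \<exists>\<delta> \<theta>. development J \<gamma> p 0 \<delta> \<theta> \<and> convex_development J 0 \<delta> \<theta>)))"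

definition quasigeodesic :: "plane set \<Rightarrow> real set \<Rightarrow> (real \<Rightarrow> plane) \<Rightarrow> bool" where
  "quasigeodesic K I \<gamma> \<longleftrightarrow>
     (\<forall>a b. a < b \<and> {a..b} \<subseteq> I \<longrightarrow> quasigeodesic_compact K a b \<gamma>)"


(* Only the values of \<Phi> on the tangent cone bundle matter. *)
definition quasigeodesic_flow ::
  "plane set \<Rightarrow> (plane \<times> plane \<Rightarrow> real \<Rightarrow> plane \<times> plane) \<Rightarrow> bool" where
  "quasigeodesic_flow K \<Phi> \<longleftrightarrow>
     (\<forall>v\<in>tangent_bundle K.
        (\<forall>t. \<Phi> v t \<in> tangent_bundle K) \<and>
        \<Phi> v 0 = v \<and>
        (\<forall>s t. \<Phi> (\<Phi> v s) t = \<Phi> v (s + t)) \<and>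
        (let c = (\<lambda>t. fst (\<Phi> v t)) in
           ((\<exists>x. \<forall>t. c t = x) \<or> (\<exists>\<sigma>>0. quasigeodesic K UNIV (\<lambda>s. c (s / \<sigma>)))) \<and>
           (\<forall>t. (c has_vector_derivative snd (\<Phi> v t)) (at_right t))))"

definition admits_continuous_billiard_evolution :: "plane set \<Rightarrow> bool" where
  "admits_continuous_billiard_evolution K \<longleftrightarrow>
     (\<exists>\<Phi>. quasigeodesic_flow K \<Phi> \<and>
          continuous_on (tangent_bundle K \<times> UNIV) (\<lambda>(v, t). fst (\<Phi> v t)))"

(* Curves are considered on [0,\<infinity>); initial directions are right derivatives at 0. *)
definition initial_directions_converge ::
  "(nat \<Rightarrow> real \<Rightarrow> plane) \<Rightarrow> (real \<Rightarrow> plane) \<Rightarrow> bool" where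
  "initial_directions_converge \<gamma>s \<gamma> \<longleftrightarrow>
     (\<lambda>i. \<gamma>s i 0) \<longlonglongrightarrow> \<gamma> 0 \<and>
     (\<forall>r \<eta>. strict_mono r \<and> (\<forall>t\<ge>0. (\<lambda>i. \<gamma>s (r i) t) \<longlonglongrightarrow> \<eta> t) \<longrightarrow>
        (\<exists>w. (\<eta> has_vector_derivative w) (at_right 0) \<and> (\<gamma> has_vector_derivative w) (at_right 0)))"

definition Alexandrov_tendsto ::
  "(plane \<times> plane \<Rightarrow> real \<Rightarrow> plane \<times> plane) \<Rightarrow> (nat \<Rightarrow> plane \<times> plane) \<Rightarrow> plane \<times> plane \<Rightarrow> bool" where
  "Alexandrov_tendsto \<Phi> vs v \<longleftrightarrow>
     initial_directions_converge (\<lambda>i t. fst (\<Phi> (vs i) t)) (\<lambda>t. fst (\<Phi> v t))"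

(* Continuity is tested on sequences of vectors of bounded length.  Billiard curves with speeds
   tending to infinity have no pointwise convergent subsequence, so a sequence of vectors at one point
   with lengths tending to infinity converges vacuously in the Alexandrov sense to every vector at
   that point; without the bound no flow on any convex body would be continuous.  The bound only
   weakens the continuity requirement.  All times are taken in [0,\<infinity>). *)
definition continuous_quasigeodesic_flow ::
  "plane set \<Rightarrow> (plane \<times> plane \<Rightarrow> real \<Rightarrow> plane \<times> plane) \<Rightarrow> bool" where
  "continuous_quasigeodesic_flow K \<Phi> \<longleftrightarrow>
     quasigeodesic_flow K \<Phi> \<and>
     (\<forall>vs v. (\<forall>i. vs i \<in> tangent_bundle K) \<and> v \<in> tangent_bundle K \<and>
             bounded (range (\<lambda>i. snd (vs i))) \<and> Alexandrov_tendsto \<Phi> vs v \<longrightarrow>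
        (\<forall>t ts. 0 \<le> t \<and> (\<forall>i. 0 \<le> ts i) \<and> ts \<longlonglongrightarrow> t \<longrightarrow>
           Alexandrov_tendsto \<Phi> (\<lambda>i. \<Phi> (vs i) (ts i)) (\<Phi> v t)))"

end

theory Submission
  imports Defs
begin

text \<open>
  The table is the unit disc with infinitely many tiny bumps, which accumulate at a boundary point \<open>p\<close> and, as the formula is
  symmetric, at the opposite point.  They are placed
  in such a way that two different billiard orbits bounce infinitely often within finite time and converge to \<open>p\<close>, both of
  them tangentially and from the same side.  At the time of arrival they have the same position and the same velocity.
  In a quasigeodesic flow the maps at the times \<open>t\<close> and \<open>- t\<close> are inverse to each other, so a position and a velocity
  determine the orbit also in the past.  Hence the table carries no quasigeodesic flow
  (\<open>two_arrivals_exclude_flow\<close>), in particular no continuous one.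

  That the orbits are forced is derived from the definition of a quasigeodesic \<open>\<gamma>\<close> as follows.  A polygon with convex corners
  falls behind a straight line in its distance from the origin.  So convexity of the developments with respect to \<open>q\<close>
  makes the function \<open>(dist q (\<gamma> t))\<^sup>2 - t\<^sup>2\<close> locally concave in \<open>t\<close>, for all points \<open>q\<close> of the table near the curve
  (\<open>quasigeodesic_locally_semiconcave\<close>).  Up to factors and constants, differences of these functions for several \<open>q\<close>
  are the coordinates of the curve, so there are one-sided tangents; they have unit length because the curve is parametrized by arclength.  Comparing left and
  right derivatives at one time gives the reflection law (\<open>corner\<close>, \<open>bounce\<close>), and in the interior of the table
  the concavity for all \<open>q\<close> in a full neighbourhood forces straight lines (\<open>interior_straight\<close>).

  For the table let \<open>1 / u\<close> be the polar radius of the boundary; the boundary is positively curved where \<open>u + u''\<close> is positive.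
  An orbit that bounces at the angles \<open>\<alpha> n\<close> on the unit circle needs at each of them a normal that is tilted by a quarter of
  the second difference of the angles, and has total length at most the total angle.  For angles of the form \<open>- 1 / sqrt k\<close>
  the gaps are of order \<open>k powr (-3/2)\<close> and the second differences are of order \<open>k powr (-5/2)\<close>.  Bumps that fit into the
  gaps and produce the tilts change \<open>u''\<close> by an amount of order \<open>1 / k\<close>, which is the square of the angle.  Therefore
  \<open>u\<close> is three times differentiable at the limit point, although its third derivative is unbounded near it
  (\<open>bump_train_angles\<close>, \<open>train_deriv\<close>).  The even and the odd indices \<open>k\<close> give the two orbits.
\<close>

section \<open>Polar frames in the plane\<close>

lemma inner_plane: "(x::plane) \<bullet> y = x $ 1 * y $ 1 + x $ 2 * y $ 2"
  by (simp add: inner_vec_def UNIV_2)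

lemma plane_eqI: "(x::plane) $ 1 = y $ 1 \<Longrightarrow> x $ 2 = y $ 2 \<Longrightarrow> x = y"
  by (simp add: vec_eq_iff forall_2)

definition dir :: "real \<Rightarrow> plane" where "dir t = vector [cos t, sin t]"
definition perp :: "real \<Rightarrow> plane" where "perp t = vector [- sin t, cos t]"

lemma dir_nth [simp]: "dir t $ 1 = cos t" "dir t $ 2 = sin t"
  by (simp_all add: dir_def)
lemma perp_nth [simp]: "perp t $ 1 = - sin t" "perp t $ 2 = cos t"
  by (simp_all add: perp_def)

lemma dir_inner_dir: "dir a \<bullet> dir b = cos (a - b)"
  and dir_inner_perp: "dir a \<bullet> perp b = sin (a - b)"
  and perp_inner_dir: "perp a \<bullet> dir b = sin (b - a)"
  and perp_inner_perp: "perp a \<bullet> perp b = cos (a - b)"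
  by (simp_all add: inner_plane cos_diff sin_diff mult.commute)

lemma norm_dir [simp]: "norm (dir t) = 1" and norm_perp [simp]: "norm (perp t) = 1"
  by (simp_all add: norm_eq_sqrt_inner dir_inner_dir perp_inner_perp)

section \<open>Curves with decreasing chord slopes\<close>

text \<open>
  Run a polygon with vertices \<open>B i\<close> at unit speed, with time \<open>t\<close>.  Along an edge \<open>norm x ^ 2 - t ^ 2\<close> is affine in \<open>t\<close>,
  and where the corner is convex as seen from the origin its slope drops.  The number \<open>\<kappa> i\<close> is an upper bound for the product of
  \<open>B i\<close> with the direction of the next edge.  The bound says that the end of the polygon is no further from the origin than
  the end of a straight segment of the same length that leaves \<open>B 0\<close> with slope \<open>\<kappa> 0\<close>.
\<close>

lemma chain_bound:
  fixes B :: "nat \<Rightarrow> plane" and \<kappa> :: "nat \<Rightarrow> real"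
  assumes step: "\<And>i. i < n \<Longrightarrow>
      (norm (B (Suc i)))\<^sup>2 \<le> (norm (B i))\<^sup>2 + (dist (B i) (B (Suc i)))\<^sup>2 + 2 * \<kappa> i * dist (B i) (B (Suc i))"
    and slope: "\<And>i. i < n \<Longrightarrow> \<kappa> (Suc i) \<le> \<kappa> i + dist (B i) (B (Suc i))"
  shows "(norm (B n))\<^sup>2 \<le> (norm (B 0))\<^sup>2 + 2 * \<kappa> 0 * (\<Sum>i<n. dist (B i) (B (Suc i)))
           + (\<Sum>i<n. dist (B i) (B (Suc i)))\<^sup>2"
proof -
  define \<sigma> where "\<sigma> k = (\<Sum>i<k. dist (B i) (B (Suc i)))" for k
  have "k \<le> n \<Longrightarrow> \<kappa> k \<le> \<kappa> 0 + \<sigma> k \<and> (norm (B k))\<^sup>2 \<le> (norm (B 0))\<^sup>2 + 2 * \<kappa> 0 * \<sigma> k + (\<sigma> k)\<^sup>2" for k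
  proof (induction k)
    case 0
    then show ?case by (simp add: \<sigma>_def)
  next
    case (Suc k)
    let ?l = "dist (B k) (B (Suc k))"
    have s: "\<sigma> (Suc k) = \<sigma> k + ?l" by (simp add: \<sigma>_def)
    have ih: "\<kappa> k \<le> \<kappa> 0 + \<sigma> k" "(norm (B k))\<^sup>2 \<le> (norm (B 0))\<^sup>2 + 2 * \<kappa> 0 * \<sigma> k + (\<sigma> k)\<^sup>2"
      using Suc by auto
    have "\<kappa> k * ?l \<le> (\<kappa> 0 + \<sigma> k) * ?l"
      by (intro mult_right_mono ih) simp
    then have "(norm (B (Suc k)))\<^sup>2 \<le> (norm (B 0))\<^sup>2 + 2 * \<kappa> 0 * \<sigma> k + (\<sigma> k)\<^sup>2 + ?l\<^sup>2 + 2 * ((\<kappa> 0 + \<sigma> k) * ?l)"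
      using step[of k] ih Suc.prems by linarith
    also have "\<dots> = (norm (B 0))\<^sup>2 + 2 * \<kappa> 0 * \<sigma> (Suc k) + (\<sigma> (Suc k))\<^sup>2"
      unfolding s by (simp add: power2_eq_square algebra_simps)
    finally show ?case
      using slope[of k] ih Suc.prems s by auto
  qed
  from this[of n] show ?thesis by (simp add: \<sigma>_def)
qed

lemma curve_length_approx:
  assumes "curve_length \<gamma> s t = ereal L" "\<epsilon> > 0"
  obtains n u where "u 0 = s" "u n = t" "mono_on {..n} u"
    "L - \<epsilon> < (\<Sum>i<n. dist (\<gamma> (u i)) (\<gamma> (u (Suc i))))" "(\<Sum>i<n. dist (\<gamma> (u i)) (\<gamma> (u (Suc i)))) \<le> L"
proof -
  define S where "S = {ereal (\<Sum>i<n. dist (\<gamma> (u i)) (\<gamma> (u (Suc i)))) | (n::nat) u. u 0 = s \<and> u n = t \<and> mono_on {..n} u}"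
  have S: "Sup S = ereal L" using assms by (simp add: curve_length_def S_def)
  then have "ereal (L - \<epsilon>) < Sup S" using assms by simp
  then obtain x where x: "x \<in> S" "ereal (L - \<epsilon>) < x" unfolding less_Sup_iff by blast
  then have "x \<le> ereal L" using S Sup_upper by metis
  moreover obtain n :: nat and u where u: "x = ereal (\<Sum>i<n. dist (\<gamma> (u i)) (\<gamma> (u (Suc i))))"
      "u 0 = s" "u n = t" "mono_on {..n} u"
    using x(1) unfolding S_def by blast
  ultimately show ?thesis
    using x(2) that[of u n] by simp
qed

lemma arclength_dist_le:
  assumes "arclength_parametrized J \<gamma>" "s \<in> J" "t \<in> J"
  shows "dist (\<gamma> s) (\<gamma> t) \<le> \<bar>s - t\<bar>"
proof -
  have *: "dist (\<gamma> a) (\<gamma> b) \<le> b - a" if ab: "a \<in> J" "b \<in> J" "a \<le> b" for a b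
  proof -
    define u where "u i = (if i = (0::nat) then a else b)" for i
    have "ereal (\<Sum>i<1. dist (\<gamma> (u i)) (\<gamma> (u (Suc i)))) \<le> curve_length \<gamma> a b"
      unfolding curve_length_def
      by (intro Sup_upper CollectI exI[of _ 1] exI[of _ u]) (auto simp: u_def mono_on_def that)
    also have "\<dots> = ereal (b - a)" using assms(1) ab by (simp add: arclength_parametrized_def)
    finally show ?thesis by (simp add: u_def)
  qed
  show ?thesis
    using *[of s t] *[of t s] assms by (cases "s \<le> t") (auto simp: dist_commute)
qed

lemma curve_length_reverse: "curve_length (\<lambda>t. \<gamma> (- t)) (- t) (- s) = curve_length \<gamma> s t"
proof -
  have sub: "{ereal (\<Sum>i<n. dist (\<gamma> (- u i)) (\<gamma> (- u (Suc i)))) | (n::nat) u. u 0 = - t \<and> u n = - s \<and> mono_on {..n} u}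
     \<subseteq> {ereal (\<Sum>i<n. dist (\<gamma> (u i)) (\<gamma> (u (Suc i)))) | (n::nat) u. u 0 = s \<and> u n = t \<and> mono_on {..n} u}"
    for \<gamma> :: "real \<Rightarrow> plane" and s t
  proof safe
    fix n :: nat and u :: "nat \<Rightarrow> real"
    assume u: "u 0 = - t" "u n = - s" "mono_on {..n} u"
    define v where "v i = - u (n - i)" for i
    have "(\<Sum>i<n. dist (\<gamma> (- u i)) (\<gamma> (- u (Suc i)))) = (\<Sum>i<n. dist (\<gamma> (- u (n - Suc i))) (\<gamma> (- u (Suc (n - Suc i)))))"
      by (rule sum.nat_diff_reindex [symmetric])
    also have "\<dots> = (\<Sum>i<n. dist (\<gamma> (v i)) (\<gamma> (v (Suc i))))"
      by (rule sum.cong) (auto simp: v_def dist_commute Suc_diff_Suc)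
    finally show "\<exists>m w. ereal (\<Sum>i<n. dist (\<gamma> (- u i)) (\<gamma> (- u (Suc i)))) = ereal (\<Sum>i<m. dist (\<gamma> (w i)) (\<gamma> (w (Suc i)))) \<and>
        w 0 = s \<and> w m = t \<and> mono_on {..m} w"
      using u by (intro exI[of _ n] exI[of _ v]) (auto simp: v_def mono_on_def)
  qed
  show ?thesis
    unfolding curve_length_def
    using sub[of \<gamma> t s] sub[of "\<lambda>t. \<gamma> (- t)" "- s" "- t"]
    by (intro arg_cong[where f = Sup]) auto
qed

text \<open>
  The bound for polygons passes to a curve, because inscribed polygons approximate its length.
\<close>

lemma forward_bound:
  assumes len: "curve_length \<delta> m t = ereal (t - m)" and "m \<le> t"
    and step: "\<And>s s'. m \<le> s \<Longrightarrow> s < s' \<Longrightarrow> s' \<le> t \<Longrightarrow>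
      (norm (\<delta> s'))\<^sup>2 \<le> (norm (\<delta> s))\<^sup>2 + (dist (\<delta> s) (\<delta> s'))\<^sup>2 + 2 * \<kappa> s * dist (\<delta> s) (\<delta> s')"
    and slope: "\<And>s s'. m \<le> s \<Longrightarrow> s < s' \<Longrightarrow> s' \<le> t \<Longrightarrow> \<kappa> s' \<le> \<kappa> s + dist (\<delta> s) (\<delta> s')"
  shows "(norm (\<delta> t))\<^sup>2 \<le> (norm (\<delta> m))\<^sup>2 + 2 * \<kappa> m * (t - m) + (t - m)\<^sup>2"
proof -
  have "\<exists>\<sigma>. t - m - 1 / real (Suc k) < \<sigma> \<and> \<sigma> \<le> t - m \<and>
      (norm (\<delta> t))\<^sup>2 \<le> (norm (\<delta> m))\<^sup>2 + 2 * \<kappa> m * \<sigma> + \<sigma>\<^sup>2" for k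
  proof -
    obtain n u where u: "u 0 = m" "u n = t" "mono_on {..n} u"
      "t - m - 1 / real (Suc k) < (\<Sum>i<n. dist (\<delta> (u i)) (\<delta> (u (Suc i))))"
      "(\<Sum>i<n. dist (\<delta> (u i)) (\<delta> (u (Suc i)))) \<le> t - m"
      by (rule curve_length_approx[OF len, of "1 / real (Suc k)"]) simp
    have mono: "u i \<le> u j" if "i \<le> j" "j \<le> n" for i j
      using u(3) that by (auto simp: mono_on_def)
    have rng: "m \<le> u i" "u i \<le> t" if "i \<le> n" for i
      using mono[of 0 i] mono[of i n] that u by auto
    have "(norm (\<delta> (u n)))\<^sup>2 \<le> (norm (\<delta> (u 0)))\<^sup>2 + 2 * \<kappa> (u 0) * (\<Sum>i<n. dist (\<delta> (u i)) (\<delta> (u (Suc i))))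
           + (\<Sum>i<n. dist (\<delta> (u i)) (\<delta> (u (Suc i))))\<^sup>2"
    proof (rule chain_bound[of n "\<lambda>i. \<delta> (u i)" "\<lambda>i. \<kappa> (u i)"])
      fix i assume i: "i < n"
      have "u i = u (Suc i) \<or> u i < u (Suc i)" using mono[of i "Suc i"] i by auto
      then show "(norm (\<delta> (u (Suc i))))\<^sup>2 \<le> (norm (\<delta> (u i)))\<^sup>2 + (dist (\<delta> (u i)) (\<delta> (u (Suc i))))\<^sup>2
            + 2 * \<kappa> (u i) * dist (\<delta> (u i)) (\<delta> (u (Suc i)))"
        using step[of "u i" "u (Suc i)"] rng i by auto
      show "\<kappa> (u (Suc i)) \<le> \<kappa> (u i) + dist (\<delta> (u i)) (\<delta> (u (Suc i)))"
        using slope[of "u i" "u (Suc i)"] rng i \<open>u i = u (Suc i) \<or> u i < u (Suc i)\<close> by auto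
    qed
    then show ?thesis
      using u(4,5) unfolding u(1,2) by blast
  qed
  then obtain \<sigma> where \<sigma>: "\<And>k. t - m - 1 / real (Suc k) < \<sigma> k" "\<And>k. \<sigma> k \<le> t - m"
      "\<And>k. (norm (\<delta> t))\<^sup>2 \<le> (norm (\<delta> m))\<^sup>2 + 2 * \<kappa> m * \<sigma> k + (\<sigma> k)\<^sup>2" by metis
  have "(\<lambda>k. t - m - 1 / real (Suc k)) \<longlonglongrightarrow> t - m - 0"
    by (intro tendsto_intros) (use LIMSEQ_inverse_real_of_nat in \<open>simp add: inverse_eq_divide\<close>)
  then have lim: "\<sigma> \<longlonglongrightarrow> t - m"
    using \<sigma> by (intro tendsto_sandwich[of "\<lambda>k. t - m - 1 / real (Suc k)" \<sigma> _ "\<lambda>_. t - m"])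
      (auto intro!: always_eventually less_imp_le)
  have "(\<lambda>k. (norm (\<delta> m))\<^sup>2 + 2 * \<kappa> m * \<sigma> k + (\<sigma> k)\<^sup>2) \<longlonglongrightarrow> (norm (\<delta> m))\<^sup>2 + 2 * \<kappa> m * (t - m) + (t - m)\<^sup>2"
    by (intro tendsto_intros lim)
  then show ?thesis
    using \<sigma>(3) by (intro LIMSEQ_le_const[of _ _ "(norm (\<delta> t))\<^sup>2"]) auto
qed

lemma concave_on_if_supergradients:
  fixes f :: "real \<Rightarrow> real"
  assumes "convex I" and sup: "\<And>m. m \<in> I \<Longrightarrow> \<exists>c. \<forall>t\<in>I. f t \<le> f m + c * (t - m)"
  shows "concave_on I f"
  unfolding concave_on_iff
proof (intro conjI ballI allI impI)
  fix x y and u v :: real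
  assume xy: "x \<in> I" "y \<in> I" and uv: "0 \<le> u" "0 \<le> v" "u + v = 1"
  define m where "m = u * x + v * y"
  have "m \<in> I" using convexD[OF assms(1) xy uv] by (simp add: m_def)
  then obtain c where c: "\<And>t. t \<in> I \<Longrightarrow> f t \<le> f m + c * (t - m)" using sup by blast
  have "u * f x + v * f y \<le> u * (f m + c * (x - m)) + v * (f m + c * (y - m))"
    using uv xy by (intro add_mono mult_left_mono c) auto
  also have "\<dots> = (u + v) * f m + c * ((u * x + v * y) - (u + v) * m)" by (simp add: algebra_simps)
  also have "\<dots> = f m" using uv by (simp add: m_def)
  finally show "f (u *\<^sub>R x + v *\<^sub>R y) \<ge> u * f x + v * f y" by (simp add: m_def)
qed (use assms in auto)

text \<open>
  By hypothesis every polygon inscribed in \<open>\<delta>\<close> has convex corners.  At each time \<open>m\<close> the number \<open>\<kappa> m\<close> separates the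
  slopes of the chords to later points from those of the chords to earlier points; up to a factor and the term coming from
  \<open>t ^ 2\<close> it is a supergradient at \<open>m\<close>, by the comparison with a straight line in both time directions.
\<close>

lemma concave_if_chord_slopes_decrease:
  fixes \<delta> :: "real \<Rightarrow> plane"
  assumes len: "arclength_parametrized {lo<..<hi} \<delta>"
    and inj: "\<And>s t. lo < s \<Longrightarrow> s < t \<Longrightarrow> t < hi \<Longrightarrow> \<delta> s \<noteq> \<delta> t"
    and slopes: "\<And>s m t. lo < s \<Longrightarrow> s < m \<Longrightarrow> m < t \<Longrightarrow> t < hi \<Longrightarrow>
      \<delta> m \<bullet> (\<delta> t - \<delta> m) / dist (\<delta> m) (\<delta> t) \<le> \<delta> m \<bullet> (\<delta> m - \<delta> s) / dist (\<delta> s) (\<delta> m)"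
  shows "concave_on {lo<..<hi} (\<lambda>t. (norm (\<delta> t))\<^sup>2 - t\<^sup>2)"
proof -
  define \<kappa> where "\<kappa> m = (SUP t\<in>{m<..<hi}. \<delta> m \<bullet> (\<delta> t - \<delta> m) / dist (\<delta> m) (\<delta> t))" for m
  have fw: "\<delta> m \<bullet> (\<delta> t - \<delta> m) \<le> \<kappa> m * dist (\<delta> m) (\<delta> t)" if "lo < m" "m < t" "t < hi" for m t
  proof -
    obtain s where s: "lo < s" "s < m" using dense \<open>lo < m\<close> by blast
    have "\<delta> m \<bullet> (\<delta> t - \<delta> m) / dist (\<delta> m) (\<delta> t) \<le> \<kappa> m"
      unfolding \<kappa>_def
      by (rule cSUP_upper) (use s that slopes in \<open>auto intro!: bdd_aboveI2[of _ _ "\<delta> m \<bullet> (\<delta> m - \<delta> s) / dist (\<delta> s) (\<delta> m)"]\<close>)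
    then show ?thesis using inj[of m t] that by (simp add: pos_divide_le_eq)
  qed
  have bw: "\<kappa> m * dist (\<delta> s) (\<delta> m) \<le> \<delta> m \<bullet> (\<delta> m - \<delta> s)" if "lo < s" "s < m" "m < hi" for s m
  proof -
    have "\<kappa> m \<le> \<delta> m \<bullet> (\<delta> m - \<delta> s) / dist (\<delta> s) (\<delta> m)"
      unfolding \<kappa>_def by (rule cSUP_least) (use that slopes in auto)
    then show ?thesis using inj[of s m] that by (simp add: pos_le_divide_eq)
  qed
  have sq: "(norm b)\<^sup>2 = (norm a)\<^sup>2 + (dist a b)\<^sup>2 + 2 * (a \<bullet> (b - a))" for a b :: plane
    by (simp add: power2_norm_eq_inner dist_norm inner_diff inner_commute)
  have slope: "\<kappa> s' \<le> \<kappa> s + dist (\<delta> s) (\<delta> s')" if "lo < s" "s < s'" "s' < hi" for s s'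
  proof -
    have "\<kappa> s' * dist (\<delta> s) (\<delta> s') \<le> \<delta> s' \<bullet> (\<delta> s' - \<delta> s)" by (rule bw) fact+
    also have "\<dots> = \<delta> s \<bullet> (\<delta> s' - \<delta> s) + (dist (\<delta> s) (\<delta> s'))\<^sup>2"
      by (simp add: power2_norm_eq_inner dist_norm inner_diff inner_commute)
    also have "\<dots> \<le> \<kappa> s * dist (\<delta> s) (\<delta> s') + (dist (\<delta> s) (\<delta> s'))\<^sup>2"
      using fw[of s s'] that by simp
    also have "\<dots> = (\<kappa> s + dist (\<delta> s) (\<delta> s')) * dist (\<delta> s) (\<delta> s')"
      by (simp add: power2_eq_square algebra_simps)
    finally show ?thesis using inj[of s s'] that by simp
  qed
  have fwd: "(norm (\<delta> t))\<^sup>2 \<le> (norm (\<delta> m))\<^sup>2 + 2 * \<kappa> m * (t - m) + (t - m)\<^sup>2"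
    if mt: "lo < m" "m \<le> t" "t < hi" for m t
  proof (rule forward_bound)
    show "curve_length \<delta> m t = ereal (t - m)" using len mt by (auto simp: arclength_parametrized_def)
    fix s s' assume "m \<le> s" "s < s'" "s' \<le> t"
    then have *: "lo < s" "s < s'" "s' < hi" using mt by auto
    show "(norm (\<delta> s'))\<^sup>2 \<le> (norm (\<delta> s))\<^sup>2 + (dist (\<delta> s) (\<delta> s'))\<^sup>2 + 2 * \<kappa> s * dist (\<delta> s) (\<delta> s')"
      using fw[OF *] sq[of "\<delta> s'" "\<delta> s"] by linarith
    show "\<kappa> s' \<le> \<kappa> s + dist (\<delta> s) (\<delta> s')" using slope * by blast
  qed fact
  have bwd: "(norm (\<delta> s))\<^sup>2 \<le> (norm (\<delta> m))\<^sup>2 - 2 * \<kappa> m * (m - s) + (m - s)\<^sup>2"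
    if sm: "lo < s" "s \<le> m" "m < hi" for m s
  proof -
    have "(norm (\<delta> (- (- s))))\<^sup>2 \<le> (norm (\<delta> (- (- m))))\<^sup>2 + 2 * (- \<kappa> (- (- m))) * (- s - (- m)) + (- s - (- m))\<^sup>2"
    proof (rule forward_bound[of "\<lambda>t. \<delta> (- t)" "- m" "- s" "\<lambda>t. - \<kappa> (- t)"])
      show "curve_length (\<lambda>t. \<delta> (- t)) (- m) (- s) = ereal (- s - - m)"
        using len sm by (auto simp: arclength_parametrized_def curve_length_reverse)
      fix t t' assume "- m \<le> t" "t < t'" "t' \<le> - s"
      then have *: "lo < - t'" "- t' < - t" "- t < hi" using sm by auto
      show "(norm (\<delta> (- t')))\<^sup>2 \<le> (norm (\<delta> (- t)))\<^sup>2 + (dist (\<delta> (- t)) (\<delta> (- t')))\<^sup>2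
          + 2 * - \<kappa> (- t) * dist (\<delta> (- t)) (\<delta> (- t'))"
        using bw[OF *] sq[of "\<delta> (- t')" "\<delta> (- t)"] by (simp add: dist_commute inner_diff_right algebra_simps)
      show "- \<kappa> (- t') \<le> - \<kappa> (- t) + dist (\<delta> (- t)) (\<delta> (- t'))"
        using slope[OF *] by (simp add: dist_commute)
    qed (use sm in auto)
    then show ?thesis by simp
  qed
  show ?thesis
  proof (rule concave_on_if_supergradients)
    fix m assume m: "m \<in> {lo<..<hi}"
    have "(norm (\<delta> t))\<^sup>2 - t\<^sup>2 \<le> (norm (\<delta> m))\<^sup>2 - m\<^sup>2 + (2 * \<kappa> m - 2 * m) * (t - m)" if "t \<in> {lo<..<hi}" for t
      using fwd[of m t] bwd[of t m] that m
      by (cases "m \<le> t") (auto simp: power2_eq_square algebra_simps)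
    then show "\<exists>c. \<forall>t\<in>{lo<..<hi}. (norm (\<delta> t))\<^sup>2 - t\<^sup>2 \<le> (norm (\<delta> m))\<^sup>2 - m\<^sup>2 + c * (t - m)" by blast
  qed simp
qed

section \<open>Convex developments\<close>

lemma dir_nonzero [simp]: "dir t \<noteq> 0"
  using norm_dir[of t] by (metis norm_zero zero_neq_one)

lemma concave_on_transform:
  assumes "concave_on S f" "\<And>x. x \<in> S \<Longrightarrow> f x = g x"
  shows "concave_on S g"
proof -
  have "convex S" using assms(1) by (simp add: concave_on_iff)
  then have "u *\<^sub>R x + v *\<^sub>R y \<in> S" if "x \<in> S" "y \<in> S" "0 \<le> u" "0 \<le> v" "u + v = 1" for x y u v
    using that convexD by blast
  with assms show ?thesis unfolding concave_on_iff by auto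
qed

text \<open>
  The segment from \<open>A\<close> to \<open>C\<close> passes through \<open>\<nu> *\<^sub>R B\<close>, so it meets the line through the origin and \<open>B\<close> not beyond \<open>B\<close>.
  Hence the sum of the unit vectors from \<open>B\<close> to \<open>A\<close> and from \<open>B\<close> to \<open>C\<close> does not point away from the origin.
\<close>

lemma corner_slopes:
  fixes A B C :: plane
  assumes "x > 0" "y > 0" "\<nu> \<le> 1" and eq: "x *\<^sub>R A + y *\<^sub>R C = ((x + y) * \<nu>) *\<^sub>R B"
    and ne: "A \<noteq> B" "C \<noteq> B"
  shows "B \<bullet> (C - B) / dist B C \<le> B \<bullet> (B - A) / dist A B"
proof -
  define a where "a = A - B"
  define c where "c = C - B"
  define k where "k = (x + y) * (1 - \<nu>)"
  have k: "k \<ge> 0" using assms by (simp add: k_def)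
  have e: "x *\<^sub>R a + y *\<^sub>R c = - (k *\<^sub>R B)"
    using eq by (simp add: a_def c_def k_def algebra_simps)
  have na: "norm a > 0" "norm c > 0" using ne by (auto simp: a_def c_def)
  define a' where "a' = a /\<^sub>R norm a"
  define c' where "c' = c /\<^sub>R norm c"
  define \<alpha> where "\<alpha> = x * norm a"
  define \<beta> where "\<beta> = y * norm c"
  have pos: "\<alpha> > 0" "\<beta> > 0" using na assms by (auto simp: \<alpha>_def \<beta>_def)
  have u: "norm a' = 1" "norm c' = 1" using na by (auto simp: a'_def c'_def)
  have e': "\<alpha> *\<^sub>R a' + \<beta> *\<^sub>R c' = - (k *\<^sub>R B)"
  proof -
    have "\<alpha> *\<^sub>R a' = x *\<^sub>R a" "\<beta> *\<^sub>R c' = y *\<^sub>R c"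
      using na by (simp_all add: \<alpha>_def \<beta>_def a'_def c'_def mult.assoc)
    then show ?thesis using e by simp
  qed
  have "B \<bullet> (a' + c') \<le> 0"
  proof (cases "k = 0")
    case True
    with e' have h: "\<alpha> *\<^sub>R a' = - (\<beta> *\<^sub>R c')" by (simp add: eq_neg_iff_add_eq_0)
    then have "norm (\<alpha> *\<^sub>R a') = norm (\<beta> *\<^sub>R c')" by simp
    with u pos have "\<alpha> = \<beta>" by simp
    then have "\<alpha> *\<^sub>R (a' + c') = 0" using h by (simp add: scaleR_add_right)
    with pos show ?thesis by simp
  next
    case False
    have ac: "a' \<bullet> a' = 1" "c' \<bullet> c' = 1" using u by (simp_all add: norm_eq_1)
    have "\<bar>a' \<bullet> c'\<bar> \<le> 1" using Cauchy_Schwarz_ineq2[of a' c'] u by simp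
    have "- (k * (B \<bullet> (a' + c'))) = (- (k *\<^sub>R B)) \<bullet> (a' + c')" by simp
    also have "\<dots> = (\<alpha> + \<beta>) * (1 + a' \<bullet> c')"
      unfolding e'[symmetric] by (simp add: inner_add ac inner_commute algebra_simps)
    also have "\<dots> \<ge> 0" using pos \<open>\<bar>a' \<bullet> c'\<bar> \<le> 1\<close> by simp
    finally have "k * (B \<bullet> (a' + c')) \<le> 0" by simp
    with False k show ?thesis by (simp add: mult_le_0_iff)
  qed
  then have "B \<bullet> c' \<le> - (B \<bullet> a')" by (simp add: inner_add)
  then show ?thesis
    by (simp add: a'_def c'_def a_def c_def dist_norm norm_minus_commute inner_diff_right divide_inverse algebra_simps)
qed

lemma developmentD:
  assumes "development J \<gamma> p 0 \<delta> \<theta>"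
  shows "arclength_parametrized J \<delta>" "\<And>t. t \<in> J \<Longrightarrow> norm (\<delta> t) = dist p (\<gamma> t)"
    "continuous_on J \<theta>" "\<And>s t. s \<in> J \<Longrightarrow> t \<in> J \<Longrightarrow> s \<le> t \<Longrightarrow> \<theta> t \<le> \<theta> s"
    "\<And>t. t \<in> J \<Longrightarrow> \<delta> t = dist p (\<gamma> t) *\<^sub>R dir (\<theta> t)"
  using assms unfolding development_def
  by (auto simp: monotone_on_def dir_def dist_norm)

lemma dir_same_angle:
  assumes "r *\<^sub>R dir a = s *\<^sub>R dir b" "r > 0" "s > 0" "\<bar>a - b\<bar> < 2 * pi"
  shows "a = b"
proof -
  have "norm (r *\<^sub>R dir a) = norm (s *\<^sub>R dir b)" by (simp only: assms(1))
  then have "r = s" using assms(2,3) by (simp only: norm_scaleR norm_dir)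
  then have "dir a = dir b" using assms by simp
  then have "cos (a - b) = 1" by (metis cos_zero diff_self dir_inner_dir)
  then obtain n :: int where "a - b = of_int n * 2 * pi" using cos_one_2pi_int by blast
  moreover have "n = 0"
  proof (rule ccontr)
    assume "n \<noteq> 0"
    then have "1 \<le> \<bar>real_of_int n\<bar>" by linarith
    then have "2 * pi \<le> \<bar>real_of_int n\<bar> * (2 * pi)" using pi_gt_zero by simp
    then show False using assms calculation by (simp add: abs_mult mult.assoc)
  qed
  ultimately show ?thesis by simp
qed

text \<open>
  The chord from \<open>\<delta> s\<close> to \<open>\<delta> t\<close> meets the ray through \<open>\<delta> m\<close> in a point of the convex region swept by the development.
  As the polar angle is strictly decreasing, \<open>\<delta> m\<close> is the only point of the curve on this ray, so the chord meets the
  ray no further out than at \<open>\<delta> m\<close>.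
\<close>

lemma development_slopes:
  assumes dev: "development J \<gamma> p 0 \<delta> \<theta>" and conv: "convex_development J 0 \<delta> \<theta>"
    and J: "{s..t} \<subseteq> J" and sm: "s < m" "m < t" and sweep: "\<theta> s - \<theta> t < pi"
    and strict: "\<And>s t. s \<in> J \<Longrightarrow> t \<in> J \<Longrightarrow> s < t \<Longrightarrow> \<theta> t < \<theta> s"
    and off: "p \<notin> \<gamma> ` J"
  shows "\<delta> m \<bullet> (\<delta> t - \<delta> m) / dist (\<delta> m) (\<delta> t) \<le> \<delta> m \<bullet> (\<delta> m - \<delta> s) / dist (\<delta> s) (\<delta> m)"
proof -
  note d = developmentD[OF dev]
  define r where "r t = dist p (\<gamma> t)" for t
  have inJ: "s \<in> J" "m \<in> J" "t \<in> J" using J sm by auto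
  have r: "r q > 0" if "q \<in> J" for q using off that by (auto simp: r_def)
  have \<delta>: "\<delta> q = r q *\<^sub>R dir (\<theta> q)" if "q \<in> J" for q using d(5) that by (simp add: r_def)
  have th: "\<theta> t < \<theta> m" "\<theta> m < \<theta> s" using strict inJ sm by auto
  define x where "x = sin (\<theta> m - \<theta> t) / r s"
  define y where "y = sin (\<theta> s - \<theta> m) / r t"
  have xy: "x > 0" "y > 0"
    using th sweep r inJ by (auto simp: x_def y_def intro!: divide_pos_pos sin_gt_zero)
  have sinp: "sin (\<theta> s - \<theta> t) > 0" using th sweep by (intro sin_gt_zero) auto
  have comb: "x *\<^sub>R \<delta> s + y *\<^sub>R \<delta> t = sin (\<theta> s - \<theta> t) *\<^sub>R dir (\<theta> m)"
  proof -
    have "x *\<^sub>R \<delta> s + y *\<^sub>R \<delta> t = sin (\<theta> m - \<theta> t) *\<^sub>R dir (\<theta> s) + sin (\<theta> s - \<theta> m) *\<^sub>R dir (\<theta> t)"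
      using r[of s] r[of t] inJ by (simp add: \<delta> x_def y_def)
    also have "\<dots> = sin (\<theta> s - \<theta> t) *\<^sub>R dir (\<theta> m)"
    proof (rule plane_eqI)
      have sq: "(sin a)\<^sup>2 + (cos a)\<^sup>2 = 1" for a :: real by simp
      show "(sin (\<theta> m - \<theta> t) *\<^sub>R dir (\<theta> s) + sin (\<theta> s - \<theta> m) *\<^sub>R dir (\<theta> t)) $ 1 = (sin (\<theta> s - \<theta> t) *\<^sub>R dir (\<theta> m)) $ 1"
        by (simp add: sin_diff algebra_simps)
      show "(sin (\<theta> m - \<theta> t) *\<^sub>R dir (\<theta> s) + sin (\<theta> s - \<theta> m) *\<^sub>R dir (\<theta> t)) $ 2 = (sin (\<theta> s - \<theta> t) *\<^sub>R dir (\<theta> m)) $ 2"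
        by (simp add: sin_diff algebra_simps)
    qed
    finally show ?thesis .
  qed
  define k where "k = sin (\<theta> s - \<theta> t) / (x + y)"
  have k: "k > 0" using sinp xy by (simp add: k_def)
  define R where "R = (\<Union>q\<in>{s..t}. closed_segment 0 (\<delta> q))"
  have "convex R"
  proof -
    have "(s + t) / 2 - (t - s) / 2 = s" "(s + t) / 2 + (t - s) / 2 = t" by (auto simp: field_simps)
    then show ?thesis
      using conv[unfolded convex_development_def, rule_format, of "(t - s) / 2" "(s + t) / 2"] inJ sm sweep
      by (simp add: R_def)
  qed
  moreover have "\<delta> s \<in> R" "\<delta> t \<in> R" using sm by (auto simp: R_def)
  ultimately have "(x / (x + y)) *\<^sub>R \<delta> s + (y / (x + y)) *\<^sub>R \<delta> t \<in> R"
    using xy by (intro convexD) (auto simp: add_divide_distrib[symmetric])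
  also have "(x / (x + y)) *\<^sub>R \<delta> s + (y / (x + y)) *\<^sub>R \<delta> t = (1 / (x + y)) *\<^sub>R (x *\<^sub>R \<delta> s + y *\<^sub>R \<delta> t)"
    by (simp add: scaleR_add_right)
  also have "\<dots> = k *\<^sub>R dir (\<theta> m)" by (simp add: comb k_def)
  finally obtain q \<nu> where q: "q \<in> {s..t}" "0 \<le> \<nu>" "\<nu> \<le> 1" "k *\<^sub>R dir (\<theta> m) = \<nu> *\<^sub>R \<delta> q"
    by (auto simp: R_def closed_segment_def)
  then have "q \<in> J" using J by auto
  have eq: "k *\<^sub>R dir (\<theta> m) = (\<nu> * r q) *\<^sub>R dir (\<theta> q)" using q \<delta> \<open>q \<in> J\<close> by simp
  have "\<nu> \<noteq> 0"
  proof
    assume "\<nu> = 0"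
    then have "norm (k *\<^sub>R dir (\<theta> m)) = 0" using eq by simp
    then show False using k by simp
  qed
  then have "\<nu> * r q > 0" using q r \<open>q \<in> J\<close> by simp
  have "\<theta> t \<le> \<theta> q" "\<theta> q \<le> \<theta> s" using d(4) q inJ \<open>q \<in> J\<close> by auto
  then have "\<bar>\<theta> m - \<theta> q\<bar> < 2 * pi" using th sweep pi_gt_zero by linarith
  then have "\<theta> m = \<theta> q" using dir_same_angle[OF eq] k \<open>\<nu> * r q > 0\<close> by blast
  then have "q = m" using strict[of q m] strict[of m q] \<open>q \<in> J\<close> inJ by (metis linorder_neqE less_irrefl)
  have "x *\<^sub>R \<delta> s + y *\<^sub>R \<delta> t = (x + y) *\<^sub>R (k *\<^sub>R dir (\<theta> m))"
    unfolding comb k_def using xy by simp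
  also have "\<dots> = ((x + y) * \<nu>) *\<^sub>R \<delta> m" using q \<open>q = m\<close> by simp
  finally have comb2: "x *\<^sub>R \<delta> s + y *\<^sub>R \<delta> t = ((x + y) * \<nu>) *\<^sub>R \<delta> m" .
  have ne: "\<delta> a \<noteq> \<delta> b" if "a \<in> {s,m,t}" "b \<in> {s,m,t}" "a \<noteq> b" for a b
  proof
    assume "\<delta> a = \<delta> b"
    have "a \<in> J" "b \<in> J" using that inJ by auto
    moreover have "\<bar>\<theta> a - \<theta> b\<bar> < 2 * pi" using that th sweep pi_gt_zero by auto
    ultimately have "\<theta> a = \<theta> b" using dir_same_angle[of "r a" "\<theta> a" "r b" "\<theta> b"] \<open>\<delta> a = \<delta> b\<close> \<delta> r by auto
    then show False using that th by auto
  qed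
  show ?thesis
    by (rule corner_slopes[OF xy q(3) comb2]) (use ne sm in auto)
qed

text \<open>
  To sweep the angle \<open>pi\<close> around the origin the curve would have to reach the opposite ray, which is further away than the
  length of the curve allows.
\<close>

lemma development_sweep:
  assumes dev: "development J \<gamma> p 0 \<delta> \<theta>" and J: "{s..t} \<subseteq> J" and st: "s \<le> t"
    and far: "\<And>q. q \<in> {s..t} \<Longrightarrow> t - s < dist p (\<gamma> q)"
  shows "\<theta> s - \<theta> t < pi"
proof (rule ccontr)
  note d = developmentD[OF dev]
  assume "\<not> ?thesis"
  then have h: "\<theta> t \<le> \<theta> s - pi" by simp
  have "continuous_on {s..t} \<theta>" using d(3) J continuous_on_subset by blast
  then obtain q where q: "s \<le> q" "q \<le> t" "\<theta> q = \<theta> s - pi"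
    using IVT2'[of \<theta> t "\<theta> s - pi" s] h st pi_gt_zero by auto
  have inJ: "s \<in> J" "q \<in> J" using J q st by auto
  have "dir (\<theta> q) = - dir (\<theta> s)" by (rule plane_eqI) (simp_all add: q(3))
  then have "\<delta> s - \<delta> q = (dist p (\<gamma> s) + dist p (\<gamma> q)) *\<^sub>R dir (\<theta> s)"
    using d(5) inJ by (simp add: algebra_simps)
  then have "dist (\<delta> s) (\<delta> q) = dist p (\<gamma> s) + dist p (\<gamma> q)" by (simp add: dist_norm)
  moreover have "dist (\<delta> s) (\<delta> q) \<le> \<bar>s - q\<bar>" using arclength_dist_le[OF d(1)] inJ by blast
  moreover have "t - s < dist p (\<gamma> s)" using far st by auto
  moreover have "dist p (\<gamma> q) \<ge> 0" by simp
  ultimately show False using q by linarith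
qed

lemma good_development_concave:
  assumes dev: "development J \<gamma> p 0 \<delta> \<theta>" and conv: "convex_development J 0 \<delta> \<theta>"
    and J: "{lo<..<hi} \<subseteq> J"
    and strict: "\<And>s t. s \<in> J \<Longrightarrow> t \<in> J \<Longrightarrow> s < t \<Longrightarrow> \<theta> t < \<theta> s"
    and far: "\<And>q. q \<in> {lo<..<hi} \<Longrightarrow> hi - lo < dist p (\<gamma> q)"
    and off: "p \<notin> \<gamma> ` J"
  shows "concave_on {lo<..<hi} (\<lambda>t. (dist p (\<gamma> t))\<^sup>2 - t\<^sup>2)"
proof -
  note d = developmentD[OF dev]
  have sweep: "\<theta> s - \<theta> t < pi" if "lo < s" "s \<le> t" "t < hi" for s t
  proof (rule development_sweep[OF dev])
    show "t - s < dist p (\<gamma> q)" if "q \<in> {s..t}" for q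
      using far[of q] that \<open>lo < s\<close> \<open>t < hi\<close> by auto
  qed (use J that in auto)
  have "concave_on {lo<..<hi} (\<lambda>t. (norm (\<delta> t))\<^sup>2 - t\<^sup>2)"
  proof (rule concave_if_chord_slopes_decrease)
    show "arclength_parametrized {lo<..<hi} \<delta>"
      using d(1) J unfolding arclength_parametrized_def by blast
    show "\<delta> s \<noteq> \<delta> t" if "lo < s" "s < t" "t < hi" for s t
    proof
      assume eq: "\<delta> s = \<delta> t"
      have st: "s \<in> J" "t \<in> J" using that J by auto
      have "\<theta> t < \<theta> s" "\<theta> s - \<theta> t < pi" using strict st sweep that by auto
      moreover have "dist p (\<gamma> s) > 0" "dist p (\<gamma> t) > 0" using st off by auto
      ultimately have "\<theta> s = \<theta> t"
        using dir_same_angle[of "dist p (\<gamma> s)" "\<theta> s" "dist p (\<gamma> t)" "\<theta> t"] eq d(5) st by auto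
      with \<open>\<theta> t < \<theta> s\<close> show False by simp
    qed
    fix s m t assume *: "lo < s" "s < m" "m < t" "t < hi"
    show "\<delta> m \<bullet> (\<delta> t - \<delta> m) / dist (\<delta> m) (\<delta> t) \<le> \<delta> m \<bullet> (\<delta> m - \<delta> s) / dist (\<delta> s) (\<delta> m)"
      using * J sweep[of s t]
      by (intro development_slopes[OF dev conv _ _ _ _ strict off]) auto
  qed
  moreover have "(norm (\<delta> t))\<^sup>2 - t\<^sup>2 = (dist p (\<gamma> t))\<^sup>2 - t\<^sup>2" if "t \<in> {lo<..<hi}" for t
    using d(2) J that by auto
  ultimately show ?thesis by (rule concave_on_transform)
qed

section \<open>Radial developments are exceptional\<close>

text \<open>
  Where the polar angle is constant, the development moves on a ray, and its length is the total variation of the distance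
  to \<open>p\<close>.
\<close>

lemma development_radial_variation:
  assumes dev: "development J \<gamma> p 0 \<delta> \<theta>" and J: "{q1..q2} \<subseteq> J" and eq: "\<theta> q1 = \<theta> q2"
    and st: "q1 \<le> s" "s < t" "t \<le> q2" and "c < t - s"
  obtains n u where "u 0 = s" "u n = t" "mono_on {..n} u"
    "c < (\<Sum>i<n. \<bar>dist p (\<gamma> (u i)) - dist p (\<gamma> (u (Suc i)))\<bar>)"
proof -
  note d = developmentD[OF dev]
  have const: "\<theta> q = \<theta> q1" if "q \<in> {q1..q2}" for q
  proof -
    have "q1 \<in> J" "q \<in> J" "q2 \<in> J" "q1 \<le> q" "q \<le> q2" using that J by auto
    then show ?thesis using d(4)[of q1 q] d(4)[of q q2] eq by simp
  qed
  have "curve_length \<delta> s t = ereal (t - s)"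
    using d(1) st J unfolding arclength_parametrized_def by (simp add: subset_iff)
  then obtain n u where u: "u 0 = s" "u n = t" "mono_on {..n} u"
    "t - s - (t - s - c) < (\<Sum>i<n. dist (\<delta> (u i)) (\<delta> (u (Suc i))))"
    by (rule curve_length_approx[of _ _ _ _ "t - s - c"]) (use assms in simp)
  have rng: "u i \<in> {q1..q2}" if "i \<le> n" for i
  proof -
    have "u 0 \<le> u i" "u i \<le> u n" using u(3) that by (auto simp: mono_on_def)
    then show ?thesis using u st by auto
  qed
  have "dist (\<delta> (u i)) (\<delta> (u (Suc i))) = \<bar>dist p (\<gamma> (u i)) - dist p (\<gamma> (u (Suc i)))\<bar>" if "i < n" for i
  proof -
    have in': "u i \<in> {q1..q2}" "u (Suc i) \<in> {q1..q2}" using rng that by auto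
    have "\<delta> (u i) - \<delta> (u (Suc i)) = (dist p (\<gamma> (u i)) - dist p (\<gamma> (u (Suc i)))) *\<^sub>R dir (\<theta> q1)"
      using d(5)[of "u i"] d(5)[of "u (Suc i)"] const[OF in'(1)] const[OF in'(2)] in' J
      by (simp add: scaleR_diff_left subset_iff)
    then show ?thesis by (simp add: dist_norm)
  qed
  then have "(\<Sum>i<n. dist (\<delta> (u i)) (\<delta> (u (Suc i)))) = (\<Sum>i<n. \<bar>dist p (\<gamma> (u i)) - dist p (\<gamma> (u (Suc i)))\<bar>)"
    by (intro sum.cong) auto
  with u show ?thesis by (intro that[of u n]) auto
qed

text \<open>
  A displacement near \<open>x\<close> cannot change at full rate both the distance to \<open>p\<close> and the distance to \<open>p'\<close>, when these points
  are seen from \<open>x\<close> in directions that are not parallel.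
\<close>

lemma two_distances_contract:
  fixes x p p' :: plane
  assumes ind: "\<And>c. p - x \<noteq> c *\<^sub>R (p' - x)" and ne: "p' \<noteq> x"
  obtains \<kappa> h where "0 < \<kappa>" "\<kappa> \<le> 1" "0 < h"
    "\<And>y z. dist y x < h \<Longrightarrow> dist z x < h \<Longrightarrow>
       \<bar>dist p y - dist p z\<bar> + \<bar>dist p' y - dist p' z\<bar> \<le> (2 - \<kappa>) * dist y z"
proof -
  have ne': "p \<noteq> x" using ind[of 0] by auto
  define m where "m q yz = (1 / (dist q (fst yz) + dist q (snd yz))) *\<^sub>R (fst yz + snd yz - 2 *\<^sub>R q)"
    for q :: plane and yz :: "plane \<times> plane"
  have lim: "(m q \<longlongrightarrow> (1 / dist q x) *\<^sub>R (x - q)) (at (x, x))" if "q \<noteq> x" for q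
  proof -
    have "isCont (m q) (x, x)"
      unfolding m_def using that by (intro continuous_intros) auto
    moreover have "m q (x, x) = (1 / dist q x) *\<^sub>R (x - q)"
    proof -
      have "x + x - 2 *\<^sub>R q = 2 *\<^sub>R (x - q)" by (simp add: algebra_simps scaleR_2)
      then show ?thesis by (simp add: m_def)
    qed
    ultimately show ?thesis by (simp add: isCont_def)
  qed
  define e where "e = (1 / dist p x) *\<^sub>R (x - p)"
  define e' where "e' = (1 / dist p' x) *\<^sub>R (x - p')"
  have n: "norm e = 1" "norm e' = 1" using ne ne' by (auto simp: e_def e'_def dist_norm norm_minus_commute)
  have px: "x - p = dist p x *\<^sub>R e" "x - p' = dist p' x *\<^sub>R e'" using ne ne' by (auto simp: e_def e'_def)
  have no: "e \<noteq> s *\<^sub>R e'" for s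
  proof
    assume "e = s *\<^sub>R e'"
    then have "x - p = (dist p x * s / dist p' x) *\<^sub>R (dist p' x *\<^sub>R e')" using px ne by simp
    then have "x - p = (dist p x * s / dist p' x) *\<^sub>R (x - p')" using px by simp
    then have "p - x = (dist p x * s / dist p' x) *\<^sub>R (p' - x)"
      by (metis minus_diff_eq scaleR_minus_right)
    then show False using ind by blast
  qed
  have lt: "norm (e + e') < 2" "norm (e - e') < 2"
  proof -
    have "norm (e + e') \<noteq> norm e + norm e'" using no[of 1] n norm_triangle_eq[of e e'] by auto
    moreover have "norm (e + (- e')) \<noteq> norm e + norm (- e')" using no[of "- 1"] n norm_triangle_eq[of e "- e'"] by auto
    ultimately show "norm (e + e') < 2" "norm (e - e') < 2"
      using norm_triangle_ineq[of e e'] norm_triangle_ineq[of e "- e'"] n by auto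
  qed
  define \<kappa> where "\<kappa> = min 1 ((2 - max (norm (e + e')) (norm (e - e'))) / 2)"
  have \<kappa>: "0 < \<kappa>" "\<kappa> \<le> 1" "norm (e + e') < 2 - \<kappa>" "norm (e - e') < 2 - \<kappa>"
  proof -
    define M where "M = max (norm (e + e')) (norm (e - e'))"
    have M: "M < 2" "norm (e + e') \<le> M" "norm (e - e') \<le> M" using lt by (auto simp: M_def)
    have k: "\<kappa> = min 1 ((2 - M) / 2)" by (simp add: \<kappa>_def M_def)
    have "0 < \<kappa>" using M(1) by (simp add: k)
    moreover have "\<kappa> \<le> 1" unfolding k by (rule min.cobounded1)
    moreover have "\<kappa> \<le> (2 - M) / 2" unfolding k by (rule min.cobounded2)
    ultimately show "0 < \<kappa>" "\<kappa> \<le> 1" "norm (e + e') < 2 - \<kappa>" "norm (e - e') < 2 - \<kappa>"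
      using M by auto
  qed
  have "\<forall>\<^sub>F yz in at (x, x). norm (m p yz + m p' yz) < 2 - \<kappa>"
    by (rule order_tendstoD[OF _ \<kappa>(3)]) (unfold e_def e'_def, intro tendsto_intros lim ne ne')
  moreover have "\<forall>\<^sub>F yz in at (x, x). norm (m p yz - m p' yz) < 2 - \<kappa>"
    by (rule order_tendstoD[OF _ \<kappa>(4)]) (unfold e_def e'_def, intro tendsto_intros lim ne ne')
  ultimately have "\<forall>\<^sub>F yz in at (x, x). norm (m p yz + m p' yz) < 2 - \<kappa> \<and> norm (m p yz - m p' yz) < 2 - \<kappa>"
    by (rule eventually_conj)
  then obtain h0 where h0: "h0 > 0" "\<And>yz. yz \<noteq> (x, x) \<Longrightarrow> dist yz (x, x) < h0 \<Longrightarrow>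
      norm (m p yz + m p' yz) < 2 - \<kappa> \<and> norm (m p yz - m p' yz) < 2 - \<kappa>"
    unfolding eventually_at by auto
  define h where "h = min (h0 / 2) (min (dist p x) (dist p' x))"
  have "h > 0" using h0 ne ne' by (simp add: h_def)
  moreover have "\<bar>dist p y - dist p z\<bar> + \<bar>dist p' y - dist p' z\<bar> \<le> (2 - \<kappa>) * dist y z"
    if yz: "dist y x < h" "dist z x < h" for y z
  proof (cases "y = z")
    case False
    then have "(y, z) \<noteq> (x, x)" by auto
    moreover have "dist (y, z) (x, x) < h0"
    proof -
      have "dist (y, z) (x, x) \<le> dist y x + dist z x"
        by (simp add: dist_Pair_Pair sqrt_sum_squares_le_sum)
      then show ?thesis using yz by (simp add: h_def)
    qed
    ultimately have b: "norm (m p (y, z) + m p' (y, z)) < 2 - \<kappa>" "norm (m p (y, z) - m p' (y, z)) < 2 - \<kappa>"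
      using h0 by auto
    have diff: "dist q y - dist q z = (y - z) \<bullet> m q (y, z)" if "q = p \<or> q = p'" for q
    proof -
      have "q \<noteq> y" using yz that by (auto simp: h_def)
      then have pos: "dist q y + dist q z > 0" by (metis add_pos_nonneg zero_less_dist_iff zero_le_dist)
      have "(dist q y - dist q z) * (dist q y + dist q z) = (dist q y)\<^sup>2 - (dist q z)\<^sup>2"
        by (simp add: power2_eq_square algebra_simps)
      also have "\<dots> = (y - z) \<bullet> (y + z - 2 *\<^sub>R q)"
        by (simp add: dist_norm power2_norm_eq_inner inner_diff inner_add inner_commute algebra_simps)
      finally have "dist q y - dist q z = (1 / (dist q y + dist q z)) * ((y - z) \<bullet> (y + z - 2 *\<^sub>R q))"
        using pos by (simp add: eq_divide_eq)
      then show ?thesis unfolding m_def inner_scaleR_right fst_conv snd_conv .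
    qed
    have in_le: "\<bar>(y - z) \<bullet> v\<bar> \<le> (2 - \<kappa>) * dist y z" if "norm v < 2 - \<kappa>" for v
    proof -
      have "\<bar>(y - z) \<bullet> v\<bar> \<le> norm (y - z) * norm v" by (rule Cauchy_Schwarz_ineq2)
      also have "\<dots> \<le> norm (y - z) * (2 - \<kappa>)" using that by (intro mult_left_mono) auto
      finally show ?thesis by (simp add: dist_norm mult.commute)
    qed
    have "\<bar>dist p y - dist p z\<bar> + \<bar>dist p' y - dist p' z\<bar> =
        max \<bar>(y - z) \<bullet> (m p (y, z) + m p' (y, z))\<bar> \<bar>(y - z) \<bullet> (m p (y, z) - m p' (y, z))\<bar>"
      by (simp add: diff inner_add_right inner_diff_right max_def abs_if)
    also have "\<dots> \<le> (2 - \<kappa>) * dist y z" using in_le[OF b(1)] in_le[OF b(2)] by simp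
    finally show ?thesis .
  qed simp
  ultimately show ?thesis using that \<kappa> by blast
qed

lemma variation_ge_increment:
  fixes f :: "nat \<Rightarrow> real"
  shows "\<bar>f 0 - f n\<bar> \<le> (\<Sum>i<n. \<bar>f i - f (Suc i)\<bar>)"
  by (induction n) auto

text \<open>
  If the developments with respect to \<open>p\<close> and \<open>p'\<close> are both radial, the curve has full radial variation with respect to
  both points.  On some short piece the distance to \<open>p\<close> changes at nearly full rate.  On a partition of that piece which
  exhausts the variation of the distance to \<open>p'\<close>, the variation of the distance to \<open>p\<close> is still nearly full, by the triangle
  inequality.  This contradicts the contraction property above, unless the two points are collinear with \<open>\<gamma> q1\<close>.
\<close>

lemma radial_points_collinear:
  assumes len: "arclength_parametrized J \<gamma>" and J: "{q1..q2} \<subseteq> J" and q: "q1 < q2"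
    and dev: "development J \<gamma> p 0 \<delta> \<theta>" "\<theta> q1 = \<theta> q2"
    and dev': "development J \<gamma> p' 0 \<delta>' \<theta>'" "\<theta>' q1 = \<theta>' q2" and ne: "p' \<noteq> \<gamma> q1"
  shows "\<exists>c. p - \<gamma> q1 = c *\<^sub>R (p' - \<gamma> q1)"
proof (rule ccontr)
  assume "\<nexists>c. p - \<gamma> q1 = c *\<^sub>R (p' - \<gamma> q1)"
  then obtain \<kappa> h where \<kappa>: "0 < \<kappa>" "\<kappa> \<le> 1" "0 < h" and
    contract: "\<And>y z. dist y (\<gamma> q1) < h \<Longrightarrow> dist z (\<gamma> q1) < h \<Longrightarrow>
       \<bar>dist p y - dist p z\<bar> + \<bar>dist p' y - dist p' z\<bar> \<le> (2 - \<kappa>) * dist y z"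
    using two_distances_contract[of p "\<gamma> q1" p'] ne by blast
  define t where "t = min q2 (q1 + h / 2)"
  have t: "q1 < t" "t \<le> q2" "t - q1 < h" using q \<kappa> by (auto simp: t_def)
  have lip: "dist (\<gamma> a) (\<gamma> b) \<le> \<bar>a - b\<bar>" if "a \<in> {q1..q2}" "b \<in> {q1..q2}" for a b
    using arclength_dist_le[OF len, of a b] that J by (meson subsetD)
  have near: "dist (\<gamma> a) (\<gamma> q1) < h" if "a \<in> {q1..t}" for a
    using lip[of a q1] that t by auto
  have c: "(1 - \<kappa> / 2) * (t - q1) < t - q1" using \<kappa> t by simp
  obtain n u where u: "u 0 = q1" "u n = t" "mono_on {..n} u"
    "(1 - \<kappa> / 2) * (t - q1) < (\<Sum>i<n. \<bar>dist p (\<gamma> (u i)) - dist p (\<gamma> (u (Suc i)))\<bar>)"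
    by (rule development_radial_variation[OF dev(1) J dev(2) order_refl t(1,2) c])
  have "\<exists>i<n. (1 - \<kappa> / 2) * (u (Suc i) - u i) < \<bar>dist p (\<gamma> (u i)) - dist p (\<gamma> (u (Suc i)))\<bar>"
  proof (rule ccontr)
    assume "\<not> ?thesis"
    then have "\<bar>dist p (\<gamma> (u i)) - dist p (\<gamma> (u (Suc i)))\<bar> \<le> (1 - \<kappa> / 2) * (u (Suc i) - u i)" if "i < n" for i
      using that by (meson not_less)
    then have "(\<Sum>i<n. \<bar>dist p (\<gamma> (u i)) - dist p (\<gamma> (u (Suc i)))\<bar>) \<le> (\<Sum>i<n. (1 - \<kappa> / 2) * (u (Suc i) - u i))"
      by (intro sum_mono) simp
    also have "\<dots> = (1 - \<kappa> / 2) * (t - q1)"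
      by (simp only: sum_distrib_left[symmetric] sum_lessThan_telescope u)
    finally show False using u by simp
  qed
  then obtain i where i: "i < n" "(1 - \<kappa> / 2) * (u (Suc i) - u i) < \<bar>dist p (\<gamma> (u i)) - dist p (\<gamma> (u (Suc i)))\<bar>"
    by blast
  define a where "a = u i"
  define b where "b = u (Suc i)"
  have ab: "q1 \<le> a" "a \<le> b" "b \<le> t"
  proof -
    have "u 0 \<le> u i" "u i \<le> u (Suc i)" "u (Suc i) \<le> u n"
      using u(3) i(1) by (auto simp: mono_on_def)
    then show "q1 \<le> a" "a \<le> b" "b \<le> t" using u(1,2) by (simp_all add: a_def b_def)
  qed
  have "a \<noteq> b" using i by (auto simp: a_def b_def)
  with ab have "a < b" by simp
  then have c': "(1 - \<kappa> / 2) * (b - a) < b - a" using \<kappa> by simp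
  have "b \<le> q2" using ab t by simp
  obtain k v where v: "v 0 = a" "v k = b" "mono_on {..k} v"
    "(1 - \<kappa> / 2) * (b - a) < (\<Sum>j<k. \<bar>dist p' (\<gamma> (v j)) - dist p' (\<gamma> (v (Suc j)))\<bar>)"
    by (rule development_radial_variation[OF dev'(1) J dev'(2) ab(1) \<open>a < b\<close> \<open>b \<le> q2\<close> c'])
  have rng: "v j \<in> {q1..t}" if "j \<le> k" for j
  proof -
    have "v 0 \<le> v j" "v j \<le> v k" using v(3) that by (auto simp: mono_on_def)
    then show ?thesis using v ab by auto
  qed
  have "(1 - \<kappa> / 2) * (b - a) < \<bar>dist p (\<gamma> (v 0)) - dist p (\<gamma> (v k))\<bar>"
    using i(2) by (simp add: a_def b_def v(1,2)[unfolded a_def b_def])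
  also have "\<dots> \<le> (\<Sum>j<k. \<bar>dist p (\<gamma> (v j)) - dist p (\<gamma> (v (Suc j)))\<bar>)"
    using variation_ge_increment[of "\<lambda>j. dist p (\<gamma> (v j))"] by simp
  finally have "2 * ((1 - \<kappa> / 2) * (b - a)) <
      (\<Sum>j<k. \<bar>dist p (\<gamma> (v j)) - dist p (\<gamma> (v (Suc j)))\<bar> + \<bar>dist p' (\<gamma> (v j)) - dist p' (\<gamma> (v (Suc j)))\<bar>)"
    using v(4) by (simp add: sum.distrib)
  also have "\<dots> \<le> (\<Sum>j<k. (2 - \<kappa>) * (v (Suc j) - v j))"
  proof (rule sum_mono)
    fix j assume j: "j \<in> {..<k}"
    have m: "v j \<le> v (Suc j)" using v(3) j by (auto simp: mono_on_def)
    have "\<bar>dist p (\<gamma> (v j)) - dist p (\<gamma> (v (Suc j)))\<bar> + \<bar>dist p' (\<gamma> (v j)) - dist p' (\<gamma> (v (Suc j)))\<bar>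
        \<le> (2 - \<kappa>) * dist (\<gamma> (v j)) (\<gamma> (v (Suc j)))"
      using rng j by (intro contract near) auto
    also have "\<dots> \<le> (2 - \<kappa>) * (v (Suc j) - v j)"
    proof (rule mult_left_mono)
      show "dist (\<gamma> (v j)) (\<gamma> (v (Suc j))) \<le> v (Suc j) - v j"
        using lip[of "v j" "v (Suc j)"] rng[of j] rng[of "Suc j"] j m t by auto
    qed (use \<kappa> in simp)
    finally show "\<bar>dist p (\<gamma> (v j)) - dist p (\<gamma> (v (Suc j)))\<bar> + \<bar>dist p' (\<gamma> (v j)) - dist p' (\<gamma> (v (Suc j)))\<bar>
        \<le> (2 - \<kappa>) * (v (Suc j) - v j)" .
  qed
  also have "\<dots> = (2 - \<kappa>) * (b - a)"
    by (simp only: sum_distrib_left[symmetric] sum_lessThan_telescope v)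
  also have "\<dots> = 2 * ((1 - \<kappa> / 2) * (b - a))" by (simp add: field_simps)
  finally show False by simp
qed

lemma negligible_arclength_curve:
  assumes "arclength_parametrized J \<gamma>"
  shows "negligible (\<gamma> ` J)"
proof -
  define f where "f x = \<gamma> (x $ 1)" for x :: plane
  define S where "S = {x :: plane. x $ 2 = 0 \<and> x $ 1 \<in> J}"
  have "negligible S"
  proof (rule negligible_subset)
    show "negligible {x :: plane. axis 2 1 \<bullet> x = 0}" by (rule negligible_hyperplane) simp
    show "S \<subseteq> {x. axis 2 1 \<bullet> x = 0}" by (auto simp: S_def inner_axis')
  qed
  then have "negligible (f ` S)"
  proof (rule negligible_locally_Lipschitz_image[rotated])
    fix x assume x: "x \<in> S"
    have "norm (f y - f x) \<le> 1 * norm (y - x)" if "y \<in> S" for y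
    proof -
      have "norm (f y - f x) \<le> \<bar>y $ 1 - x $ 1\<bar>"
        using arclength_dist_le[OF assms, of "y $ 1" "x $ 1"] x that by (simp add: f_def S_def dist_norm)
      also have "\<dots> \<le> norm (y - x)" using component_le_norm_cart[of "y - x" 1] by simp
      finally show ?thesis by simp
    qed
    then show "\<exists>T B. open T \<and> x \<in> T \<and> (\<forall>y\<in>S \<inter> T. norm (f y - f x) \<le> B * norm (y - x))"
      by (intro exI[of _ UNIV] exI[of _ 1]) auto
  qed simp
  moreover have "\<gamma> ` J \<subseteq> f ` S"
  proof
    fix y assume "y \<in> \<gamma> ` J"
    then obtain t where "t \<in> J" "y = \<gamma> t" by auto
    then have "y = f (vector [t, 0])" "vector [t, 0] \<in> S" by (auto simp: f_def S_def)
    then show "y \<in> f ` S" by blast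
  qed
  ultimately show ?thesis by (rule negligible_subset)
qed

text \<open>
  A development on a ray may turn back without any effect on the swept region, so convexity says nothing about the curve
  if the development is radial.  Points with this property are exceptional, since they lie on a line.
\<close>

lemma negligible_radial_points:
  assumes len: "arclength_parametrized J \<gamma>" and J: "{q1..q2} \<subseteq> J" and q: "q1 < q2"
  shows "negligible {p. p \<noteq> \<gamma> q1 \<and> (\<exists>\<delta> \<theta>. development J \<gamma> p 0 \<delta> \<theta> \<and> \<theta> q1 = \<theta> q2)}" (is "negligible ?B")
proof (cases "?B = {}")
  case True
  then show ?thesis by (simp only: negligible_empty)
next
  case False
  then obtain p' where p': "p' \<in> ?B" by blast
  define d where "d = p' - \<gamma> q1"
  define a :: plane where "a = vector [- d $ 2, d $ 1]"
  have a0: "a \<bullet> d = 0" by (simp add: a_def inner_plane)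
  have "a \<noteq> 0"
  proof
    assume "a = 0"
    then have "a $ 1 = 0" "a $ 2 = 0" by auto
    then have "d = 0" by (intro plane_eqI) (auto simp: a_def)
    then show False using p' by (simp add: d_def)
  qed
  then have "negligible {x. a \<bullet> x = a \<bullet> \<gamma> q1}" by (intro negligible_hyperplane) simp
  moreover have "?B \<subseteq> {x. a \<bullet> x = a \<bullet> \<gamma> q1}"
  proof
    fix p assume "p \<in> ?B"
    then obtain c where "p - \<gamma> q1 = c *\<^sub>R d"
      using radial_points_collinear[OF len J q] p' unfolding d_def by blast
    then have "a \<bullet> (p - \<gamma> q1) = 0" using a0 by simp
    then show "p \<in> {x. a \<bullet> x = a \<bullet> \<gamma> q1}" by (simp add: inner_diff_right)
  qed
  ultimately show ?thesis by (rule negligible_subset)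
qed

section \<open>Squared distances along quasigeodesics\<close>

text \<open>
  Along a straight line run at unit speed the function \<open>(dist p (\<gamma> t))\<^sup>2 - t\<^sup>2\<close> is affine, so its concavity compares the
  curve with a straight line.  The length of the time interval is tied to the distance of \<open>p\<close>, in order that developments
  sweep an angle less than \<open>pi\<close>.
\<close>

definition semiconcave_within :: "plane set \<Rightarrow> (real \<Rightarrow> plane) \<Rightarrow> real \<Rightarrow> real \<Rightarrow> real \<Rightarrow> bool" where
  "semiconcave_within K \<gamma> T \<rho> \<epsilon> \<longleftrightarrow> (\<forall>p\<in>K. \<forall>\<eta>>0.
     dist p (\<gamma> T) < \<rho> \<longrightarrow> \<eta> \<le> \<epsilon> \<longrightarrow> 4 * \<eta> < dist p (\<gamma> T) \<longrightarrow>
     concave_on {T - \<eta><..<T + \<eta>} (\<lambda>t. (dist p (\<gamma> t))\<^sup>2 - t\<^sup>2))"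

definition locally_semiconcave :: "plane set \<Rightarrow> (real \<Rightarrow> plane) \<Rightarrow> real \<Rightarrow> bool" where
  "locally_semiconcave K \<gamma> T \<longleftrightarrow> (\<exists>\<rho>>0. \<exists>\<epsilon>>0. semiconcave_within K \<gamma> T \<rho> \<epsilon>)"

lemma semiconcave_withinD:
  "semiconcave_within K \<gamma> T \<rho> \<epsilon> \<Longrightarrow> p \<in> K \<Longrightarrow> 0 < \<eta> \<Longrightarrow> dist p (\<gamma> T) < \<rho> \<Longrightarrow> \<eta> \<le> \<epsilon> \<Longrightarrow>
   4 * \<eta> < dist p (\<gamma> T) \<Longrightarrow> concave_on {T - \<eta><..<T + \<eta>} (\<lambda>t. (dist p (\<gamma> t))\<^sup>2 - t\<^sup>2)"
  unfolding semiconcave_within_def by simp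

lemma closed_concave_points:
  "closed {p. concave_on {lo<..<hi} (\<lambda>t. (dist p (\<gamma> t))\<^sup>2 - t\<^sup>2)}"
proof -
  have "{p. concave_on {lo<..<hi} (\<lambda>t. (dist p (\<gamma> t))\<^sup>2 - t\<^sup>2)} =
    (\<Inter>x\<in>{lo<..<hi}. \<Inter>y\<in>{lo<..<hi}. \<Inter>uv\<in>{uv. 0 \<le> fst uv \<and> 0 \<le> snd uv \<and> fst uv + snd uv = 1}.
      {p. fst uv * ((dist p (\<gamma> x))\<^sup>2 - x\<^sup>2) + snd uv * ((dist p (\<gamma> y))\<^sup>2 - y\<^sup>2)
        \<le> (dist p (\<gamma> (fst uv *\<^sub>R x + snd uv *\<^sub>R y)))\<^sup>2 - (fst uv *\<^sub>R x + snd uv *\<^sub>R y)\<^sup>2})"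
    unfolding concave_on_iff by (auto simp: convex_real_interval)
  also have "closed \<dots>"
    by (intro closed_INT ballI closed_Collect_le continuous_intros)
  finally show ?thesis .
qed

text \<open>
  For each \<open>p\<close> outside a null set the polar angle of the development is strictly decreasing, and then convexity of the
  development gives concavity.  Concavity is a closed condition on \<open>p\<close>, and every point of a convex body is a limit of
  interior points outside a given null set.
\<close>

lemma quasigeodesic_locally_semiconcave:
  assumes K: "convex_body K" and geo: "quasigeodesic K UNIV \<gamma>"
  shows "locally_semiconcave K \<gamma> t0"
proof -
  have "quasigeodesic_compact K (t0 - 1) (t0 + 1) \<gamma>"
    using geo by (simp add: quasigeodesic_def)
  note c = this[unfolded quasigeodesic_compact_def Let_def]
  note al = c[THEN conjunct2, THEN conjunct1]
  have "t0 \<in> {t0 - 1..t0 + 1}" by simp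
  from bspec[OF c[THEN conjunct2, THEN conjunct2] this] obtain U \<epsilon>0 where U: "openin (top_of_set K) U" "\<gamma> t0 \<in> U" "0 < \<epsilon>0" and
    dev: "\<forall>p\<in>U - \<gamma> ` ({t0 - 1..t0 + 1} \<inter> {t0 - \<epsilon>0..t0 + \<epsilon>0}).
      \<exists>\<delta> \<theta>. development ({t0 - 1..t0 + 1} \<inter> {t0 - \<epsilon>0..t0 + \<epsilon>0}) \<gamma> p 0 \<delta> \<theta> \<and>
        convex_development ({t0 - 1..t0 + 1} \<inter> {t0 - \<epsilon>0..t0 + \<epsilon>0}) 0 \<delta> \<theta>"
    by (elim exE conjE)
  define e where "e = min 1 \<epsilon>0"
  define J where "J = {t0 - e..t0 + e}"
  have e: "e > 0" using U by (simp add: e_def)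
  have Jeq: "{t0 - 1..t0 + 1} \<inter> {t0 - \<epsilon>0..t0 + \<epsilon>0} = J" by (auto simp: J_def e_def)
  have len: "arclength_parametrized J \<gamma>" 
  proof -
    have "J \<subseteq> {t0 - 1..t0 + 1}" by (auto simp: J_def e_def)
    then show ?thesis using al unfolding arclength_parametrized_def by blast
  qed
  obtain \<rho> where \<rho>: "\<rho> > 0" "ball (\<gamma> t0) \<rho> \<inter> K \<subseteq> U"
    using U(1,2) unfolding openin_contains_ball by blast
  define B where "B q = {p. p \<noteq> \<gamma> (fst q) \<and> (\<exists>\<delta> \<theta>. development J \<gamma> p 0 \<delta> \<theta> \<and> \<theta> (fst q) = \<theta> (snd q))}" for q
  \<comment> \<open>If the angle is not strictly decreasing, it is constant between two rational times.\<close>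
  define Q where "Q = {q \<in> \<rat> \<times> \<rat>. fst q < snd q \<and> {fst q..snd q} \<subseteq> J}"
  define N where "N = \<gamma> ` J \<union> \<Union> (B ` Q)"
  have "countable Q"
    unfolding Q_def by (rule countable_subset[of _ "\<rat> \<times> \<rat>"]) (auto simp: countable_rat)
  then have "negligible (\<Union> (B ` Q))"
    by (intro negligible_countable_Union countable_image)
      (auto simp: B_def Q_def intro!: negligible_radial_points[OF len])
  then have N: "negligible N" using negligible_arclength_curve[OF len] by (simp add: N_def negligible_Un)
  have lip: "dist (\<gamma> a) (\<gamma> b) \<le> \<bar>a - b\<bar>" if "a \<in> J" "b \<in> J" for a b
    using arclength_dist_le[OF len] that by blast
  have good: "concave_on {t0 - \<eta><..<t0 + \<eta>} (\<lambda>t. (dist p (\<gamma> t))\<^sup>2 - t\<^sup>2)"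
    if p: "p \<in> U" "p \<notin> N" and \<eta>: "\<eta> > 0" "\<eta> \<le> e" "4 * \<eta> < dist p (\<gamma> t0)" for p \<eta>
  proof -
    have off: "p \<notin> \<gamma> ` J" using p by (simp add: N_def)
    obtain \<delta> \<theta> where d: "development J \<gamma> p 0 \<delta> \<theta>" "convex_development J 0 \<delta> \<theta>"
      using bspec[OF dev, of p] p(1) off unfolding Jeq by blast
    note dD = developmentD[OF d(1)]
    show ?thesis
    proof (rule good_development_concave[OF d _ _ _ off])
      show "{t0 - \<eta><..<t0 + \<eta>} \<subseteq> J" using \<eta> by (auto simp: J_def)
      fix s t assume st: "s \<in> J" "t \<in> J" "s < t"
      show "\<theta> t < \<theta> s"
      proof (rule ccontr)
        assume "\<not> \<theta> t < \<theta> s"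
        then have eq: "\<theta> s = \<theta> t" using dD(4)[of s t] st by simp
        obtain q1 where q1: "q1 \<in> \<rat>" "s < q1" "q1 < t" using Rats_dense_in_real st by blast
        obtain q2 where q2: "q2 \<in> \<rat>" "q1 < q2" "q2 < t" using Rats_dense_in_real q1 by blast
        have inJ: "{q1..q2} \<subseteq> J" "q1 \<in> J" "q2 \<in> J" using q1 q2 st by (auto simp: J_def)
        have "\<theta> q1 = \<theta> q2"
          using dD(4)[of s q1] dD(4)[of q1 q2] dD(4)[of q2 t] eq inJ st q1 q2 by simp
        then have "p \<in> B (q1, q2)" using d off inJ by (auto simp: B_def)
        moreover have "(q1, q2) \<in> Q" using q1 q2 inJ by (auto simp: Q_def)
        ultimately show False using p by (auto simp: N_def)
      qed
    next
      fix q assume q: "q \<in> {t0 - \<eta><..<t0 + \<eta>}"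
      then have "q \<in> J" "t0 \<in> J" using \<eta> e by (auto simp: J_def)
      then have "dist (\<gamma> q) (\<gamma> t0) \<le> \<bar>q - t0\<bar>" by (rule lip)
      then show "t0 + \<eta> - (t0 - \<eta>) < dist p (\<gamma> q)"
        using \<eta> q dist_triangle[of p "\<gamma> t0" "\<gamma> q"] by auto
    qed
  qed
  show ?thesis
    unfolding locally_semiconcave_def semiconcave_within_def
  proof (rule exI[of _ \<rho>], intro conjI \<rho>(1), rule exI[of _ e], intro conjI e ballI allI impI)
    fix p \<eta> assume p: "p \<in> K" "dist p (\<gamma> t0) < \<rho>" and \<eta>: "0 < \<eta>" "\<eta> \<le> e" "4 * \<eta> < dist p (\<gamma> t0)"
    show "concave_on {t0 - \<eta><..<t0 + \<eta>} (\<lambda>t. (dist p (\<gamma> t))\<^sup>2 - t\<^sup>2)"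
    proof (rule ccontr)
      assume no: "\<not> ?thesis"
      define C where "C = {p. concave_on {t0 - \<eta><..<t0 + \<eta>} (\<lambda>t. (dist p (\<gamma> t))\<^sup>2 - t\<^sup>2)}"
      define V where "V = ball (\<gamma> t0) \<rho> \<inter> {p. 4 * \<eta> < dist p (\<gamma> t0)} \<inter> - C"
      have "open V"
        unfolding V_def C_def
        by (intro open_Int open_ball open_Collect_less continuous_intros open_Compl closed_concave_points)
      moreover have "p \<in> V" using no p \<eta> by (simp add: V_def C_def dist_commute)
      moreover have "K = closure (interior K)"
        using K convex_closure_interior[of K] by (simp add: convex_body_def closure_closed compact_imp_closed)
      ultimately have "V \<inter> interior K \<noteq> {}"
        using p(1) open_Int_closure_eq_empty[of V "interior K"] by blast
      then have "\<not> negligible (V \<inter> interior K)"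
        using \<open>open V\<close> by (intro open_not_negligible) auto
      then have "\<not> V \<inter> interior K \<subseteq> N" using negligible_subset[OF N] by metis
      then obtain x where x: "x \<in> V" "x \<in> interior K" "x \<notin> N" by blast
      then have "x \<in> K" using interior_subset by blast
      then have "x \<in> U" using \<rho>(2) x(1) unfolding V_def by blast
      then have "x \<in> C" using good[of x \<eta>] x \<eta> by (simp add: V_def C_def)
      then show False using x by (simp add: V_def)
    qed
  qed
qed

section \<open>One-sided derivatives\<close>

definition right_tangent :: "(real \<Rightarrow> plane) \<Rightarrow> real \<Rightarrow> plane \<Rightarrow> bool" where
  "right_tangent \<gamma> T w \<longleftrightarrow> ((\<lambda>h. (\<gamma> (T + h) - \<gamma> T) /\<^sub>R h) \<longlongrightarrow> w) (at_right 0)"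

definition left_tangent :: "(real \<Rightarrow> plane) \<Rightarrow> real \<Rightarrow> plane \<Rightarrow> bool" where
  "left_tangent \<gamma> T u \<longleftrightarrow> ((\<lambda>h. (\<gamma> T - \<gamma> (T - h)) /\<^sub>R h) \<longlongrightarrow> u) (at_right 0)"

text \<open>
  Strictness, that is control of the increments between any two times shortly after \<open>T\<close>, is what relates the derivative to
  the length of the curve.
\<close>

definition strict_right_deriv :: "(real \<Rightarrow> 'a::real_normed_vector) \<Rightarrow> real \<Rightarrow> 'a \<Rightarrow> bool" where
  "strict_right_deriv f T w \<longleftrightarrow> (\<forall>\<epsilon>>0. \<exists>\<eta>>0. \<forall>s s'. T \<le> s \<longrightarrow> s \<le> s' \<longrightarrow> s' \<le> T + \<eta> \<longrightarrow>
     norm (f s' - f s - (s' - s) *\<^sub>R w) \<le> \<epsilon> * (s' - s))"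

lemma concave_slopes:
  fixes f :: "real \<Rightarrow> real"
  assumes "concave_on I f" "x \<in> I" "z \<in> I" "x < y" "y < z"
  shows "(f z - f x) / (z - x) \<le> (f y - f x) / (y - x)"
    and "(f z - f y) / (z - y) \<le> (f z - f x) / (z - x)"
proof -
  have c: "convex_on I (\<lambda>t. - f t)" using assms(1) by (simp add: concave_on_def)
  have "((- f x) - (- f y)) / (x - y) \<le> ((- f x) - (- f z)) / (x - z)"
    by (rule convex_on_slope_le(1)[OF c]) (use assms in auto)
  moreover have "((- f x) - (- f z)) / (x - z) \<le> ((- f y) - (- f z)) / (y - z)"
    by (rule convex_on_slope_le(2)[OF c]) (use assms in auto)
  moreover have "((- f a) - (- f b)) / (a - b) = - ((f b - f a) / (b - a))" if "a < b" for a b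
    using that by (simp add: divide_simps) (simp add: algebra_simps)
  ultimately show "(f z - f x) / (z - x) \<le> (f y - f x) / (y - x)"
    "(f z - f y) / (z - y) \<le> (f z - f x) / (z - x)"
    using assms by simp_all
qed

text \<open>
  Difference quotients to the right of \<open>T\<close> increase to their supremum \<open>D\<close> as the points approach \<open>T\<close>; a quotient over
  \<open>s\<close> and \<open>s'\<close> lies between the quotient over \<open>s'\<close> and a fixed later point and the one over \<open>T\<close> and \<open>s'\<close>.
\<close>

lemma concave_strict_right_deriv:
  fixes f :: "real \<Rightarrow> real"
  assumes f: "concave_on {lo<..<hi} f" and T: "lo < T" "T < hi"
  shows "\<exists>D. strict_right_deriv f T D"
proof -
  define D where "D = (SUP y\<in>{T<..<hi}. (f y - f T) / (y - T))"
  obtain x0 where x0: "lo < x0" "x0 < T" using dense T by blast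
  have bdd: "bdd_above ((\<lambda>y. (f y - f T) / (y - T)) ` {T<..<hi})"
  proof (rule bdd_aboveI2)
    fix y assume y: "y \<in> {T<..<hi}"
    show "(f y - f T) / (y - T) \<le> (f T - f x0) / (T - x0)"
      using concave_slopes[OF f, of x0 y T] x0 y T by simp
  qed
  have D: "(f y - f T) / (y - T) \<le> D" if "T < y" "y < hi" for y
    unfolding D_def by (rule cSUP_upper[OF _ bdd]) (use that in auto)
  have cont: "continuous_on {lo<..<hi} f"
  proof -
    have "continuous_on {lo<..<hi} (\<lambda>t. - f t)"
      using f by (intro convex_on_continuous) (auto simp: concave_on_def)
    then show ?thesis using continuous_on_minus by fastforce
  qed
  have "strict_right_deriv f T D"
    unfolding strict_right_deriv_def
  proof (intro allI impI)
    fix \<epsilon> :: real assume \<epsilon>: "\<epsilon> > 0"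
    have "D - \<epsilon> < (SUP y\<in>{T<..<hi}. (f y - f T) / (y - T))" using \<epsilon> by (simp add: D_def)
    then obtain y where y: "T < y" "y < hi" "D - \<epsilon> < (f y - f T) / (y - T)"
      using T by (subst (asm) less_cSUP_iff[OF _ bdd]) auto
    have "isCont (\<lambda>s. (f y - f s) / (y - s)) T"
      using cont T y by (intro continuous_intros) (auto simp: continuous_on_eq_continuous_at)
    then have "((\<lambda>s. (f y - f s) / (y - s)) \<longlongrightarrow> (f y - f T) / (y - T)) (at T)" by (simp add: isCont_def)
    then have "\<forall>\<^sub>F s in at T. D - \<epsilon> < (f y - f s) / (y - s)" using y(3) by (rule order_tendstoD)
    then obtain d where d: "d > 0" "\<And>s. s \<noteq> T \<Longrightarrow> dist s T < d \<Longrightarrow> D - \<epsilon> < (f y - f s) / (y - s)"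
      unfolding eventually_at by auto
    define \<eta> where "\<eta> = min (d / 2) ((y - T) / 2)"
    have \<eta>: "\<eta> > 0" "\<eta> < d" "T + \<eta> < y" using d y by (auto simp: \<eta>_def min_def field_simps)
    show "\<exists>\<eta>>0. \<forall>s s'. T \<le> s \<longrightarrow> s \<le> s' \<longrightarrow> s' \<le> T + \<eta> \<longrightarrow> norm (f s' - f s - (s' - s) *\<^sub>R D) \<le> \<epsilon> * (s' - s)"
    proof (intro exI[of _ \<eta>] conjI \<eta>(1) allI impI)
      fix s s' assume s: "T \<le> s" "s \<le> s'" "s' \<le> T + \<eta>"
      show "norm (f s' - f s - (s' - s) *\<^sub>R D) \<le> \<epsilon> * (s' - s)"
      proof (cases "s = s'")
        case False
        then have s': "s < s'" "T < s'" "s' < y" using s \<eta> by auto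
        have lowb: "D - \<epsilon> < (f y - f s') / (y - s')"
          using s s' \<eta> by (intro d(2)) (auto simp: dist_real_def)
        have "(f y - f s') / (y - s') \<le> (f y - f s) / (y - s)" "(f y - f s) / (y - s) \<le> (f s' - f s) / (s' - s)"
          using concave_slopes[OF f, of s y s'] s s' y T by auto
        with lowb have lo: "D - \<epsilon> < (f s' - f s) / (s' - s)" by linarith
        have "(f s' - f s) / (s' - s) \<le> D"
        proof (cases "s = T")
          case False
          then have "(f s' - f s) / (s' - s) \<le> (f s' - f T) / (s' - T)"
            using concave_slopes(2)[OF f, of T s' s] s s' y T by auto
          also have "\<dots> \<le> D" using D s' y by simp
          finally show ?thesis .
        qed (use D s' y in simp)
        with lo s' have "(D - \<epsilon>) * (s' - s) \<le> f s' - f s" "f s' - f s \<le> D * (s' - s)"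
          by (simp_all add: pos_less_divide_eq pos_divide_le_eq)
        then show ?thesis by (auto simp: algebra_simps abs_if)
      qed simp
    qed
  qed
  then show ?thesis by blast
qed

lemma strict_right_deriv_combine:
  fixes f g :: "real \<Rightarrow> real"
  assumes f: "strict_right_deriv f T D" and g: "strict_right_deriv g T E"
  shows "strict_right_deriv (\<lambda>t. a * (f t - g t) + b) T (a * (D - E))"
  unfolding strict_right_deriv_def
proof (intro allI impI)
  fix \<epsilon> :: real assume "\<epsilon> > 0"
  define e where "e = \<epsilon> / (2 * (\<bar>a\<bar> + 1))"
  have e: "e > 0" "\<bar>a\<bar> * (2 * e) \<le> \<epsilon>"
  proof -
    show "e > 0" using \<open>\<epsilon> > 0\<close> by (simp add: e_def add_nonneg_pos)
    have "\<bar>a\<bar> * (2 * e) = \<epsilon> * (\<bar>a\<bar> / (\<bar>a\<bar> + 1))" by (simp add: e_def field_simps)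
    also have "\<dots> \<le> \<epsilon> * 1" using \<open>\<epsilon> > 0\<close> by (intro mult_left_mono) (auto simp: field_simps)
    finally show "\<bar>a\<bar> * (2 * e) \<le> \<epsilon>" by simp
  qed
  obtain d1 where d1: "d1 > 0" "\<And>s s'. T \<le> s \<Longrightarrow> s \<le> s' \<Longrightarrow> s' \<le> T + d1 \<Longrightarrow> norm (f s' - f s - (s' - s) *\<^sub>R D) \<le> e * (s' - s)"
    using f e unfolding strict_right_deriv_def by blast
  obtain d2 where d2: "d2 > 0" "\<And>s s'. T \<le> s \<Longrightarrow> s \<le> s' \<Longrightarrow> s' \<le> T + d2 \<Longrightarrow> norm (g s' - g s - (s' - s) *\<^sub>R E) \<le> e * (s' - s)"
    using g e unfolding strict_right_deriv_def by blast
  show "\<exists>\<eta>>0. \<forall>s s'. T \<le> s \<longrightarrow> s \<le> s' \<longrightarrow> s' \<le> T + \<eta> \<longrightarrow>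
      norm (a * (f s' - g s') + b - (a * (f s - g s) + b) - (s' - s) *\<^sub>R (a * (D - E))) \<le> \<epsilon> * (s' - s)"
  proof (rule exI[of _ "min d1 d2"], intro conjI allI impI)
    fix s s' assume s: "T \<le> s" "s \<le> s'" "s' \<le> T + min d1 d2"
    let ?x = "f s' - f s - (s' - s) * D" and ?y = "g s' - g s - (s' - s) * E"
    have "\<bar>?x\<bar> \<le> e * (s' - s)" "\<bar>?y\<bar> \<le> e * (s' - s)" using d1(2)[of s s'] d2(2)[of s s'] s by auto
    then have "\<bar>?x - ?y\<bar> \<le> 2 * e * (s' - s)" by (simp add: abs_le_iff)
    then have "\<bar>a\<bar> * \<bar>?x - ?y\<bar> \<le> \<bar>a\<bar> * (2 * e * (s' - s))" by (intro mult_left_mono) auto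
    also have "\<dots> = (\<bar>a\<bar> * (2 * e)) * (s' - s)" by simp
    also have "\<dots> \<le> \<epsilon> * (s' - s)" using e s by (intro mult_right_mono) auto
    finally have "\<bar>a * (?x - ?y)\<bar> \<le> \<epsilon> * (s' - s)" by (simp only: abs_mult)
    moreover have "a * (f s' - g s') + b - (a * (f s - g s) + b) - (s' - s) *\<^sub>R (a * (D - E)) = a * (?x - ?y)"
      by (simp add: algebra_simps)
    ultimately show "norm (a * (f s' - g s') + b - (a * (f s - g s) + b) - (s' - s) *\<^sub>R (a * (D - E))) \<le> \<epsilon> * (s' - s)"
      by simp
  qed (use d1 d2 in simp)
qed

lemma strict_right_deriv_components:
  fixes \<gamma> :: "real \<Rightarrow> plane"
  assumes 1: "strict_right_deriv (\<lambda>t. \<gamma> t $ 1) T (w $ 1)" and 2: "strict_right_deriv (\<lambda>t. \<gamma> t $ 2) T (w $ 2)"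
  shows "strict_right_deriv \<gamma> T w"
  unfolding strict_right_deriv_def
proof (intro allI impI)
  fix \<epsilon> :: real assume "\<epsilon> > 0"
  then have e: "\<epsilon> / 2 > 0" by simp
  obtain d1 where d1: "d1 > 0" "\<And>s s'. T \<le> s \<Longrightarrow> s \<le> s' \<Longrightarrow> s' \<le> T + d1 \<Longrightarrow>
      norm (\<gamma> s' $ 1 - \<gamma> s $ 1 - (s' - s) *\<^sub>R w $ 1) \<le> \<epsilon> / 2 * (s' - s)"
    using 1 e unfolding strict_right_deriv_def by blast
  obtain d2 where d2: "d2 > 0" "\<And>s s'. T \<le> s \<Longrightarrow> s \<le> s' \<Longrightarrow> s' \<le> T + d2 \<Longrightarrow>
      norm (\<gamma> s' $ 2 - \<gamma> s $ 2 - (s' - s) *\<^sub>R w $ 2) \<le> \<epsilon> / 2 * (s' - s)"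
    using 2 e unfolding strict_right_deriv_def by blast
  show "\<exists>\<eta>>0. \<forall>s s'. T \<le> s \<longrightarrow> s \<le> s' \<longrightarrow> s' \<le> T + \<eta> \<longrightarrow> norm (\<gamma> s' - \<gamma> s - (s' - s) *\<^sub>R w) \<le> \<epsilon> * (s' - s)"
  proof (rule exI[of _ "min d1 d2"], intro conjI allI impI)
    fix s s' assume s: "T \<le> s" "s \<le> s'" "s' \<le> T + min d1 d2"
    let ?v = "\<gamma> s' - \<gamma> s - (s' - s) *\<^sub>R w"
    have "norm ?v \<le> \<bar>?v $ 1\<bar> + \<bar>?v $ 2\<bar>" using norm_le_l1_cart[of ?v] by (simp add: UNIV_2)
    also have "\<dots> \<le> \<epsilon> / 2 * (s' - s) + \<epsilon> / 2 * (s' - s)"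
      using d1(2)[of s s'] d2(2)[of s s'] s by (intro add_mono) auto
    finally show "norm ?v \<le> \<epsilon> * (s' - s)" by simp
  qed (use d1 d2 in simp)
qed

lemma strict_right_deriv_imp_right_tangent:
  assumes "strict_right_deriv \<gamma> T w"
  shows "right_tangent \<gamma> T w"
  unfolding right_tangent_def
proof (rule tendstoI)
  fix \<epsilon> :: real assume \<epsilon>: "\<epsilon> > 0"
  then have "\<epsilon> / 2 > 0" by simp
  then obtain \<eta> where \<eta>: "\<eta> > 0" "\<And>s s'. T \<le> s \<Longrightarrow> s \<le> s' \<Longrightarrow> s' \<le> T + \<eta> \<Longrightarrow> norm (\<gamma> s' - \<gamma> s - (s' - s) *\<^sub>R w) \<le> \<epsilon> / 2 * (s' - s)"
    using assms unfolding strict_right_deriv_def by blast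
  have "dist ((\<gamma> (T + h) - \<gamma> T) /\<^sub>R h) w < \<epsilon>" if h: "0 < h" "h < \<eta>" for h
  proof -
    have "(\<gamma> (T + h) - \<gamma> T) /\<^sub>R h - w = (\<gamma> (T + h) - \<gamma> T - h *\<^sub>R w) /\<^sub>R h"
      using h by (simp add: scaleR_diff_right)
    then have "dist ((\<gamma> (T + h) - \<gamma> T) /\<^sub>R h) w = norm (\<gamma> (T + h) - \<gamma> T - h *\<^sub>R w) / h"
      using h by (simp add: dist_norm divide_inverse)
    also have "\<dots> \<le> \<epsilon> / 2" using \<eta>(2)[of T "T + h"] h by (simp add: pos_divide_le_eq)
    also have "\<dots> < \<epsilon>" using \<epsilon> by simp
    finally show ?thesis .
  qed
  then show "\<forall>\<^sub>F h in at_right 0. dist ((\<gamma> (T + h) - \<gamma> T) /\<^sub>R h) w < \<epsilon>"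
    unfolding eventually_at_right_field using \<eta>(1) by (intro exI[of _ \<eta>]) auto
qed

text \<open>
  Short arcs after \<open>T\<close> have length about \<open>norm w\<close> times their duration.
\<close>

lemma strict_right_deriv_arclength:
  assumes len: "arclength_parametrized UNIV \<gamma>" and w: "strict_right_deriv \<gamma> T w"
  shows "norm w = 1"
proof (rule antisym; rule field_le_epsilon)
  fix e :: real assume e: "0 < e"
  obtain \<eta> where \<eta>: "\<eta> > 0" "\<And>s s'. T \<le> s \<Longrightarrow> s \<le> s' \<Longrightarrow> s' \<le> T + \<eta> \<Longrightarrow> norm (\<gamma> s' - \<gamma> s - (s' - s) *\<^sub>R w) \<le> e * (s' - s)"
    using w e unfolding strict_right_deriv_def by blast
  have "norm (\<eta> *\<^sub>R w) \<le> norm (\<gamma> (T + \<eta>) - \<gamma> T) + norm (\<gamma> (T + \<eta>) - \<gamma> T - \<eta> *\<^sub>R w)"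
    using norm_triangle_sub[of "\<eta> *\<^sub>R w" "\<gamma> (T + \<eta>) - \<gamma> T"] by (simp add: norm_minus_commute)
  also have "\<dots> \<le> \<eta> + e * \<eta>"
    using \<eta>(2)[of T "T + \<eta>"] arclength_dist_le[OF len, of "T + \<eta>" T] \<eta>(1) by (intro add_mono) (auto simp: dist_norm)
  finally have "\<eta> * norm w \<le> \<eta> * (1 + e)" using \<eta>(1) by (simp add: algebra_simps)
  then show "norm w \<le> 1 + e" using \<eta>(1) by simp
next
  fix e :: real assume "0 < e"
  then have e: "e / 2 > 0" by simp
  obtain \<eta> where \<eta>: "\<eta> > 0" "\<And>s s'. T \<le> s \<Longrightarrow> s \<le> s' \<Longrightarrow> s' \<le> T + \<eta> \<Longrightarrow> norm (\<gamma> s' - \<gamma> s - (s' - s) *\<^sub>R w) \<le> e / 2 * (s' - s)"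
    using w e unfolding strict_right_deriv_def by blast
  have cl: "curve_length \<gamma> T (T + \<eta>) = ereal \<eta>" using len \<eta>(1) by (simp add: arclength_parametrized_def)
  have "e / 2 * \<eta> > 0" using e \<eta>(1) by simp
  then obtain n u where u: "u 0 = T" "u n = T + \<eta>" "mono_on {..n} u"
    "\<eta> - e / 2 * \<eta> < (\<Sum>i<n. dist (\<gamma> (u i)) (\<gamma> (u (Suc i))))"
    by (rule curve_length_approx[OF cl])
  have "(\<Sum>i<n. dist (\<gamma> (u i)) (\<gamma> (u (Suc i)))) \<le> (\<Sum>i<n. (norm w + e / 2) * (u (Suc i) - u i))"
  proof (rule sum_mono)
    fix i assume i: "i \<in> {..<n}"
    have m: "u 0 \<le> u i" "u i \<le> u (Suc i)" "u (Suc i) \<le> u n" using u(3) i by (auto simp: mono_on_def)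
    have "norm (\<gamma> (u (Suc i)) - \<gamma> (u i)) \<le> norm ((u (Suc i) - u i) *\<^sub>R w) + norm (\<gamma> (u (Suc i)) - \<gamma> (u i) - (u (Suc i) - u i) *\<^sub>R w)"
      by (rule norm_triangle_sub)
    also have "\<dots> \<le> (u (Suc i) - u i) * norm w + e / 2 * (u (Suc i) - u i)"
      using m u by (intro add_mono \<eta>(2)) auto
    finally show "dist (\<gamma> (u i)) (\<gamma> (u (Suc i))) \<le> (norm w + e / 2) * (u (Suc i) - u i)"
      by (simp add: dist_norm norm_minus_commute algebra_simps)
  qed
  also have "\<dots> = (norm w + e / 2) * \<eta>"
    by (simp only: sum_distrib_left[symmetric] sum_lessThan_telescope u) simp
  finally have "(1 - e / 2) * \<eta> < (norm w + e / 2) * \<eta>" using u(4) by (simp add: algebra_simps)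
  then have "1 - e / 2 < norm w + e / 2" using \<eta>(1) by simp
  then show "1 \<le> norm w + e" by simp
qed

lemma concave_on_reflect:
  fixes f :: "real \<Rightarrow> real"
  assumes "concave_on {a<..<b} f"
  shows "concave_on {- b<..<- a} (\<lambda>t. f (- t))"
  unfolding concave_on_iff
proof (intro conjI ballI allI impI)
  fix x y u v :: real
  assume *: "x \<in> {- b<..<- a}" "y \<in> {- b<..<- a}" "0 \<le> u" "0 \<le> v" "u + v = 1"
  then have "- x \<in> {a<..<b}" "- y \<in> {a<..<b}" by auto
  then have "u * f (- x) + v * f (- y) \<le> f (u *\<^sub>R (- x) + v *\<^sub>R (- y))"
    using assms * unfolding concave_on_iff by blast
  then show "u * f (- x) + v * f (- y) \<le> f (- (u *\<^sub>R x + v *\<^sub>R y))" by (simp add: algebra_simps)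
qed (simp add: convex_real_interval)

lemma left_tangent_reflect:
  "left_tangent \<gamma> T u \<longleftrightarrow> right_tangent (\<lambda>t. \<gamma> (- t)) (- T) (- u)"
proof -
  have "(\<lambda>h. (\<gamma> (- (- T + h)) - \<gamma> (- (- T))) /\<^sub>R h) = (\<lambda>h. - ((\<gamma> T - \<gamma> (T - h)) /\<^sub>R h))"
    by (simp add: fun_eq_iff scaleR_diff_right)
  then show ?thesis unfolding left_tangent_def right_tangent_def by (simp add: tendsto_minus_cancel_left)
qed

lemma right_tangent_unique:
  assumes "right_tangent \<gamma> T w" "right_tangent \<gamma> T w'"
  shows "w = w'"
  using assms tendsto_unique[OF trivial_limit_at_right_real] unfolding right_tangent_def by blast

lemma right_tangent_iff_has_vector_derivative:
  "(\<gamma> has_vector_derivative w) (at_right T) \<longleftrightarrow> right_tangent \<gamma> T w"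
proof -
  have "(\<gamma> has_vector_derivative w) (at_right T) \<longleftrightarrow> ((\<lambda>y. (\<gamma> y - \<gamma> T) /\<^sub>R (y - T)) \<longlongrightarrow> w) (at_right T)"
  proof -
    have "((\<lambda>y. (\<gamma> y - \<gamma> T) /\<^sub>R (y - T)) \<longlongrightarrow> w) (at_right T) \<longleftrightarrow>
        ((\<lambda>y. (\<gamma> y - \<gamma> T) /\<^sub>R (y - T) - w) \<longlongrightarrow> 0) (at_right T)"
      by (rule LIM_zero_iff[symmetric])
    also have "\<dots> \<longleftrightarrow> ((\<lambda>y. (\<gamma> y - \<gamma> T - (y - T) *\<^sub>R w) /\<^sub>R norm (y - T)) \<longlongrightarrow> 0) (at_right T)"
      by (intro tendsto_cong eventually_mono[OF eventually_at_right_less]) (auto simp: scaleR_diff_right)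
    finally show ?thesis
      unfolding has_vector_derivative_def has_derivative_at_within
      by (auto simp: bounded_linear_scaleR_left)
  qed
  also have "\<dots> \<longleftrightarrow> right_tangent \<gamma> T w"
    unfolding right_tangent_def filterlim_at_right_to_0[of _ _ T] by (simp add: add.commute)
  finally show ?thesis .
qed

lemma two_sided_tangent:
  assumes "right_tangent \<gamma> T w" "left_tangent \<gamma> T w"
  shows "(\<gamma> has_vector_derivative w) (at T)"
proof -
  have l: "(\<gamma> has_vector_derivative w) (at_left T)"
  proof -
    have "((\<lambda>y. (\<gamma> y - \<gamma> T) /\<^sub>R (y - T) - w) \<longlongrightarrow> 0) (at_left T)"
    proof -
      have "((\<lambda>h. (\<gamma> T - \<gamma> (T - h)) /\<^sub>R h - w) \<longlongrightarrow> w - w) (at_right 0)"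
        using assms(2) unfolding left_tangent_def by (intro tendsto_diff tendsto_const)
      then have "((\<lambda>h. (\<gamma> (T - h) - \<gamma> T) /\<^sub>R (- h) - w) \<longlongrightarrow> 0) (at_right 0)"
        by (simp add: scaleR_diff_right)
      then show ?thesis
        unfolding filterlim_at_left_to_right at_right_to_0[of "- T"] filterlim_filtermap by simp
    qed
    then have "((\<lambda>y. (\<gamma> y - \<gamma> T - (y - T) *\<^sub>R w) /\<^sub>R norm (y - T)) \<longlongrightarrow> 0) (at_left T)"
    proof -
      assume "((\<lambda>y. (\<gamma> y - \<gamma> T) /\<^sub>R (y - T) - w) \<longlongrightarrow> 0) (at_left T)"
      then have "((\<lambda>y. - ((\<gamma> y - \<gamma> T) /\<^sub>R (y - T) - w)) \<longlongrightarrow> - 0) (at_left T)" by (rule tendsto_minus)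
      moreover have "\<forall>\<^sub>F y in at_left T. - ((\<gamma> y - \<gamma> T) /\<^sub>R (y - T) - w) = (\<gamma> y - \<gamma> T - (y - T) *\<^sub>R w) /\<^sub>R norm (y - T)"
      proof (rule eventually_mono[OF eventually_at_left_real[of "T - 1" T]])
        fix y assume "y \<in> {T - 1<..<T}"
        then have "\<bar>y - T\<bar> = - (y - T)" by simp
        then have "inverse \<bar>y - T\<bar> = - inverse (y - T)" by (simp only: inverse_minus_eq)
        then show "- ((\<gamma> y - \<gamma> T) /\<^sub>R (y - T) - w) = (\<gamma> y - \<gamma> T - (y - T) *\<^sub>R w) /\<^sub>R norm (y - T)"
          using \<open>y \<in> {T - 1<..<T}\<close> by (simp add: scaleR_diff_right)
      qed simp
      ultimately show ?thesis using tendsto_cong by fastforce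
    qed
    then show ?thesis
      unfolding has_vector_derivative_def has_derivative_at_within by (auto simp: bounded_linear_scaleR_left)
  qed
  have r: "(\<gamma> has_vector_derivative w) (at_right T)"
    using assms right_tangent_iff_has_vector_derivative by blast
  show ?thesis
    using l r unfolding has_vector_derivative_def has_derivative_at_within
    by (auto simp: filterlim_at_split)
qed

section \<open>Motion of billiard paths\<close>

text \<open>
  The motion of quasigeodesics is derived from the parametrization by arclength and the local semiconcavity.  Both
  properties are symmetric under reversal of time, so each result on right tangents has a counterpart for left tangents.
\<close>

locale billiard_path =
  fixes K :: "plane set" and \<gamma> :: "real \<Rightarrow> plane"
  assumes body: "convex_body K" and mem: "\<gamma> t \<in> K"
    and len: "arclength_parametrized UNIV \<gamma>"
    and semiconcave: "locally_semiconcave K \<gamma> T"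
begin

lemma reflect: "billiard_path K (\<lambda>t. \<gamma> (- t))"
proof
  show "arclength_parametrized UNIV (\<lambda>t. \<gamma> (- t))"
    unfolding arclength_parametrized_def
  proof (intro ballI impI)
    fix s t :: real assume "s \<le> t"
    have "curve_length (\<lambda>t. \<gamma> (- t)) (- (- s)) (- (- t)) = curve_length \<gamma> (- t) (- s)"
      by (rule curve_length_reverse)
    also have "\<dots> = ereal (t - s)" using len \<open>s \<le> t\<close> by (simp add: arclength_parametrized_def)
    finally show "curve_length (\<lambda>t. \<gamma> (- t)) s t = ereal (t - s)" by simp
  qed
  fix T
  obtain \<rho> \<epsilon> where r: "\<rho> > 0" "\<epsilon> > 0" and sc: "semiconcave_within K \<gamma> (- T) \<rho> \<epsilon>"
    using semiconcave[of "- T"] unfolding locally_semiconcave_def by blast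
  note c = semiconcave_withinD[OF sc]
  show "locally_semiconcave K (\<lambda>t. \<gamma> (- t)) T"
    unfolding locally_semiconcave_def semiconcave_within_def
  proof (rule exI[of _ \<rho>], intro conjI r(1), rule exI[of _ \<epsilon>], intro conjI r(2) ballI allI impI)
    fix p \<eta> assume "p \<in> K" "0 < \<eta>" "dist p (\<gamma> (- T)) < \<rho>" "\<eta> \<le> \<epsilon>" "4 * \<eta> < dist p (\<gamma> (- T))"
    then have "concave_on {- T - \<eta><..<- T + \<eta>} (\<lambda>t. (dist p (\<gamma> t))\<^sup>2 - t\<^sup>2)" by (rule c)
    from concave_on_reflect[OF this]
    show "concave_on {T - \<eta><..<T + \<eta>} (\<lambda>t. (dist p (\<gamma> (- t)))\<^sup>2 - t\<^sup>2)" by (simp add: algebra_simps)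
  qed
qed (use body mem in auto)

lemma lipschitz: "dist (\<gamma> s) (\<gamma> t) \<le> \<bar>s - t\<bar>"
  using arclength_dist_le[OF len] by simp

lemma continuous: "continuous_on S \<gamma>"
proof (rule continuous_on_subset[OF _ subset_UNIV])
  show "continuous_on UNIV \<gamma>"
    unfolding continuous_on_iff
  proof (intro ballI allI impI)
    fix x e :: real assume "e > 0"
    then show "\<exists>d>0. \<forall>x'\<in>UNIV. dist x' x < d \<longrightarrow> dist (\<gamma> x') (\<gamma> x) < e"
      using lipschitz by (intro exI[of _ e]) (auto simp: dist_real_def intro: le_less_trans)
  qed
qed

text \<open>
  The squared distances to \<open>p\<close>, to \<open>p\<close> shifted along the first axis and to \<open>p\<close> shifted along the second axis have
  one-sided derivatives by concavity; their differences are the coordinates of the curve,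
  up to factors and constants.
\<close>

lemma ex_right_tangent: "\<exists>w. right_tangent \<gamma> T w \<and> norm w = 1"
proof -
  obtain \<rho> \<epsilon> where r: "\<rho> > 0" "\<epsilon> > 0" and sc: "semiconcave_within K \<gamma> T \<rho> \<epsilon>"
    using semiconcave[of T] unfolding locally_semiconcave_def by blast
  note c = semiconcave_withinD[OF sc]
  have K: "K = closure (interior K)"
    using body convex_closure_interior[of K] by (simp add: convex_body_def closure_closed compact_imp_closed)
  define V where "V = ball (\<gamma> T) \<rho> \<inter> interior K"
  have V: "open V" "V \<noteq> {}"
  proof -
    show "open V" unfolding V_def by (intro open_Int open_ball open_interior)
    have "\<gamma> T \<in> closure (interior K)" using mem K by blast
    moreover have "\<gamma> T \<in> ball (\<gamma> T) \<rho>" using r by simp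
    ultimately show "V \<noteq> {}"
      using open_Int_closure_eq_empty[of "ball (\<gamma> T) \<rho>" "interior K"] unfolding V_def by blast
  qed
  have "V - {\<gamma> T} \<noteq> {}" using V not_open_singleton[of "\<gamma> T"] by (metis Diff_eq_empty_iff subset_singletonD)
  then obtain p0 where p0: "p0 \<in> V - {\<gamma> T}" by blast
  moreover have "open (V - {\<gamma> T})" using V by (simp add: open_delete)
  ultimately obtain a where a: "a > 0" "ball p0 a \<subseteq> V - {\<gamma> T}" using open_contains_ball by blast
  define p where "p i = p0 + (a / 2) *\<^sub>R axis i (1::real)" for i :: 2
  have pV: "p i \<in> V - {\<gamma> T}" for i
  proof -
    have "dist p0 (p i) = a / 2" using a by (simp add: p_def dist_norm norm_axis_1)
    then show ?thesis using a by (intro subsetD[OF a(2)]) simp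
  qed
  define \<eta> where "\<eta> = min \<epsilon> (min (dist p0 (\<gamma> T)) (min (dist (p 1) (\<gamma> T)) (dist (p 2) (\<gamma> T))) / 5)"
  have \<eta>: "\<eta> > 0" using r p0 pV[of 1] pV[of 2] by (simp add: \<eta>_def)
  have conc: "concave_on {T - \<eta><..<T + \<eta>} (\<lambda>t. (dist x (\<gamma> t))\<^sup>2 - t\<^sup>2)" if x: "x = p0 \<or> x = p 1 \<or> x = p 2" for x
  proof (rule c[OF _ \<eta>])
    have "x \<in> V - {\<gamma> T}" using x p0 pV by auto
    then show "x \<in> K" "dist x (\<gamma> T) < \<rho>"
      using interior_subset by (auto simp: V_def dist_commute)
    have pos: "dist x (\<gamma> T) > 0" using \<open>x \<in> V - {\<gamma> T}\<close> by simp
    have "\<eta> \<le> dist x (\<gamma> T) / 5" using x by (auto simp: \<eta>_def)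
    with pos show "4 * \<eta> < dist x (\<gamma> T)" by linarith
    show "\<eta> \<le> \<epsilon>" by (simp add: \<eta>_def)
  qed
  have ex: "\<exists>D. strict_right_deriv (\<lambda>t. (dist x (\<gamma> t))\<^sup>2 - t\<^sup>2) T D" if x: "x = p0 \<or> x = p 1 \<or> x = p 2" for x
    by (rule concave_strict_right_deriv[OF conc[OF x]]) (use \<eta> in auto)
  have comp: "\<exists>D. strict_right_deriv (\<lambda>t. \<gamma> t $ i) T D" if i: "i = 1 \<or> i = 2" for i
  proof -
    obtain D where D: "strict_right_deriv (\<lambda>t. (dist p0 (\<gamma> t))\<^sup>2 - t\<^sup>2) T D" using ex by blast
    obtain E where E: "strict_right_deriv (\<lambda>t. (dist (p i) (\<gamma> t))\<^sup>2 - t\<^sup>2) T E" using ex i by blast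
    have "\<gamma> t $ i = (1 / a) * (((dist p0 (\<gamma> t))\<^sup>2 - t\<^sup>2) - ((dist (p i) (\<gamma> t))\<^sup>2 - t\<^sup>2)) + (p0 $ i + a / 4)" for t
    proof -
      have "(dist (p i) (\<gamma> t))\<^sup>2 = (norm ((p0 - \<gamma> t) + (a / 2) *\<^sub>R axis i 1))\<^sup>2"
        by (simp add: p_def dist_norm algebra_simps)
      also have "\<dots> = (dist p0 (\<gamma> t))\<^sup>2 + a * ((p0 - \<gamma> t) \<bullet> axis i 1) + (a / 2)\<^sup>2"
        unfolding power2_norm_eq_inner dist_norm
        by (simp add: inner_add_left inner_add_right inner_commute inner_axis_axis power2_eq_square)
      finally have "(dist (p i) (\<gamma> t))\<^sup>2 = (dist p0 (\<gamma> t))\<^sup>2 + a * (p0 $ i - \<gamma> t $ i) + (a / 2)\<^sup>2"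
        by (simp add: inner_axis)
      then show ?thesis using a(1) by (simp add: field_simps power2_eq_square)
    qed
    then show ?thesis using strict_right_deriv_combine[OF D E, of "1 / a" "p0 $ i + a / 4"] by auto
  qed
  obtain D1 where D1: "strict_right_deriv (\<lambda>t. \<gamma> t $ 1) T D1" using comp by blast
  obtain D2 where D2: "strict_right_deriv (\<lambda>t. \<gamma> t $ 2) T D2" using comp by blast
  have s: "strict_right_deriv \<gamma> T (vector [D1, D2])"
    using D1 D2 by (intro strict_right_deriv_components) auto
  then show ?thesis using strict_right_deriv_imp_right_tangent strict_right_deriv_arclength[OF len] by blast
qed

lemma ex_left_tangent: "\<exists>u. left_tangent \<gamma> T u \<and> norm u = 1"
proof -
  interpret r: billiard_path K "\<lambda>t. \<gamma> (- t)" by (rule reflect)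
  obtain w where "right_tangent (\<lambda>t. \<gamma> (- t)) (- T) w" "norm w = 1" using r.ex_right_tangent by blast
  then show ?thesis by (intro exI[of _ "- w"]) (simp add: left_tangent_reflect)
qed

text \<open>
  At \<open>T\<close> the right derivative of the concave function \<open>(dist p (\<gamma> t))\<^sup>2 - t\<^sup>2\<close> is at most its left derivative.  This is
  applied to a point \<open>p\<close> near \<open>\<gamma> T\<close> on the segment to \<open>x\<close>.  The inequality contains the reflection law: at a smooth
  boundary point the directions to points \<open>x\<close> fill an open half plane, so that
  only the normal component of the velocity can change.
\<close>

lemma corner:
  assumes u: "left_tangent \<gamma> T u" and w: "right_tangent \<gamma> T w" and x: "x \<in> K"
  shows "0 \<le> (w - u) \<bullet> (x - \<gamma> T)"
proof (cases "x = \<gamma> T")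
  case False
  let ?q = "\<gamma> T"
  obtain \<rho> \<epsilon> where r: "\<rho> > 0" "\<epsilon> > 0" and sc: "semiconcave_within K \<gamma> T \<rho> \<epsilon>"
    using semiconcave[of T] unfolding locally_semiconcave_def by blast
  note c = semiconcave_withinD[OF sc]
  define l where "l = min 1 (\<rho> / (2 * norm (x - ?q)))"
  have l: "0 < l" "l \<le> 1" "l * norm (x - ?q) < \<rho>"
  proof -
    have n: "norm (x - ?q) > 0" using False by simp
    then show "0 < l" "l \<le> 1" using r by (auto simp: l_def)
    have "l * norm (x - ?q) \<le> \<rho> / (2 * norm (x - ?q)) * norm (x - ?q)"
      using n by (intro mult_right_mono) (auto simp: l_def)
    also have "\<dots> = \<rho> / 2" using n by (simp add: field_simps)
    finally show "l * norm (x - ?q) < \<rho>" using r by simp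
  qed
  define p where "p = ?q + l *\<^sub>R (x - ?q)"
  have pK: "p \<in> K"
  proof -
    have "(1 - l) *\<^sub>R ?q + l *\<^sub>R x \<in> K"
      using body x mem l by (intro convexD) (auto simp: convex_body_def)
    then show ?thesis by (simp add: p_def algebra_simps)
  qed
  have pq: "p - ?q = l *\<^sub>R (x - ?q)" by (simp add: p_def)
  have dp: "dist p ?q = l * norm (x - ?q)" using l by (simp add: dist_norm pq)
  have dpos: "dist p ?q > 0" using False l by (simp add: dp)
  define \<eta> where "\<eta> = min \<epsilon> (dist p ?q / 5)"
  have \<eta>: "\<eta> > 0" "\<eta> \<le> \<epsilon>" "4 * \<eta> < dist p ?q"
    using r dpos by (auto simp: \<eta>_def min_def)
  define F where "F t = (dist p (\<gamma> t))\<^sup>2 - t\<^sup>2" for t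
  have F: "concave_on {T - \<eta><..<T + \<eta>} F"
    unfolding F_def using c[OF pK \<eta>(1) _ \<eta>(2,3)] l dp by simp
  have exp: "(dist p y)\<^sup>2 = (dist p ?q)\<^sup>2 + 2 * ((?q - p) \<bullet> (y - ?q)) + (norm (y - ?q))\<^sup>2" for y
    unfolding dist_norm power2_norm_eq_inner by (simp add: inner_diff inner_commute algebra_simps)
  have slope_r: "(F (T + h) - F T) / h = 2 * ((?q - p) \<bullet> ((\<gamma> (T + h) - ?q) /\<^sub>R h)) + (norm ((\<gamma> (T + h) - ?q) /\<^sub>R h))\<^sup>2 * h - 2 * T - h"
    if "h > 0" for h
  proof -
    define D where "D = (\<gamma> (T + h) - ?q) /\<^sub>R h"
    have e: "\<gamma> (T + h) - ?q = h *\<^sub>R D" using that by (simp add: D_def)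
    have "F (T + h) - F T = h * (2 * ((?q - p) \<bullet> D) + (norm D)\<^sup>2 * h - 2 * T - h)"
      unfolding F_def exp[of "\<gamma> (T + h)"] e by (simp add: power2_eq_square algebra_simps)
    then show ?thesis using that unfolding D_def[symmetric] by simp
  qed
  have slope_l: "(F T - F (T - h)) / h = 2 * ((?q - p) \<bullet> ((?q - \<gamma> (T - h)) /\<^sub>R h)) - (norm ((?q - \<gamma> (T - h)) /\<^sub>R h))\<^sup>2 * h - 2 * T + h"
    if "h > 0" for h
  proof -
    define D where "D = (?q - \<gamma> (T - h)) /\<^sub>R h"
    have "?q - \<gamma> (T - h) = h *\<^sub>R D" using that by (simp add: D_def)
    then have e: "\<gamma> (T - h) - ?q = - (h *\<^sub>R D)" by (metis minus_diff_eq)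
    have "F T - F (T - h) = h * (2 * ((?q - p) \<bullet> D) - (norm D)\<^sup>2 * h - 2 * T + h)"
      unfolding F_def exp[of "\<gamma> (T - h)"] e by (simp add: power2_eq_square algebra_simps)
    then show ?thesis using that unfolding D_def[symmetric] by simp
  qed
  have idl: "((\<lambda>h::real. h) \<longlongrightarrow> 0) (at_right 0)" by (rule tendsto_ident_at)
  have R: "((\<lambda>h. (F (T + h) - F T) / h) \<longlongrightarrow> 2 * ((?q - p) \<bullet> w) + (norm w)\<^sup>2 * 0 - 2 * T - 0) (at_right 0)"
  proof (rule Lim_transform_eventually)
    show "((\<lambda>h. 2 * ((?q - p) \<bullet> ((\<gamma> (T + h) - ?q) /\<^sub>R h)) + (norm ((\<gamma> (T + h) - ?q) /\<^sub>R h))\<^sup>2 * h - 2 * T - h)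
        \<longlongrightarrow> 2 * ((?q - p) \<bullet> w) + (norm w)\<^sup>2 * 0 - 2 * T - 0) (at_right 0)"
      using w unfolding right_tangent_def by (intro tendsto_intros idl)
    show "\<forall>\<^sub>F h in at_right 0. 2 * ((?q - p) \<bullet> ((\<gamma> (T + h) - ?q) /\<^sub>R h)) + (norm ((\<gamma> (T + h) - ?q) /\<^sub>R h))\<^sup>2 * h - 2 * T - h = (F (T + h) - F T) / h"
      using slope_r by (intro eventually_mono[OF eventually_at_right_less]) auto
  qed
  have L: "((\<lambda>h. (F T - F (T - h)) / h) \<longlongrightarrow> 2 * ((?q - p) \<bullet> u) - (norm u)\<^sup>2 * 0 - 2 * T + 0) (at_right 0)"
  proof (rule Lim_transform_eventually)
    show "((\<lambda>h. 2 * ((?q - p) \<bullet> ((?q - \<gamma> (T - h)) /\<^sub>R h)) - (norm ((?q - \<gamma> (T - h)) /\<^sub>R h))\<^sup>2 * h - 2 * T + h)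
        \<longlongrightarrow> 2 * ((?q - p) \<bullet> u) - (norm u)\<^sup>2 * 0 - 2 * T + 0) (at_right 0)"
      using u unfolding left_tangent_def by (intro tendsto_intros idl)
    show "\<forall>\<^sub>F h in at_right 0. 2 * ((?q - p) \<bullet> ((?q - \<gamma> (T - h)) /\<^sub>R h)) - (norm ((?q - \<gamma> (T - h)) /\<^sub>R h))\<^sup>2 * h - 2 * T + h = (F T - F (T - h)) / h"
      using slope_l by (intro eventually_mono[OF eventually_at_right_less]) auto
  qed
  have "\<forall>\<^sub>F h in at_right 0. (F (T + h) - F T) / h \<le> (F T - F (T - h)) / h"
  proof (rule eventually_mono[OF eventually_at_right_real[OF \<eta>(1)]])
    fix h assume "h \<in> {0<..<\<eta>}"
    then show "(F (T + h) - F T) / h \<le> (F T - F (T - h)) / h"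
      using concave_slopes[OF F, of "T - h" "T + h" T] by auto
  qed
  then have "2 * ((?q - p) \<bullet> w) + (norm w)\<^sup>2 * 0 - 2 * T - 0 \<le> 2 * ((?q - p) \<bullet> u) - (norm u)\<^sup>2 * 0 - 2 * T + 0"
    by (rule tendsto_le[OF trivial_limit_at_right_real L R])
  then have "0 \<le> (p - ?q) \<bullet> (w - u)" by (simp add: inner_diff)
  then have "0 \<le> l * ((x - ?q) \<bullet> (w - u))" by (simp add: pq)
  then show ?thesis using l by (simp add: zero_le_mult_iff inner_commute)
qed simp

lemma interior_derivative:
  assumes "\<gamma> T \<in> interior K"
  shows "\<exists>w. (\<gamma> has_vector_derivative w) (at T) \<and> norm w = 1"
proof -
  obtain w where w: "right_tangent \<gamma> T w" "norm w = 1" using ex_right_tangent by blast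
  obtain u where u: "left_tangent \<gamma> T u" "norm u = 1" using ex_left_tangent by blast
  obtain r where r: "r > 0" "cball (\<gamma> T) r \<subseteq> K" using assms unfolding mem_interior_cball by blast
  have "w - u = 0"
  proof (rule ccontr)
    assume ne: "w - u \<noteq> 0"
    define x where "x = \<gamma> T - (r / norm (w - u)) *\<^sub>R (w - u)"
    have "dist (\<gamma> T) x = r" using ne r by (simp add: x_def dist_norm)
    then have "x \<in> K" using r by auto
    then have "0 \<le> (w - u) \<bullet> (x - \<gamma> T)" using corner u w by blast
    also have "\<dots> = - (r / norm (w - u)) * ((w - u) \<bullet> (w - u))" by (simp add: x_def)
    also have "\<dots> < 0" using ne r by (simp add: dot_square_norm)
    finally show False by simp
  qed
  then show ?thesis using two_sided_tangent[of \<gamma> T w] w u by auto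
qed

text \<open>
  Let \<open>v\<close> be the change of velocity between the times \<open>s\<close> and \<open>t\<close>.  Concavity for the point at distance \<open>a\<close> behind \<open>\<gamma> s\<close> in
  the direction of \<open>v\<close> bounds \<open>a * norm v\<close> by the defect \<open>(t - s) - (\<gamma> t - \<gamma> s) \<bullet> g t\<close>.  The defect is at most
  \<open>2 * (t - s)\<close>, so the velocity is Lipschitz; but then the defect of a unit speed curve is of third order.
\<close>

lemma interior_turning_bound:
  assumes "\<gamma> T \<in> interior K"
  shows "\<exists>\<delta>>0. \<exists>C. \<forall>s t. T - \<delta> < s \<longrightarrow> s < t \<longrightarrow> t < T + \<delta> \<longrightarrow>
    norm (vector_derivative \<gamma> (at t) - vector_derivative \<gamma> (at s)) \<le> C * (t - s) ^ 3"
proof -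
  obtain \<rho> \<epsilon> where r: "\<rho> > 0" "\<epsilon> > 0" and sc: "semiconcave_within K \<gamma> T \<rho> \<epsilon>"
    using semiconcave[of T] unfolding locally_semiconcave_def by blast
  note c = semiconcave_withinD[OF sc]
  obtain r0 where r0: "r0 > 0" "cball (\<gamma> T) r0 \<subseteq> K" using assms unfolding mem_interior_cball by blast
  define a where "a = min r0 \<rho> / 3"
  have a: "a > 0" "2 * a < r0" "2 * a < \<rho>" using r r0 by (auto simp: a_def)
  define \<eta> where "\<eta> = min \<epsilon> (a / 8)"
  have \<eta>: "\<eta> > 0" "\<eta> \<le> \<epsilon>" "\<eta> \<le> a / 8" using r a by (auto simp: \<eta>_def)
  define g where "g t = vector_derivative \<gamma> (at t)" for t
  have near: "dist (\<gamma> t) (\<gamma> T) < \<eta>" if "T - \<eta> < t" "t < T + \<eta>" for t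
    using lipschitz[of t T] that by (auto simp: abs_if split: if_splits)
  have g: "(\<gamma> has_vector_derivative g t) (at t)" "norm (g t) = 1" if "T - \<eta> < t" "t < T + \<eta>" for t
  proof -
    have "\<gamma> t \<in> ball (\<gamma> T) r0" using near[OF that] \<eta> a by (simp add: dist_commute)
    moreover have "ball (\<gamma> T) r0 \<subseteq> K" using r0 ball_subset_cball by blast
    ultimately have "\<gamma> t \<in> interior K" using interior_maximal open_ball by blast
    then obtain w where w: "(\<gamma> has_vector_derivative w) (at t)" "norm w = 1" using interior_derivative by blast
    then have "g t = w" by (simp add: g_def vector_derivative_at)
    with w show "(\<gamma> has_vector_derivative g t) (at t)" "norm (g t) = 1" by auto
  qed
  have key: "a * norm (g t - g s) \<le> (t - s) - (\<gamma> t - \<gamma> s) \<bullet> g t"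
    if st: "T - \<eta> < s" "s < t" "t < T + \<eta>" for s t
  proof (cases "g t = g s")
    case True
    have "(\<gamma> t - \<gamma> s) \<bullet> g t \<le> norm (\<gamma> t - \<gamma> s) * norm (g t)" by (rule norm_cauchy_schwarz)
    also have "\<dots> \<le> t - s" using lipschitz[of t s] g(2)[of t] st by (simp add: dist_norm)
    finally show ?thesis using True by simp
  next
    case False
    define v where "v = g t - g s"
    have v: "norm v > 0" using False by (simp add: v_def)
    define p where "p = \<gamma> s - (a / norm v) *\<^sub>R v"
    have ds: "dist p (\<gamma> s) = a" using v a by (simp add: p_def dist_norm)
    have nT: "dist (\<gamma> s) (\<gamma> T) < a / 8" using near[of s] st \<eta> by linarith
    have pd: "dist p (\<gamma> T) < 2 * a" "4 * \<eta> < dist p (\<gamma> T)"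
      using dist_triangle[of p "\<gamma> T" "\<gamma> s"] dist_triangle[of p "\<gamma> s" "\<gamma> T"] nT ds \<eta> by (simp_all add: dist_commute)
    have "p \<in> K" using pd a by (intro subsetD[OF r0(2)]) (simp add: dist_commute)
    then have F: "concave_on {T - \<eta><..<T + \<eta>} (\<lambda>t. (dist p (\<gamma> t))\<^sup>2 - t\<^sup>2)"
      using c[OF _ \<eta>(1) _ \<eta>(2) pd(2)] pd a by simp
    have dF: "((\<lambda>t. (dist p (\<gamma> t))\<^sup>2 - t\<^sup>2) has_field_derivative (2 * ((\<gamma> x - p) \<bullet> g x) - 2 * x)) (at x)"
      if x: "T - \<eta> < x" "x < T + \<eta>" for x
    proof -
      have "((\<lambda>t. (\<gamma> t - p) \<bullet> (\<gamma> t - p)) has_vector_derivative ((\<gamma> x - p) \<bullet> (g x - 0) + (g x - 0) \<bullet> (\<gamma> x - p))) (at x)"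
        by (intro bounded_bilinear.has_vector_derivative[OF bounded_bilinear_inner] has_vector_derivative_diff g[OF x] has_vector_derivative_const)
      then have "((\<lambda>t. (\<gamma> t - p) \<bullet> (\<gamma> t - p)) has_field_derivative (2 * ((\<gamma> x - p) \<bullet> g x))) (at x)"
        by (simp add: has_real_derivative_iff_has_vector_derivative inner_commute)
      moreover have "((\<lambda>t. t\<^sup>2) has_field_derivative (2 * x)) (at x)" by (auto intro!: derivative_eq_intros)
      ultimately have "((\<lambda>t. (\<gamma> t - p) \<bullet> (\<gamma> t - p) - t\<^sup>2) has_field_derivative (2 * ((\<gamma> x - p) \<bullet> g x) - 2 * x)) (at x)"
        by (rule DERIV_diff)
      moreover have "(\<lambda>t. (dist p (\<gamma> t))\<^sup>2 - t\<^sup>2) = (\<lambda>t. (\<gamma> t - p) \<bullet> (\<gamma> t - p) - t\<^sup>2)"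
        by (simp add: dist_norm norm_minus_commute power2_norm_eq_inner[symmetric])
      ultimately show ?thesis by simp
    qed
    have tang: "(dist p (\<gamma> y))\<^sup>2 - y\<^sup>2 - ((dist p (\<gamma> x))\<^sup>2 - x\<^sup>2) \<le> (2 * ((\<gamma> x - p) \<bullet> g x) - 2 * x) * (y - x)"
      if x: "x \<in> {T - \<eta><..<T + \<eta>}" and y: "y \<in> {T - \<eta><..<T + \<eta>}" for x y
    proof -
      have "(- ((dist p (\<gamma> y))\<^sup>2 - y\<^sup>2)) - (- ((dist p (\<gamma> x))\<^sup>2 - x\<^sup>2)) \<ge> (- (2 * ((\<gamma> x - p) \<bullet> g x) - 2 * x)) * (y - x)"
      proof (rule convex_on_imp_above_tangent)
        show "convex_on {T - \<eta><..<T + \<eta>} (\<lambda>t. - ((dist p (\<gamma> t))\<^sup>2 - t\<^sup>2))" using F by (simp add: concave_on_def)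
        show "((\<lambda>t. - ((dist p (\<gamma> t))\<^sup>2 - t\<^sup>2)) has_field_derivative - (2 * ((\<gamma> x - p) \<bullet> g x) - 2 * x)) (at x within {T - \<eta><..<T + \<eta>})"
          by (rule DERIV_minus, rule has_field_derivative_at_within, rule dF) (use x in auto)
      qed (use x y in \<open>auto simp: interior_open\<close>)
      then show ?thesis by (simp add: algebra_simps)
    qed
    have "(2 * ((\<gamma> t - p) \<bullet> g t) - 2 * t) * (t - s) \<le> (2 * ((\<gamma> s - p) \<bullet> g s) - 2 * s) * (t - s)"
      using tang[of s t] tang[of t s] st by (simp add: algebra_simps)
    then have "(\<gamma> t - p) \<bullet> g t - t \<le> (\<gamma> s - p) \<bullet> g s - s" using st by (simp add: mult_le_cancel_right)
    moreover have "(\<gamma> t - p) \<bullet> g t - (\<gamma> s - p) \<bullet> g s = (\<gamma> t - \<gamma> s) \<bullet> g t + (\<gamma> s - p) \<bullet> v"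
      by (simp add: v_def inner_diff algebra_simps)
    moreover have "(\<gamma> s - p) \<bullet> v = a * norm v"
      using v by (simp add: p_def dot_square_norm power2_eq_square)
    ultimately show ?thesis by (simp add: v_def)
  qed
  define L where "L = 2 / a"
  have L: "L > 0" using a by (simp add: L_def)
  have lip: "norm (g t - g s) \<le> L * (t - s)" if st: "T - \<eta> < s" "s < t" "t < T + \<eta>" for s t
  proof -
    define X where "X = (\<gamma> t - \<gamma> s) \<bullet> g t"
    have "\<bar>X\<bar> \<le> norm (\<gamma> t - \<gamma> s) * norm (g t)"
      unfolding X_def by (rule Cauchy_Schwarz_ineq2)
    also have "\<dots> \<le> t - s" using lipschitz[of t s] g(2)[of t] st by (simp add: dist_norm)
    finally have "- X \<le> t - s" by simp
    moreover have "a * norm (g t - g s) \<le> (t - s) - X" using key[OF st] by (simp add: X_def)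
    ultimately have "a * norm (g t - g s) \<le> 2 * (t - s)" by simp
    then show ?thesis using a by (simp add: L_def field_simps)
  qed
  have fwd: "(t - s) * (1 - (L * (t - s))\<^sup>2 / 2) \<le> (\<gamma> t - \<gamma> s) \<bullet> g t"
    if st: "T - \<eta> < s" "s < t" "t < T + \<eta>" for s t
  proof -
    have d: "((\<lambda>x. \<gamma> x \<bullet> g t) has_real_derivative (g x \<bullet> g t)) (at x)" if "s \<le> x" "x \<le> t" for x
    proof -
      have "((\<lambda>x. \<gamma> x \<bullet> g t) has_vector_derivative (\<gamma> x \<bullet> 0 + g x \<bullet> g t)) (at x)"
        using that st by (intro bounded_bilinear.has_vector_derivative[OF bounded_bilinear_inner] g has_vector_derivative_const) auto
      then show ?thesis by (simp add: has_real_derivative_iff_has_vector_derivative)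
    qed
    obtain z where z: "s < z" "z < t" "\<gamma> t \<bullet> g t - \<gamma> s \<bullet> g t = (t - s) * (g z \<bullet> g t)"
      using MVT2[OF \<open>s < t\<close> d] by blast
    have n: "norm (g z) = 1" "norm (g t) = 1" using g(2) z st by auto
    have "(norm (g t - g z))\<^sup>2 = 2 - 2 * (g z \<bullet> g t)"
      using n by (simp add: power2_norm_eq_inner inner_diff inner_commute norm_eq_1)
    moreover have "(norm (g t - g z))\<^sup>2 \<le> (L * (t - s))\<^sup>2"
    proof (rule power_mono)
      have "norm (g t - g z) \<le> L * (t - z)" using lip[of z t] z st by simp
      also have "\<dots> \<le> L * (t - s)" using L z by simp
      finally show "norm (g t - g z) \<le> L * (t - s)" .
    qed simp
    ultimately have "1 - (L * (t - s))\<^sup>2 / 2 \<le> g z \<bullet> g t" by linarith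
    then show ?thesis using z st by (simp add: inner_diff_left mult_left_mono)
  qed
  have "norm (g t - g s) \<le> (L\<^sup>2 / (2 * a)) * (t - s) ^ 3" if st: "T - \<eta> < s" "s < t" "t < T + \<eta>" for s t
  proof -
    have "a * norm (g t - g s) \<le> (t - s) * ((L * (t - s))\<^sup>2 / 2)"
    proof -
      have "(t - s) * (1 - (L * (t - s))\<^sup>2 / 2) = (t - s) - (t - s) * ((L * (t - s))\<^sup>2 / 2)"
        by (simp only: right_diff_distrib mult_1_right)
      then show ?thesis using key[OF st] fwd[OF st] by linarith
    qed
    also have "\<dots> = a * ((L\<^sup>2 / (2 * a)) * (t - s) ^ 3)"
      using a by (simp add: power2_eq_square power3_eq_cube)
    finally show ?thesis using a by (simp only: mult_le_cancel_left_pos)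
  qed
  then show ?thesis using \<eta>(1) unfolding g_def by blast
qed

end

context billiard_path
begin

text \<open>
  A velocity whose variation is bounded by the cube of the elapsed time is constant.
\<close>

lemma interior_straight:
  assumes ab: "a < b" and int: "\<And>t. a < t \<Longrightarrow> t < b \<Longrightarrow> \<gamma> t \<in> interior K"
  shows "\<exists>e. norm e = 1 \<and> (\<forall>t\<in>{a..b}. \<gamma> t = \<gamma> a + (t - a) *\<^sub>R e)"
proof -
  define g where "g t = vector_derivative \<gamma> (at t)" for t
  have g: "(\<gamma> has_vector_derivative g t) (at t)" "norm (g t) = 1" if "t \<in> {a<..<b}" for t
  proof -
    have "\<gamma> t \<in> interior K" using int that by simp
    then obtain w where w: "(\<gamma> has_vector_derivative w) (at t)" "norm w = 1"
      using interior_derivative by blast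
    then have "g t = w" by (simp add: g_def vector_derivative_at)
    with w show "(\<gamma> has_vector_derivative g t) (at t)" "norm (g t) = 1" by auto
  qed
  have "(g has_vector_derivative 0) (at T within {a<..<b})" if T: "T \<in> {a<..<b}" for T
  proof -
    have "\<gamma> T \<in> interior K" using int T by simp
    then obtain \<delta> C where \<delta>: "\<delta> > 0"
      and "\<forall>s t. T - \<delta> < s \<longrightarrow> s < t \<longrightarrow> t < T + \<delta> \<longrightarrow> norm (g t - g s) \<le> C * (t - s) ^ 3"
      using interior_turning_bound unfolding g_def by blast
    then have C: "norm (g t - g s) \<le> C * (t - s) ^ 3" if "T - \<delta> < s" "s < t" "t < T + \<delta>" for s t
      using that by simp
    have "((\<lambda>y. (g y - g T) /\<^sub>R norm (y - T)) \<longlongrightarrow> 0) (at T)"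
    proof (rule Lim_null_comparison)
      have "norm ((g y - g T) /\<^sub>R norm (y - T)) \<le> C * (y - T)\<^sup>2" if y: "y \<noteq> T" "dist y T < \<delta>" for y
      proof -
        have "norm (g y - g T) \<le> C * \<bar>y - T\<bar> ^ 3"
        proof (cases "y < T")
          case True
          then show ?thesis using C[of y T] y \<delta> by (simp add: dist_real_def norm_minus_commute)
        next
          case False
          then show ?thesis using C[of T y] y \<delta> by (simp add: dist_real_def)
        qed
        also have "\<dots> = C * (y - T)\<^sup>2 * \<bar>y - T\<bar>" by (simp add: power3_eq_cube power2_eq_square)
        finally have "norm (g y - g T) / \<bar>y - T\<bar> \<le> C * (y - T)\<^sup>2" using y by (simp add: pos_divide_le_eq)
        then show ?thesis by (simp add: divide_inverse mult.commute)
      qed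
      then show "\<forall>\<^sub>F y in at T. norm ((g y - g T) /\<^sub>R norm (y - T)) \<le> C * (y - T)\<^sup>2"
        unfolding eventually_at using \<delta> by (intro exI[of _ \<delta>]) auto
      have "((\<lambda>y. C * (y - T)\<^sup>2) \<longlongrightarrow> C * (T - T)\<^sup>2) (at T)" by (intro tendsto_intros)
      then show "((\<lambda>y. C * (y - T)\<^sup>2) \<longlongrightarrow> 0) (at T)" by simp
    qed
    then have "(g has_vector_derivative 0) (at T)"
      unfolding has_vector_derivative_def has_derivative_at_within by simp
    then show ?thesis by (rule has_vector_derivative_at_within)
  qed
  then obtain e where e: "\<And>t. t \<in> {a<..<b} \<Longrightarrow> g t = e"
    using has_vector_derivative_zero_constant[of "{a<..<b}" g] by (auto simp: convex_real_interval)
  have ne: "norm e = 1" using e[of "(a + b) / 2"] g(2)[of "(a + b) / 2"] ab by simp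
  define f where "f t = \<gamma> t - (t - a) *\<^sub>R e" for t
  have "f t = \<gamma> a" if t: "t \<in> {a..b}" for t
  proof (rule has_derivative_zero_unique_strong_interval[of "{a, b}" a b f "\<gamma> a" t])
    show "continuous_on {a..b} f" unfolding f_def by (intro continuous_intros continuous)
    show "f a = \<gamma> a" by (simp add: f_def)
    fix x assume x: "x \<in> {a..b} - {a, b}"
    then have x: "x \<in> {a<..<b}" by auto
    have "((\<lambda>t. (t - a) *\<^sub>R e) has_vector_derivative e) (at x within {a..b})"
      unfolding has_vector_derivative_def by (rule derivative_eq_intros | simp)+
    then have "(f has_vector_derivative (g x - e)) (at x within {a..b})"
      unfolding f_def by (rule has_vector_derivative_diff[OF has_vector_derivative_at_within[OF g(1)[OF x]]])
    then show "(f has_derivative (\<lambda>h. 0)) (at x within {a..b})"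
      using e[OF x] by (simp add: has_vector_derivative_def)
  qed (use t in auto)
  then have "\<forall>t\<in>{a..b}. \<gamma> t = \<gamma> a + (t - a) *\<^sub>R e" by (simp add: f_def algebra_simps)
  with ne show ?thesis by blast
qed

lemma straight_right_tangent:
  assumes "a < b" "\<And>t. t \<in> {a..b} \<Longrightarrow> \<gamma> t = \<gamma> a + (t - a) *\<^sub>R e"
  shows "right_tangent \<gamma> a e"
  unfolding right_tangent_def
proof (rule Lim_transform_eventually)
  show "((\<lambda>h. e) \<longlongrightarrow> e) (at_right 0)" by simp
  have ba: "0 < b - a" using assms by simp
  show "\<forall>\<^sub>F h in at_right 0. e = (\<gamma> (a + h) - \<gamma> a) /\<^sub>R h"
  proof (rule eventually_mono[OF eventually_at_right_real[OF ba]])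
    fix h assume h: "h \<in> {0<..<b - a}"
    have "\<gamma> (a + h) = \<gamma> a + (a + h - a) *\<^sub>R e" by (rule assms(2)) (use h in auto)
    then show "e = (\<gamma> (a + h) - \<gamma> a) /\<^sub>R h" using h by simp
  qed
qed

lemma straight_left_tangent:
  assumes "a < b" "\<And>t. t \<in> {a..b} \<Longrightarrow> \<gamma> t = \<gamma> a + (t - a) *\<^sub>R e"
  shows "left_tangent \<gamma> b e"
  unfolding left_tangent_def
proof (rule Lim_transform_eventually)
  show "((\<lambda>h. e) \<longlongrightarrow> e) (at_right 0)" by simp
  have ba: "0 < b - a" using assms by simp
  show "\<forall>\<^sub>F h in at_right 0. e = (\<gamma> b - \<gamma> (b - h)) /\<^sub>R h"
  proof (rule eventually_mono[OF eventually_at_right_real[OF ba]])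
    fix h assume h: "h \<in> {0<..<b - a}"
    have 1: "\<gamma> b = \<gamma> a + (b - a) *\<^sub>R e" by (rule assms(2)) (use assms(1) in auto)
    have 2: "\<gamma> (b - h) = \<gamma> a + (b - h - a) *\<^sub>R e" by (rule assms(2)) (use h in auto)
    have "\<gamma> b - \<gamma> (b - h) = h *\<^sub>R e" unfolding 1 2 by (simp add: algebra_simps)
    then show "e = (\<gamma> b - \<gamma> (b - h)) /\<^sub>R h" using h by simp
  qed
qed

text \<open>
  By convexity the body contains a cone with vertex \<open>\<gamma> T\<close> around the direction \<open>w\<close>.
\<close>

lemma enters_interior:
  assumes w: "right_tangent \<gamma> T w" and x: "\<gamma> T + l *\<^sub>R w \<in> interior K" and l: "0 < l"
  shows "\<exists>\<eta>>0. \<forall>t. 0 < t \<longrightarrow> t < \<eta> \<longrightarrow> \<gamma> (T + t) \<in> interior K"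
proof -
  let ?q = "\<gamma> T"
  obtain r where r: "r > 0" "ball (?q + l *\<^sub>R w) r \<subseteq> K" using x unfolding mem_interior by blast
  have "\<forall>\<^sub>F h in at_right 0. dist ((\<gamma> (T + h) - ?q) /\<^sub>R h) w < r / l"
    using w r l unfolding right_tangent_def by (intro tendstoD) auto
  then obtain \<eta>0 where \<eta>0: "\<eta>0 > 0" "\<And>h. 0 < h \<Longrightarrow> h < \<eta>0 \<Longrightarrow> dist ((\<gamma> (T + h) - ?q) /\<^sub>R h) w < r / l"
    unfolding eventually_at_right_field by auto
  have "\<gamma> (T + t) \<in> interior K" if t: "0 < t" "t < min \<eta>0 l" for t
  proof -
    have sub: "ball (?q + t *\<^sub>R w) (t / l * r) \<subseteq> K"
    proof
      fix y assume y: "y \<in> ball (?q + t *\<^sub>R w) (t / l * r)"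
      define z where "z = ?q + (l / t) *\<^sub>R (y - ?q)"
      have "?q + l *\<^sub>R w - z = (l / t) *\<^sub>R (?q + t *\<^sub>R w - y)"
        using t by (simp add: z_def algebra_simps)
      then have "dist (?q + l *\<^sub>R w) z = l / t * dist (?q + t *\<^sub>R w) y" using t l by (simp add: dist_norm)
      also have "\<dots> < l / t * (t / l * r)" using y t l by (intro mult_strict_left_mono) auto
      also have "\<dots> = r" using t l by simp
      finally have "z \<in> K" using r by auto
      then have "(1 - t / l) *\<^sub>R ?q + (t / l) *\<^sub>R z \<in> K"
        using body mem t l by (intro convexD) (auto simp: convex_body_def)
      also have "(1 - t / l) *\<^sub>R ?q + (t / l) *\<^sub>R z = y"
        using t l by (simp add: z_def algebra_simps)
      finally show "y \<in> K" .
    qed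
    have "?q + t *\<^sub>R w - \<gamma> (T + t) = - t *\<^sub>R ((\<gamma> (T + t) - ?q) /\<^sub>R t - w)"
      using t by (simp add: algebra_simps)
    then have "dist (?q + t *\<^sub>R w) (\<gamma> (T + t)) = t * dist ((\<gamma> (T + t) - ?q) /\<^sub>R t) w"
      using t by (simp add: dist_norm)
    also have "\<dots> < t * (r / l)" using \<eta>0(2)[of t] t by (intro mult_strict_left_mono) auto
    finally have "\<gamma> (T + t) \<in> ball (?q + t *\<^sub>R w) (t / l * r)" by simp
    then show ?thesis using sub interior_maximal open_ball by blast
  qed
  then show ?thesis using \<eta>0 l by (intro exI[of _ "min \<eta>0 l"]) auto
qed

text \<open>
  The path is straight as long as it stays in the interior, and the line that it follows does not leave the interior before
  time \<open>l\<close>; so the supremum of the times up to which the path stays in the interior is \<open>l\<close>.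
\<close>

lemma follow_line:
  assumes w: "right_tangent \<gamma> T w" and l: "0 < l"
    and int: "\<And>t. 0 < t \<Longrightarrow> t < l \<Longrightarrow> \<gamma> T + t *\<^sub>R w \<in> interior K"
  shows "\<forall>t\<in>{0..l}. \<gamma> (T + t) = \<gamma> T + t *\<^sub>R w"
proof -
  define A where "A = {t. 0 < t \<and> t \<le> l \<and> (\<forall>s. 0 < s \<longrightarrow> s < t \<longrightarrow> \<gamma> (T + s) \<in> interior K)}"
  have line: "\<gamma> (T + t) = \<gamma> T + t *\<^sub>R w" if b: "b \<in> A" and t: "0 \<le> t" "t \<le> b" for b t
  proof -
    have b0: "0 < b" using b by (simp add: A_def)
    have "\<gamma> s \<in> interior K" if "T < s" "s < T + b" for s
    proof -
      have "\<gamma> (T + (s - T)) \<in> interior K" using b that unfolding A_def by (simp only: mem_Collect_eq)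
      then show ?thesis by simp
    qed
    then have "\<exists>e. norm e = 1 \<and> (\<forall>s\<in>{T..T + b}. \<gamma> s = \<gamma> T + (s - T) *\<^sub>R e)"
      using b0 by (intro interior_straight) auto
    then obtain e where e: "\<forall>s\<in>{T..T + b}. \<gamma> s = \<gamma> T + (s - T) *\<^sub>R e" by blast
    have "right_tangent \<gamma> T e"
      by (rule straight_right_tangent[of T "T + b"]) (use b0 e in \<open>auto simp only: less_add_same_cancel1\<close>)
    then have "e = w" using right_tangent_unique w by blast
    then show ?thesis using bspec[OF e, of "T + t"] t by simp
  qed
  have "\<gamma> T + (l / 2) *\<^sub>R w \<in> interior K" using int[of "l / 2"] l by simp
  then obtain \<eta> where \<eta>: "\<eta> > 0" "\<And>t. 0 < t \<Longrightarrow> t < \<eta> \<Longrightarrow> \<gamma> (T + t) \<in> interior K"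
    using enters_interior[OF w, of "l / 2"] l by auto
  have ne: "min \<eta> l \<in> A" using \<eta> l by (auto simp: A_def)
  have bdd: "bdd_above A" unfolding A_def by (intro bdd_aboveI[of _ l]) auto
  define b where "b = Sup A"
  have b: "0 < b" "b \<le> l"
  proof -
    have "min \<eta> l \<le> b" unfolding b_def using ne bdd by (rule cSup_upper)
    then show "0 < b" using \<eta> l by auto
    have "A \<noteq> {}" using ne by blast
    then show "b \<le> l" unfolding b_def by (rule cSup_least) (simp add: A_def)
  qed
  have bA: "b \<in> A"
  proof -
    have "\<gamma> (T + s) \<in> interior K" if "0 < s" "s < b" for s
    proof -
      have "A \<noteq> {}" using ne by blast
      then obtain b' where "b' \<in> A" "s < b'"
        using \<open>s < b\<close> less_cSup_iff[OF _ bdd, of s] unfolding b_def by blast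
      then show ?thesis using \<open>0 < s\<close> by (simp add: A_def)
    qed
    then show ?thesis using b by (simp add: A_def)
  qed
  have "b = l"
  proof (rule ccontr)
    assume "b \<noteq> l"
    then have bl: "b < l" using b by simp
    have "\<gamma> (T + b) \<in> interior K" using line[OF bA, of b] int[of b] b bl by simp
    then obtain r where r: "r > 0" "ball (\<gamma> (T + b)) r \<subseteq> interior K" using open_contains_ball[of "interior K"] by auto
    define b' where "b' = min l (b + r)"
    have b': "b < b'" using bl r by (simp add: b'_def)
    have "\<gamma> (T + s) \<in> interior K" if s: "0 < s" "s < b'" for s
    proof (cases "s < b")
      case True
      then show ?thesis using bA s by (simp add: A_def)
    next
      case False
      have "dist (\<gamma> (T + b)) (\<gamma> (T + s)) \<le> \<bar>(T + b) - (T + s)\<bar>" by (rule lipschitz)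
      then show ?thesis using False s b' by (intro subsetD[OF r(2)]) (auto simp: b'_def)
    qed
    then have "b' \<in> A" using b b' by (simp add: A_def b'_def)
    then have "b' \<le> b" unfolding b_def using bdd by (rule cSup_upper)
    with b' show False by simp
  qed
  then show ?thesis using line[OF bA] by auto
qed

end

lemma quasigeodesic_billiard_path:
  assumes K: "convex_body K" and geo: "quasigeodesic K UNIV \<gamma>"
  shows "billiard_path K \<gamma>"
proof
  have c: "quasigeodesic_compact K a b \<gamma>" if "a < b" for a b using geo that by (simp add: quasigeodesic_def)
  show "\<gamma> t \<in> K" for t
    using c[of "t - 1" "t + 1"] by (auto simp: quasigeodesic_compact_def image_subset_iff)
  show "arclength_parametrized UNIV \<gamma>"
    unfolding arclength_parametrized_def
  proof (intro ballI impI)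
    fix s t :: real assume "s \<le> t"
    have "arclength_parametrized {s - 1..t + 1} \<gamma>"
      using c[of "s - 1" "t + 1"] \<open>s \<le> t\<close> by (simp add: quasigeodesic_compact_def)
    then show "curve_length \<gamma> s t = ereal (t - s)" using \<open>s \<le> t\<close> unfolding arclength_parametrized_def by auto
  qed
  show "locally_semiconcave K \<gamma> T" for T
    using quasigeodesic_locally_semiconcave[OF K geo] .
qed (rule K)

section \<open>Tables in polar coordinates\<close>

lemma polar_coordinates:
  fixes x :: plane
  obtains t where "x = norm x *\<^sub>R dir t"
proof (cases "x = 0")
  case False
  have "(x $ 1)\<^sup>2 + (x $ 2)\<^sup>2 = (norm x)\<^sup>2"
    unfolding power2_norm_eq_inner inner_plane by (simp add: power2_eq_square)
  then have "(x $ 1 / norm x)\<^sup>2 + (x $ 2 / norm x)\<^sup>2 = 1"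
    using False by (simp only: power_divide add_divide_distrib[symmetric]) simp
  then obtain t where "x $ 1 / norm x = cos t" "x $ 2 / norm x = sin t" using sincos_total_2pi by metis
  then have "x = norm x *\<^sub>R dir t" using False by (intro plane_eqI) (auto simp: field_simps)
  then show ?thesis by (rule that)
qed (use that in simp)

lemma frame_inner:
  "(a *\<^sub>R dir t + b *\<^sub>R perp t) \<bullet> (c *\<^sub>R dir t + d *\<^sub>R perp t) = a * c + b * d"
  by (simp add: inner_add_left inner_add_right dir_inner_dir dir_inner_perp perp_inner_dir perp_inner_perp)

lemma dir_deriv: "(dir has_vector_derivative perp t) (at t)"
  and perp_deriv: "(perp has_vector_derivative - dir t) (at t)"
proof -
  have a: "dir = (\<lambda>t. cos t *\<^sub>R axis 1 1 + sin t *\<^sub>R axis 2 1)"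
    "perp = (\<lambda>t. - sin t *\<^sub>R axis 1 1 + cos t *\<^sub>R axis 2 1)"
    by (auto intro!: plane_eqI simp: axis_def)
  have c: "(cos has_vector_derivative - sin t) (at t)" "(sin has_vector_derivative cos t) (at t)"
    by (auto simp: has_real_derivative_iff_has_vector_derivative[symmetric] intro!: derivative_eq_intros)
  have sc: "((\<lambda>t. f t *\<^sub>R v) has_vector_derivative f' *\<^sub>R v) (at t)"
    if "(f has_vector_derivative f') (at t)" for f f' and v :: plane
    using bounded_linear.has_vector_derivative[OF bounded_linear_scaleR_left that] .
  have "(dir has_vector_derivative (- sin t) *\<^sub>R axis 1 1 + cos t *\<^sub>R axis 2 1) (at t)"
    unfolding a by (intro has_vector_derivative_add sc c)
  moreover have "(- sin t) *\<^sub>R axis 1 1 + cos t *\<^sub>R axis 2 1 = perp t" by (simp add: a)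
  ultimately show "(dir has_vector_derivative perp t) (at t)" by simp
  have "(perp has_vector_derivative (- cos t) *\<^sub>R axis 1 1 + (- sin t) *\<^sub>R axis 2 1) (at t)"
    unfolding a by (intro has_vector_derivative_add sc c has_vector_derivative_minus)
  moreover have "(- cos t) *\<^sub>R axis 1 1 + (- sin t) *\<^sub>R axis 2 1 = - dir t" by (simp add: a)
  ultimately show "(perp has_vector_derivative - dir t) (at t)" by simp
qed

lemma frame_deriv:
  assumes "(f has_real_derivative f') (at t)" "(g has_real_derivative g') (at t)"
  shows "((\<lambda>t. f t *\<^sub>R dir t + g t *\<^sub>R perp t) has_vector_derivative ((f' - g t) *\<^sub>R dir t + (f t + g') *\<^sub>R perp t)) (at t)"
proof -
  have "((\<lambda>t. f t *\<^sub>R dir t + g t *\<^sub>R perp t) has_vector_derivative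
      ((f t *\<^sub>R perp t + f' *\<^sub>R dir t) + (g t *\<^sub>R (- dir t) + g' *\<^sub>R perp t))) (at t)"
    by (intro has_vector_derivative_add has_vector_derivative_scaleR assms dir_deriv perp_deriv)
  then show ?thesis by (simp add: algebra_simps)
qed

lemma angle_reduce:
  obtains m :: int where "- pi \<le> x - 2 * pi * of_int m" "x - 2 * pi * of_int m < pi"
proof -
  define m where "m = \<lfloor>(x + pi) / (2 * pi)\<rfloor>"
  have "of_int m \<le> (x + pi) / (2 * pi)" "(x + pi) / (2 * pi) < of_int m + 1"
    unfolding m_def by linarith+
  then have "of_int m * (2 * pi) \<le> x + pi" "x + pi < (of_int m + 1) * (2 * pi)"
    by (simp_all add: pos_le_divide_eq pos_divide_less_eq)
  then show ?thesis by (intro that[of m]) (auto simp: algebra_simps)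
qed

lemma dir_periodic: "dir (t + 2 * pi * of_int m) = dir t" and perp_periodic: "perp (t + 2 * pi * of_int m) = perp t"
proof -
  have "cos (2 * pi * of_int m) = 1" "sin (2 * pi * of_int m) = 0" by simp_all
  then show "dir (t + 2 * pi * of_int m) = dir t" "perp (t + 2 * pi * of_int m) = perp t"
    by (auto intro!: plane_eqI simp: cos_add sin_add)
qed

text \<open>
  The squared distance of the two unit vectors is \<open>2 - 2 * cos (a - b)\<close>.
\<close>

lemma dir_eqI:
  assumes "cos (a - b) = 1"
  shows "dir a = dir b"
proof -
  have "cos (b - a) = 1" using assms by (metis cos_minus minus_diff_eq)
  then have "(dir a - dir b) \<bullet> (dir a - dir b) = 0"
    using assms by (simp add: inner_diff dir_inner_dir)
  then show ?thesis by simp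
qed

text \<open>
  The function \<open>u\<close> is the reciprocal of the polar radius of the boundary, and \<open>u + u''\<close> is positive exactly where the
  curvature is.  The numerical bounds make the table bounded, with the origin as an interior point.
\<close>

locale polar_table =
  fixes u u1 u2 u3 :: "real \<Rightarrow> real"
  assumes u_deriv: "(u has_real_derivative u1 t) (at t)"
    and u1_deriv: "(u1 has_real_derivative u2 t) (at t)"
    and u2_deriv: "(u2 has_real_derivative u3 t) (at t)"
    and u_periodic: "u (t + 2 * pi * of_int m) = u t"
    and u1_periodic: "u1 (t + 2 * pi * of_int m) = u1 t"
    and convexity: "0 < u t + u2 t"
    and u_bounds: "1 / 2 \<le> u t" "u t \<le> 2" and u1_bound: "\<bar>u1 t\<bar> \<le> 2"
begin

lemma u_pos: "0 < u t"
  using u_bounds(1)[of t] by linarith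

text \<open>
  The line on which the functional \<open>normal \<phi>\<close> equals 1 is the tangent to the boundary at the angle \<open>\<phi>\<close>.
\<close>

definition normal :: "real \<Rightarrow> plane" where
  "normal \<phi> = u \<phi> *\<^sub>R dir \<phi> + u1 \<phi> *\<^sub>R perp \<phi>"

definition boundary :: "real \<Rightarrow> plane" where
  "boundary \<phi> = (1 / u \<phi>) *\<^sub>R dir \<phi>"

definition table :: "plane set" where
  "table = {x. \<forall>\<phi>. normal \<phi> \<bullet> x \<le> 1}"

lemma normal_periodic: "normal (t + 2 * pi * of_int m) = normal t"
  and boundary_periodic: "boundary (t + 2 * pi * of_int m) = boundary t"
  by (simp_all only: normal_def boundary_def u_periodic u1_periodic dir_periodic perp_periodic)

text \<open>
  This is variation of constants for \<open>u'' + u\<close>: the function \<open>Z\<close> leads from the reciprocal radius of the tangent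
  line at the angle \<open>\<phi> + h\<close> to \<open>u (\<phi> + h)\<close>, and its derivative has the sign of \<open>h\<close>.  Angles enter only
  modulo \<open>2 * pi\<close>, so half a turn to each side suffices.
\<close>

lemma tangent_line_strict:
  assumes "cos (\<psi> - \<phi>) \<noteq> 1"
  shows "u \<phi> * cos (\<psi> - \<phi>) + u1 \<phi> * sin (\<psi> - \<phi>) < u \<psi>"
proof -
  obtain m :: int where m: "- pi \<le> (\<psi> - \<phi>) - 2 * pi * of_int m" "(\<psi> - \<phi>) - 2 * pi * of_int m < pi"
    by (rule angle_reduce)
  define h where "h = (\<psi> - \<phi>) - 2 * pi * of_int m"
  have h: "- pi \<le> h" "h < pi" using m by (auto simp: h_def)
  have e: "\<psi> - \<phi> = h + 2 * pi * of_int m" "\<psi> = (\<phi> + h) + 2 * pi * of_int m" by (auto simp: h_def)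
  have cs: "cos (\<psi> - \<phi>) = cos h" "sin (\<psi> - \<phi>) = sin h"
    unfolding e(1) by (simp_all add: cos_add sin_add)
  have u\<psi>: "u \<psi> = u (\<phi> + h)" unfolding e(2) by (rule u_periodic)
  have "h \<noteq> 0" using assms cs by auto
  define Z where "Z x = u1 (\<phi> + x) * sin (h - x) + u (\<phi> + x) * cos (h - x)" for x
  have dZ: "(Z has_real_derivative (u2 (\<phi> + x) + u (\<phi> + x)) * sin (h - x)) (at x)" for x
  proof -
    have sh: "((\<lambda>x. \<phi> + x) has_real_derivative 1) (at x)" by (auto intro!: derivative_eq_intros)
    have d1: "((\<lambda>x. u1 (\<phi> + x)) has_real_derivative u2 (\<phi> + x)) (at x)"
      using DERIV_chain2[OF u1_deriv sh] by simp
    have d0: "((\<lambda>x. u (\<phi> + x)) has_real_derivative u1 (\<phi> + x)) (at x)"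
      using DERIV_chain2[OF u_deriv sh] by simp
    have s: "((\<lambda>x. sin (h - x)) has_real_derivative - cos (h - x)) (at x)"
      by (auto intro!: derivative_eq_intros)
    have c: "((\<lambda>x. cos (h - x)) has_real_derivative sin (h - x)) (at x)"
      by (auto intro!: derivative_eq_intros)
    have "(Z has_real_derivative ((u2 (\<phi> + x) * sin (h - x) + (- cos (h - x)) * u1 (\<phi> + x))
        + (u1 (\<phi> + x) * cos (h - x) + sin (h - x) * u (\<phi> + x)))) (at x)"
      unfolding Z_def by (intro DERIV_add DERIV_mult d1 d0 s c)
    then show ?thesis by (simp add: algebra_simps)
  qed
  have "Z 0 < Z h"
  proof (cases "0 < h")
    case True
    obtain z where z: "0 < z" "z < h" "Z h - Z 0 = (h - 0) * ((u2 (\<phi> + z) + u (\<phi> + z)) * sin (h - z))"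
      using MVT2[OF True, of Z "\<lambda>z. (u2 (\<phi> + z) + u (\<phi> + z)) * sin (h - z)"] dZ by blast
    have "0 < sin (h - z)" using z h by (intro sin_gt_zero) auto
    then have "0 < (h - 0) * ((u2 (\<phi> + z) + u (\<phi> + z)) * sin (h - z))"
      using convexity[of "\<phi> + z"] True by (intro mult_pos_pos) auto
    then show ?thesis using z by linarith
  next
    case False
    then have "h < 0" using \<open>h \<noteq> 0\<close> by simp
    obtain z where z: "h < z" "z < 0" "Z 0 - Z h = (0 - h) * ((u2 (\<phi> + z) + u (\<phi> + z)) * sin (h - z))"
      using MVT2[OF \<open>h < 0\<close>, of Z "\<lambda>z. (u2 (\<phi> + z) + u (\<phi> + z)) * sin (h - z)"] dZ by blast
    have "0 < sin (z - h)" using z h by (intro sin_gt_zero) auto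
    then have "sin (h - z) < 0" by (metis minus_diff_eq neg_less_0_iff_less sin_minus)
    then have "(0 - h) * ((u2 (\<phi> + z) + u (\<phi> + z)) * sin (h - z)) < 0"
      using convexity[of "\<phi> + z"] \<open>h < 0\<close> by (intro mult_pos_neg) auto
    then show ?thesis using z by linarith
  qed
  then show ?thesis unfolding cs u\<psi> by (simp add: Z_def algebra_simps)
qed

lemma normal_inner_dir: "normal \<phi> \<bullet> dir \<psi> = u \<phi> * cos (\<psi> - \<phi>) + u1 \<phi> * sin (\<psi> - \<phi>)"
proof -
  have "cos (\<phi> - \<psi>) = cos (\<psi> - \<phi>)" by (metis cos_minus minus_diff_eq)
  then show ?thesis by (simp add: normal_def inner_add_left dir_inner_dir perp_inner_dir)
qed

lemma normal_inner_dir_same: "dir \<psi> = dir \<phi> \<Longrightarrow> normal \<phi> \<bullet> dir \<psi> = u \<phi>"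
  by (simp add: normal_def inner_add_left dir_inner_dir perp_inner_dir)

lemma same_direction: "cos (\<psi> - \<phi>) = 1 \<Longrightarrow> u \<psi> = u \<phi>"
proof -
  assume "cos (\<psi> - \<phi>) = 1"
  then obtain m :: int where "\<psi> - \<phi> = of_int m * 2 * pi" unfolding cos_one_2pi_int by blast
  then have "\<psi> = \<phi> + 2 * pi * of_int m" by (simp add: algebra_simps)
  then show ?thesis using u_periodic by metis
qed

lemma normal_inner_dir_le: "normal \<phi> \<bullet> dir \<psi> \<le> u \<psi>"
proof (cases "cos (\<psi> - \<phi>) = 1")
  case True
  then show ?thesis using normal_inner_dir_same[of \<psi> \<phi>] dir_eqI same_direction by simp
next
  case False
  then show ?thesis using tangent_line_strict[OF False] by (simp add: normal_inner_dir)
qed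

lemma normal_inner_boundary_le: "normal \<phi> \<bullet> boundary \<psi> \<le> 1"
  using normal_inner_dir_le[of \<phi> \<psi>] u_pos[of \<psi>] by (simp add: boundary_def)

lemma normal_inner_boundary: "normal \<phi> \<bullet> boundary \<phi> = 1"
  using u_pos[of \<phi>] by (simp add: boundary_def normal_inner_dir_same)

lemma normal_inner_boundary_eq_1:
  assumes "normal \<phi> \<bullet> boundary \<psi> = 1"
  shows "boundary \<psi> = boundary \<phi>"
proof (cases "cos (\<psi> - \<phi>) = 1")
  case True
  then show ?thesis using dir_eqI[OF True] same_direction[OF True] by (simp add: boundary_def)
next
  case False
  have "normal \<phi> \<bullet> dir \<psi> = u \<psi>" using assms u_pos[of \<psi>] by (simp add: boundary_def)
  then show ?thesis using tangent_line_strict[OF False] by (simp add: normal_inner_dir)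
qed

lemma boundary_in_table: "boundary \<phi> \<in> table"
  by (simp add: table_def normal_inner_boundary_le)

lemma norm_normal_le: "norm (normal \<phi>) \<le> 4"
proof -
  have "norm (normal \<phi>) \<le> norm (u \<phi> *\<^sub>R dir \<phi>) + norm (u1 \<phi> *\<^sub>R perp \<phi>)"
    unfolding normal_def by (rule norm_triangle_ineq)
  then show ?thesis using u_bounds[of \<phi>] u1_bound[of \<phi>] by simp
qed

lemma normal_nonzero: "normal \<phi> \<noteq> 0"
  using normal_inner_boundary[of \<phi>] by (metis inner_zero_left zero_neq_one)

lemma continuous_normal: "continuous_on S normal"
proof -
  have c: "continuous_on S u" "continuous_on S u1"
    by (intro continuous_at_imp_continuous_on ballI DERIV_isCont[OF u_deriv],
        intro continuous_at_imp_continuous_on ballI DERIV_isCont[OF u1_deriv])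
  have d: "continuous_on S dir" "continuous_on S perp"
    by (intro continuous_at_imp_continuous_on ballI has_vector_derivative_continuous[OF dir_deriv],
        intro continuous_at_imp_continuous_on ballI has_vector_derivative_continuous[OF perp_deriv])
  show ?thesis unfolding normal_def[abs_def] by (intro continuous_intros c d)
qed

text \<open>
  By compactness of a period of angles the values of the functionals at \<open>x\<close> have a maximum, which is less than 1.  As the
  norms of the functionals are bounded, their values stay below 1 near \<open>x\<close>.
\<close>

lemma strict_interior:
  assumes "\<And>\<phi>. normal \<phi> \<bullet> x < 1"
  shows "x \<in> interior table"
proof -
  have "continuous_on {- pi..pi} (\<lambda>\<phi>. normal \<phi> \<bullet> x)" by (intro continuous_intros continuous_normal)
  moreover have "{- pi..pi} \<noteq> {}" using pi_gt_zero by simp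
  ultimately obtain \<phi>0 where \<phi>0: "\<forall>\<phi>\<in>{- pi..pi}. normal \<phi> \<bullet> x \<le> normal \<phi>0 \<bullet> x"
    using continuous_attains_sup[OF compact_Icc] by blast
  define M where "M = normal \<phi>0 \<bullet> x"
  have "M < 1" using assms by (simp add: M_def)
  have le: "normal \<phi> \<bullet> x \<le> M" for \<phi>
  proof -
    obtain m :: int where m: "- pi \<le> \<phi> - 2 * pi * of_int m" "\<phi> - 2 * pi * of_int m < pi" by (rule angle_reduce)
    have "normal \<phi> = normal ((\<phi> - 2 * pi * of_int m) + 2 * pi * of_int m)" by simp
    also have "\<dots> = normal (\<phi> - 2 * pi * of_int m)" by (rule normal_periodic)
    finally show ?thesis using bspec[OF \<phi>0, of "\<phi> - 2 * pi * of_int m"] m by (simp add: M_def)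
  qed
  have "ball x ((1 - M) / 4) \<subseteq> table"
  proof
    fix y assume y: "y \<in> ball x ((1 - M) / 4)"
    have "normal \<phi> \<bullet> y \<le> 1" for \<phi>
    proof -
      have "normal \<phi> \<bullet> (y - x) \<le> norm (normal \<phi>) * norm (y - x)" by (rule norm_cauchy_schwarz)
      also have "\<dots> \<le> 4 * ((1 - M) / 4)"
        using y norm_normal_le[of \<phi>] by (intro mult_mono) (auto simp: dist_norm norm_minus_commute)
      finally show ?thesis using le[of \<phi>] by (simp add: inner_diff_right)
    qed
    then show "y \<in> table" by (simp add: table_def)
  qed
  then show ?thesis using \<open>M < 1\<close> by (intro interiorI[of "ball x ((1 - M) / 4)"]) auto
qed

lemma interior_strict:
  assumes "x \<in> interior table"
  shows "normal \<phi> \<bullet> x < 1"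
proof -
  obtain r where r: "r > 0" "cball x r \<subseteq> table" using assms unfolding mem_interior_cball by blast
  define n where "n = norm (normal \<phi>)"
  have n: "n > 0" using normal_nonzero by (simp add: n_def)
  have "x + (r / n) *\<^sub>R normal \<phi> \<in> cball x r" using n r by (simp add: dist_norm n_def)
  then have "normal \<phi> \<bullet> (x + (r / n) *\<^sub>R normal \<phi>) \<le> 1" using r by (auto simp: table_def)
  then have "normal \<phi> \<bullet> x + (r / n) * n\<^sup>2 \<le> 1" by (simp add: inner_add_right dot_square_norm n_def)
  moreover have "0 < (r / n) * n\<^sup>2" using n r by simp
  ultimately show ?thesis by linarith
qed

lemma table_closed: "closed table" and table_convex: "convex table"
proof -
  have t: "table = (\<Inter>\<phi>. {x. normal \<phi> \<bullet> x \<le> 1})" by (auto simp: table_def)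
  show "closed table" unfolding t by (intro closed_INT ballI closed_halfspace_le)
  show "convex table" unfolding t by (intro convex_INT ballI convex_halfspace_le)
qed

lemma table_norm_le:
  assumes "x = r *\<^sub>R dir \<psi>" "x \<in> table"
  shows "r * u \<psi> \<le> 1"
proof -
  have "normal \<psi> \<bullet> x \<le> 1" using assms by (simp add: table_def)
  then show ?thesis using assms(1) by (simp add: normal_inner_dir_same)
qed

lemma table_convex_body: "convex_body table"
proof -
  have "norm x \<le> 2" if x: "x \<in> table" for x
  proof -
    obtain t where "x = norm x *\<^sub>R dir t" by (rule polar_coordinates)
    then have "norm x * u t \<le> 1" using table_norm_le x by blast
    moreover have "norm x * (1 / 2) \<le> norm x * u t" using u_bounds(1) by (intro mult_left_mono) auto
    ultimately show ?thesis by linarith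
  qed
  then have "bounded table" by (auto simp: bounded_iff)
  moreover have "0 \<in> interior table" by (rule strict_interior) simp
  ultimately show ?thesis
    using table_closed table_convex by (auto simp: convex_body_def compact_eq_bounded_closed)
qed

lemma frontier_table: "frontier table = boundary ` {0..<2 * pi}"
proof (intro equalityI subsetI)
  fix x assume "x \<in> frontier table"
  then have x: "x \<in> table" "x \<notin> interior table"
    using table_closed by (auto simp: frontier_def)
  then obtain \<phi> where "\<not> normal \<phi> \<bullet> x < 1" using strict_interior by blast
  then have \<phi>: "normal \<phi> \<bullet> x = 1" using x(1) by (simp add: table_def) (meson antisym_conv1)
  obtain \<psi> where \<psi>: "x = norm x *\<^sub>R dir \<psi>" by (rule polar_coordinates)
  define r where "r = norm x"
  have "x \<noteq> 0" using \<phi> by auto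
  then have r: "r > 0" by (simp add: r_def)
  have x\<psi>: "x = r *\<^sub>R dir \<psi>" using \<psi> by (simp add: r_def)
  have "1 = r * (normal \<phi> \<bullet> dir \<psi>)" using \<phi> x\<psi> by simp
  also have "\<dots> \<le> r * u \<psi>" using r normal_inner_dir_le by (intro mult_left_mono) auto
  finally have "r * u \<psi> = 1" using table_norm_le[OF x\<psi> x(1)] by simp
  then have "r = 1 / u \<psi>" using u_pos[of \<psi>] by (simp add: field_simps)
  then have xb: "x = boundary \<psi>" using x\<psi> by (simp add: boundary_def)
  obtain m :: int where m: "- pi \<le> (\<psi> - pi) - 2 * pi * of_int m" "(\<psi> - pi) - 2 * pi * of_int m < pi"
    by (rule angle_reduce)
  have "boundary \<psi> = boundary ((\<psi> - 2 * pi * of_int m) + 2 * pi * of_int m)" by simp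
  also have "\<dots> = boundary (\<psi> - 2 * pi * of_int m)" by (rule boundary_periodic)
  finally show "x \<in> boundary ` {0..<2 * pi}" using m xb by (intro image_eqI) auto
next
  fix x assume "x \<in> boundary ` {0..<2 * pi}"
  then obtain \<phi> where \<phi>: "x = boundary \<phi>" by blast
  have "x \<notin> interior table" using interior_strict[of x \<phi>] normal_inner_boundary \<phi> by auto
  then show "x \<in> frontier table"
    using boundary_in_table \<phi> closure_subset by (auto simp: frontier_def)
qed

text \<open>
  Each tangent line touches the boundary in one point, so on a chord no tangent functional reaches 1 between the end points.
\<close>

lemma chord_interior:
  assumes ne: "boundary a \<noteq> boundary b" and l: "0 < l" "l < 1"
  shows "(1 - l) *\<^sub>R boundary a + l *\<^sub>R boundary b \<in> interior table"
proof (rule strict_interior)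
  fix \<phi>
  have le: "normal \<phi> \<bullet> boundary a \<le> 1" "normal \<phi> \<bullet> boundary b \<le> 1"
    by (rule normal_inner_boundary_le)+
  have "normal \<phi> \<bullet> boundary a < 1 \<or> normal \<phi> \<bullet> boundary b < 1"
    using le normal_inner_boundary_eq_1[of \<phi> a] normal_inner_boundary_eq_1[of \<phi> b] ne by fastforce
  then have "(1 - l) * (normal \<phi> \<bullet> boundary a) + l * (normal \<phi> \<bullet> boundary b) < (1 - l) * 1 + l * 1"
  proof
    assume "normal \<phi> \<bullet> boundary a < 1"
    then show ?thesis using le l by (intro add_less_le_mono mult_strict_left_mono mult_left_mono) auto
  next
    assume "normal \<phi> \<bullet> boundary b < 1"
    then show ?thesis using le l by (intro add_le_less_mono mult_strict_left_mono mult_left_mono) auto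
  qed
  then show "normal \<phi> \<bullet> ((1 - l) *\<^sub>R boundary a + l *\<^sub>R boundary b) < 1"
    by (simp add: inner_add_right)
qed

text \<open>
  The functions \<open>r1\<close>, \<open>r2\<close> and \<open>r3\<close> are the derivatives of the polar radius \<open>1 / u\<close>.
\<close>

definition r1 :: "real \<Rightarrow> real" where "r1 t = - (u1 t / (u t)\<^sup>2)"
definition r2 :: "real \<Rightarrow> real" where "r2 t = 2 * (u1 t)\<^sup>2 / u t ^ 3 - u2 t / (u t)\<^sup>2"
definition r3 :: "real \<Rightarrow> real" where
  "r3 t = 6 * u1 t * u2 t / u t ^ 3 - 6 * u1 t ^ 3 / u t ^ 4 - u3 t / (u t)\<^sup>2"

lemma r_deriv: "((\<lambda>t. 1 / u t) has_real_derivative r1 t) (at t)"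
  and r1_deriv: "(r1 has_real_derivative r2 t) (at t)"
  and r2_deriv: "(r2 has_real_derivative r3 t) (at t)"
proof -
  have n: "u t \<noteq> 0" using u_pos[of t] by simp
  show "((\<lambda>t. 1 / u t) has_real_derivative r1 t) (at t)"
    using n by (auto intro!: derivative_eq_intros u_deriv simp: r1_def power2_eq_square)
  have "((\<lambda>t. - (u1 t / (u t)\<^sup>2)) has_real_derivative r2 t) (at t)"
    using n by (auto intro!: derivative_eq_intros u_deriv u1_deriv
      simp: r2_def divide_simps) (auto simp: eval_nat_numeral algebra_simps)
  then show "(r1 has_real_derivative r2 t) (at t)" by (simp add: r1_def[abs_def])
  have d1: "((\<lambda>t. 2 * (u1 t)\<^sup>2) has_real_derivative 4 * u1 t * u2 t) (at t)"
    by (auto intro!: derivative_eq_intros u1_deriv)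
  have d2: "((\<lambda>t. u t ^ 3) has_real_derivative 3 * (u t)\<^sup>2 * u1 t) (at t)"
    by (auto intro!: derivative_eq_intros u_deriv)
  have d3: "((\<lambda>t. (u t)\<^sup>2) has_real_derivative 2 * u t * u1 t) (at t)"
    by (auto intro!: derivative_eq_intros u_deriv)
  have n': "u t ^ 3 \<noteq> 0" "(u t)\<^sup>2 \<noteq> 0" using n by simp_all
  have "((\<lambda>t. 2 * (u1 t)\<^sup>2 / u t ^ 3 - u2 t / (u t)\<^sup>2) has_real_derivative
      (4 * u1 t * u2 t * u t ^ 3 - 2 * (u1 t)\<^sup>2 * (3 * (u t)\<^sup>2 * u1 t)) / (u t ^ 3 * u t ^ 3)
      - (u3 t * (u t)\<^sup>2 - u2 t * (2 * u t * u1 t)) / ((u t)\<^sup>2 * (u t)\<^sup>2)) (at t)"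
    by (rule DERIV_diff[OF DERIV_divide[OF d1 d2 n'(1)] DERIV_divide[OF u2_deriv d3 n'(2)]])
  also have "(4 * u1 t * u2 t * u t ^ 3 - 2 * (u1 t)\<^sup>2 * (3 * (u t)\<^sup>2 * u1 t)) / (u t ^ 3 * u t ^ 3)
      - (u3 t * (u t)\<^sup>2 - u2 t * (2 * u t * u1 t)) / ((u t)\<^sup>2 * (u t)\<^sup>2) = r3 t"
    using n by (simp add: r3_def divide_simps) (simp add: eval_nat_numeral algebra_simps)
  finally have "((\<lambda>t. 2 * (u1 t)\<^sup>2 / u t ^ 3 - u2 t / (u t)\<^sup>2) has_real_derivative r3 t) (at t)" .
  then show "(r2 has_real_derivative r3 t) (at t)" by (simp add: r2_def[abs_def])
qed

definition boundary_velocity :: "real \<Rightarrow> plane" where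
  "boundary_velocity t = r1 t *\<^sub>R dir t + (1 / u t) *\<^sub>R perp t"

lemma boundary_deriv: "(boundary has_vector_derivative boundary_velocity t) (at t)"
proof -
  have "((\<lambda>t. (1 / u t) *\<^sub>R dir t + 0 *\<^sub>R perp t) has_vector_derivative ((r1 t - 0) *\<^sub>R dir t + (1 / u t + 0) *\<^sub>R perp t)) (at t)"
    by (intro frame_deriv r_deriv DERIV_const)
  then show ?thesis by (simp add: boundary_def[abs_def] boundary_velocity_def)
qed

lemma normal_inner_velocity: "normal t \<bullet> boundary_velocity t = 0"
  unfolding normal_def boundary_velocity_def frame_inner
  using u_pos[of t] by (simp add: r1_def power2_eq_square)

lemma table_boundary_smooth: "D3_positively_curved_boundary table"
proof -
  define b2 where "b2 t = (r2 t - 1 / u t) *\<^sub>R dir t + (2 * r1 t) *\<^sub>R perp t" for t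
  define b3 where "b3 t = ((r3 t - r1 t) - 2 * r1 t) *\<^sub>R dir t + ((r2 t - 1 / u t) + 2 * r2 t) *\<^sub>R perp t" for t
  have d1: "(boundary_velocity has_vector_derivative b2 t) (at t)" for t
  proof -
    have "((\<lambda>t. r1 t *\<^sub>R dir t + (1 / u t) *\<^sub>R perp t) has_vector_derivative
        ((r2 t - 1 / u t) *\<^sub>R dir t + (r1 t + r1 t) *\<^sub>R perp t)) (at t)"
      by (intro frame_deriv r_deriv r1_deriv)
    then show ?thesis by (simp add: b2_def boundary_velocity_def[abs_def])
  qed
  have d2: "(b2 has_vector_derivative b3 t) (at t)" for t
  proof -
    have "((\<lambda>t. (r2 t - 1 / u t) *\<^sub>R dir t + (2 * r1 t) *\<^sub>R perp t) has_vector_derivative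
        (((r3 t - r1 t) - 2 * r1 t) *\<^sub>R dir t + ((r2 t - 1 / u t) + 2 * r2 t) *\<^sub>R perp t)) (at t)"
      by (intro frame_deriv DERIV_diff DERIV_cmult r_deriv r1_deriv r2_deriv)
    then show ?thesis by (simp add: b2_def[abs_def] b3_def)
  qed
  have ne: "boundary_velocity t \<noteq> 0" for t
  proof
    assume "boundary_velocity t = 0"
    then have "boundary_velocity t \<bullet> perp t = 0" by simp
    then show False using u_pos[of t]
      by (simp add: boundary_velocity_def inner_add_left dir_inner_perp perp_inner_perp)
  qed
  have cross: "(a *\<^sub>R dir t + b *\<^sub>R perp t) $ 1 * (c *\<^sub>R dir t + d *\<^sub>R perp t) $ 2
      - (a *\<^sub>R dir t + b *\<^sub>R perp t) $ 2 * (c *\<^sub>R dir t + d *\<^sub>R perp t) $ 1 = a * d - b * c" for a b c d t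
  proof -
    have s: "sin t * sin t = 1 - cos t * cos t" using sin_squared_eq[of t] by (simp add: power2_eq_square)
    show ?thesis by (simp add: algebra_simps s)
  qed
  have curv: "0 < curvature (boundary_velocity t) (b2 t)" for t
  proof -
    have "r1 t * (2 * r1 t) - (1 / u t) * (r2 t - 1 / u t) = (u t + u2 t) / u t ^ 3"
      using u_pos[of t] by (simp add: r1_def r2_def divide_simps) (simp add: eval_nat_numeral algebra_simps)
    then have "0 < r1 t * (2 * r1 t) - (1 / u t) * (r2 t - 1 / u t)"
      using u_pos[of t] convexity[of t] by simp
    then show ?thesis
      unfolding curvature_def boundary_velocity_def b2_def cross using ne[of t]
      by (simp add: boundary_velocity_def)
  qed
  have inj: "inj_on boundary {0..<2 * pi}"
  proof (rule inj_onI)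
    fix a b assume ab: "a \<in> {0..<2 * pi}" "b \<in> {0..<2 * pi}" "boundary a = boundary b"
    show "a = b"
      by (rule dir_same_angle[of "1 / u a" a "1 / u b" b]) (use ab u_pos[of a] u_pos[of b] in \<open>auto simp: boundary_def\<close>)
  qed
  have per: "boundary (t + 2 * pi) = boundary t" for t
    using boundary_periodic[of t 1] by simp
  show ?thesis
    unfolding D3_positively_curved_boundary_def
    by (rule exI[of _ "2 * pi"], rule exI[of _ boundary], rule exI[of _ boundary_velocity],
        rule exI[of _ b2], rule exI[of _ b3])
      (use per inj frontier_table boundary_deriv d1 d2 ne curv in simp)
qed

end

section \<open>Reflection at the boundary\<close>

lemma chord_eq: "dir b - dir a = (2 * sin ((b - a) / 2)) *\<^sub>R perp ((a + b) / 2)"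
proof -
  have "sin ((a - b) / 2) = - sin ((b - a) / 2)" by (metis minus_diff_eq minus_divide_left sin_minus)
  then show ?thesis by (intro plane_eqI) (simp_all add: cos_diff_cos sin_diff_sin add.commute)
qed

lemma orthogonal_plane_parallel:
  fixes x n v :: plane
  assumes "x \<bullet> v = 0" "n \<bullet> v = 0" "v \<noteq> 0" "n \<noteq> 0"
  shows "\<exists>d. x = d *\<^sub>R n"
proof -
  have 1: "x $ 1 * v $ 1 + x $ 2 * v $ 2 = 0" "n $ 1 * v $ 1 + n $ 2 * v $ 2 = 0"
    using assms by (simp_all add: inner_plane)
  have "v $ 1 * (x $ 1 * n $ 2 - x $ 2 * n $ 1) = 0" "v $ 2 * (x $ 1 * n $ 2 - x $ 2 * n $ 1) = 0"
    using 1 by algebra+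
  moreover have "v $ 1 \<noteq> 0 \<or> v $ 2 \<noteq> 0" using assms(3) plane_eqI[of v 0] by auto
  ultimately have c: "x $ 1 * n $ 2 = x $ 2 * n $ 1" by auto
  have nn: "n \<bullet> n \<noteq> 0" using assms(4) by simp
  have "(n \<bullet> n) *\<^sub>R x = (x \<bullet> n) *\<^sub>R n"
  proof (rule plane_eqI)
    show "((n \<bullet> n) *\<^sub>R x) $ 1 = ((x \<bullet> n) *\<^sub>R n) $ 1" using c by (simp add: inner_plane) algebra
    show "((n \<bullet> n) *\<^sub>R x) $ 2 = ((x \<bullet> n) *\<^sub>R n) $ 2" using c by (simp add: inner_plane) algebra
  qed
  then have "(1 / (n \<bullet> n)) *\<^sub>R ((n \<bullet> n) *\<^sub>R x) = (1 / (n \<bullet> n)) *\<^sub>R ((x \<bullet> n) *\<^sub>R n)" by simp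
  then have "x = ((x \<bullet> n) / (n \<bullet> n)) *\<^sub>R n" using nn by simp
  then show ?thesis by blast
qed

locale table_path = polar_table u u1 u2 u3 + billiard_path table \<gamma>
  for u u1 u2 u3 :: "real \<Rightarrow> real" and \<gamma> :: "real \<Rightarrow> plane"
begin

text \<open>
  The linear function \<open>(w - e) \<bullet> x\<close> is minimal on the table at the bounce point, so its derivative along the boundary
  vanishes there.
\<close>

lemma bounce_tangential:
  assumes "\<gamma> T = boundary \<phi>" "left_tangent \<gamma> T e" "right_tangent \<gamma> T w"
  shows "(w - e) \<bullet> boundary_velocity \<phi> = 0"
proof (rule DERIV_local_min)
  have "((\<lambda>\<psi>. (w - e) \<bullet> boundary \<psi>) has_vector_derivative ((w - e) \<bullet> boundary_velocity \<phi> + 0 \<bullet> boundary \<phi>)) (at \<phi>)"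
    by (rule bounded_bilinear.has_vector_derivative[OF bounded_bilinear_inner has_vector_derivative_const boundary_deriv])
  then show "((\<lambda>\<psi>. (w - e) \<bullet> boundary \<psi>) has_real_derivative (w - e) \<bullet> boundary_velocity \<phi>) (at \<phi>)"
    by (simp add: has_real_derivative_iff_has_vector_derivative)
  show "0 < (1::real)" by simp
  show "\<forall>\<psi>. \<bar>\<phi> - \<psi>\<bar> < 1 \<longrightarrow> (w - e) \<bullet> boundary \<phi> \<le> (w - e) \<bullet> boundary \<psi>"
    using corner[OF assms(2,3) boundary_in_table] assms(1) by (simp add: inner_diff_right)
qed

lemma right_tangent_inward:
  assumes "\<gamma> T = boundary \<phi>" "right_tangent \<gamma> T w"
  shows "normal \<phi> \<bullet> w \<le> 0"
proof (rule tendsto_upperbound)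
  show "((\<lambda>h. normal \<phi> \<bullet> ((\<gamma> (T + h) - \<gamma> T) /\<^sub>R h)) \<longlongrightarrow> normal \<phi> \<bullet> w) (at_right 0)"
    using assms(2) unfolding right_tangent_def by (intro tendsto_intros)
  have "normal \<phi> \<bullet> ((\<gamma> (T + h) - \<gamma> T) /\<^sub>R h) \<le> 0" if "h > 0" for h
  proof -
    have "normal \<phi> \<bullet> \<gamma> (T + h) \<le> 1" using mem[of "T + h"] by (simp add: table_def)
    then have "normal \<phi> \<bullet> (\<gamma> (T + h) - \<gamma> T) \<le> 0" using assms(1) normal_inner_boundary by (simp add: inner_diff_right)
    then show ?thesis using that by (simp add: mult_le_0_iff)
  qed
  then show "\<forall>\<^sub>F h in at_right 0. normal \<phi> \<bullet> ((\<gamma> (T + h) - \<gamma> T) /\<^sub>R h) \<le> 0"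
    by (intro eventually_mono[OF eventually_at_right_less]) auto
qed simp

lemma velocity_nonzero: "boundary_velocity t \<noteq> 0"
proof
  assume "boundary_velocity t = 0"
  then have "(0 *\<^sub>R dir t + 1 *\<^sub>R perp t) \<bullet> boundary_velocity t = 0" by simp
  then show False using u_pos[of t] unfolding boundary_velocity_def frame_inner by simp
qed

text \<open>
  The velocity after the bounce has unit length, the same tangential component as before and does not point outwards.
  These conditions hold for \<open>e'\<close>; the only other unit vector with this tangential component points outwards.
\<close>

lemma bounce:
  assumes T: "\<gamma> T = boundary \<phi>" and e: "left_tangent \<gamma> T e"
    and e': "norm e' = 1" "(e' - e) \<bullet> boundary_velocity \<phi> = 0" "normal \<phi> \<bullet> e' < 0"
  shows "right_tangent \<gamma> T e'"
proof -
  obtain w where w: "right_tangent \<gamma> T w" "norm w = 1" using ex_right_tangent by blast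
  let ?n = "normal \<phi>"
  have "(w - e) \<bullet> boundary_velocity \<phi> = 0" using bounce_tangential T e w by blast
  then have "(w - e') \<bullet> boundary_velocity \<phi> = 0" using e'(2) by (simp add: inner_diff_left)
  then obtain d where "w - e' = d *\<^sub>R ?n"
    using orthogonal_plane_parallel[of "w - e'" "boundary_velocity \<phi>" ?n] normal_inner_velocity velocity_nonzero normal_nonzero
    by blast
  then have wd: "w = e' + d *\<^sub>R ?n" by (simp add: algebra_simps)
  have "w \<bullet> w = 1" "e' \<bullet> e' = 1" using w(2) e'(1) by (simp_all add: norm_eq_1)
  then have q: "d * (2 * (?n \<bullet> e') + d * (?n \<bullet> ?n)) = 0"
    unfolding wd by (simp add: inner_add_left inner_add_right inner_commute algebra_simps)
  have "d = 0"
  proof (rule ccontr)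
    assume "d \<noteq> 0"
    then have "d * (?n \<bullet> ?n) = - 2 * (?n \<bullet> e')" using q by simp
    moreover have "?n \<bullet> w = ?n \<bullet> e' + d * (?n \<bullet> ?n)" by (simp add: wd inner_add_right)
    ultimately have "?n \<bullet> w > 0" using e'(3) by simp
    then show False using right_tangent_inward[OF T w(1)] by simp
  qed
  then show ?thesis using wd w by simp
qed

end

section \<open>Infinitely many bounces in finite time\<close>

text \<open>
  The orbit bounces at the points of the unit circle with the angles \<open>\<alpha> n\<close>.  The chord between consecutive points has the
  direction \<open>perp ((\<alpha> n + \<alpha> (Suc n)) / 2)\<close>.  By the reflection law the normal at the angle \<open>\<alpha> (Suc n)\<close> must have the mean
  angle of two consecutive chord directions, up to a quarter turn, which differs from \<open>\<alpha> (Suc n)\<close> by a quarter of the second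
  difference of the angles; the slope of \<open>u\<close> produces this tilt.  The path starts in the middle of the first chord.
\<close>

locale bouncing_path = table_path u u1 u2 u3 \<gamma>
  for u u1 u2 u3 :: "real \<Rightarrow> real" and \<gamma> :: "real \<Rightarrow> plane" +
  fixes \<alpha> :: "nat \<Rightarrow> real"
  assumes inc: "\<alpha> n < \<alpha> (Suc n)" and neg: "\<alpha> n < 0" and low: "- 1 \<le> \<alpha> n" and lim: "\<alpha> \<longlonglongrightarrow> 0"
    and on_circle: "u (\<alpha> n) = 1" "u 0 = 1" "u1 0 = 0"
    and slope: "u1 (\<alpha> (Suc n)) = tan ((\<alpha> n - 2 * \<alpha> (Suc n) + \<alpha> (Suc (Suc n))) / 4)"
    and start: "\<gamma> 0 = (1 / 2) *\<^sub>R (dir (\<alpha> 0) + dir (\<alpha> 1))" "right_tangent \<gamma> 0 (perp ((\<alpha> 0 + \<alpha> 1) / 2))"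
begin

definition mid :: "nat \<Rightarrow> real" where "mid n = (\<alpha> n + \<alpha> (Suc n)) / 2"
definition chord :: "nat \<Rightarrow> real" where "chord n = 2 * sin ((\<alpha> (Suc n) - \<alpha> n) / 2)"
definition hit :: "nat \<Rightarrow> real" where "hit n = chord 0 / 2 + (\<Sum>i<n. chord (Suc i))"

lemma hit_Suc: "hit (Suc n) = hit n + chord (Suc n)"
  by (simp add: hit_def)

lemma gap: "0 < \<alpha> (Suc n) - \<alpha> n" "\<alpha> (Suc n) - \<alpha> n \<le> 1"
  using inc[of n] neg[of "Suc n"] low[of n] by auto

lemma chord_pos: "0 < chord n" and chord_le: "chord n \<le> \<alpha> (Suc n) - \<alpha> n"
proof -
  have "(\<alpha> (Suc n) - \<alpha> n) / 2 \<le> 1 / 2" using gap(2)[of n] by simp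
  also have "1 / 2 < pi" using pi_gt3 by simp
  finally have "(\<alpha> (Suc n) - \<alpha> n) / 2 < pi" .
  then show "0 < chord n" using gap(1)[of n] by (auto simp: chord_def intro!: sin_gt_zero)
  show "chord n \<le> \<alpha> (Suc n) - \<alpha> n"
    using sin_x_le_x[of "(\<alpha> (Suc n) - \<alpha> n) / 2"] gap(1)[of n] by (simp add: chord_def)
qed

lemma boundary_point: "boundary (\<alpha> n) = dir (\<alpha> n)"
  by (simp add: boundary_def on_circle)

lemma chord_vector: "dir (\<alpha> (Suc n)) = dir (\<alpha> n) + chord n *\<^sub>R perp (mid n)"
  using chord_eq[of "\<alpha> (Suc n)" "\<alpha> n"] by (simp add: chord_def mid_def algebra_simps)

lemma chord_point_interior:
  assumes "0 < t" "t < chord n"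
  shows "dir (\<alpha> n) + t *\<^sub>R perp (mid n) \<in> interior table"
proof -
  have "boundary (\<alpha> n) \<noteq> boundary (\<alpha> (Suc n))"
    using chord_pos[of n] chord_vector[of n] norm_perp[of "mid n"]
    by (auto simp: boundary_point simp del: norm_perp)
  then have "(1 - t / chord n) *\<^sub>R boundary (\<alpha> n) + (t / chord n) *\<^sub>R boundary (\<alpha> (Suc n)) \<in> interior table"
    using assms chord_pos[of n] by (intro chord_interior) auto
  also have "(1 - t / chord n) *\<^sub>R boundary (\<alpha> n) + (t / chord n) *\<^sub>R boundary (\<alpha> (Suc n)) = dir (\<alpha> n) + t *\<^sub>R perp (mid n)"
    using chord_pos[of n] by (simp add: boundary_point chord_vector algebra_simps)
  finally show ?thesis .
qed

text \<open>
  The normal has the direction \<open>dir \<nu>\<close>, where \<open>\<nu>\<close> is the mean of \<open>mid n\<close> and \<open>mid (Suc n)\<close>; the two chords are mirror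
  images of each other.
\<close>

lemma reflection:
  assumes T: "\<gamma> T = dir (\<alpha> (Suc n))" and left: "left_tangent \<gamma> T (perp (mid n))"
  shows "right_tangent \<gamma> T (perp (mid (Suc n)))"
proof (rule bounce)
  let ?k = "Suc n"
  define \<delta> where "\<delta> = (\<alpha> n - 2 * \<alpha> ?k + \<alpha> (Suc ?k)) / 4"
  define \<nu> where "\<nu> = \<alpha> ?k + \<delta>"
  have \<nu>: "\<nu> - mid n = (mid ?k - mid n) / 2" "mid ?k - \<nu> = (mid ?k - mid n) / 2"
    by (simp_all add: \<nu>_def \<delta>_def mid_def field_simps)
  have mids: "0 < mid ?k - mid n" "mid ?k - mid n \<le> 1"
    using gap[of n] gap[of ?k] by (simp_all add: mid_def field_simps)
  have "\<bar>\<delta>\<bar> \<le> 1" using gap[of n] gap[of ?k] by (simp add: \<delta>_def abs_le_iff)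
  then have c: "cos \<delta> > 0" using pi_gt3 by (intro cos_gt_zero_pi) auto
  have sl: "u1 (\<alpha> ?k) = tan \<delta>" unfolding \<delta>_def by (rule slope)
  have n: "normal (\<alpha> ?k) = (1 / cos \<delta>) *\<^sub>R dir \<nu>"
    using c by (intro plane_eqI)
      (simp_all add: normal_def on_circle sl \<nu>_def tan_def cos_add sin_add field_simps)
  have v: "boundary_velocity (\<alpha> ?k) = (1 / cos \<delta>) *\<^sub>R perp \<nu>"
    using c by (intro plane_eqI)
      (simp_all add: boundary_velocity_def r1_def on_circle sl \<nu>_def tan_def cos_add sin_add field_simps)
  show "\<gamma> T = boundary (\<alpha> ?k)" using T by (simp add: boundary_point)
  show "left_tangent \<gamma> T (perp (mid n))" by (rule left)
  show "norm (perp (mid ?k)) = 1" by simp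
  have "cos (mid n - \<nu>) = cos (\<nu> - mid n)" by (metis cos_minus minus_diff_eq)
  then show "(perp (mid ?k) - perp (mid n)) \<bullet> boundary_velocity (\<alpha> ?k) = 0"
    by (simp add: v inner_diff_left perp_inner_perp \<nu>)
  have "sin (\<nu> - mid ?k) = - sin (mid ?k - \<nu>)" by (metis minus_diff_eq sin_minus)
  moreover have "0 < sin (mid ?k - \<nu>)" unfolding \<nu> using mids pi_gt3 by (intro sin_gt_zero) auto
  ultimately show "normal (\<alpha> ?k) \<bullet> perp (mid ?k) < 0"
    using c by (simp add: n dir_inner_perp)
qed

lemma segment_end:
  assumes seg: "\<forall>t\<in>{0..l}. \<gamma> (T + t) = \<gamma> T + t *\<^sub>R e" and l: "0 < l"
  shows "left_tangent \<gamma> (T + l) e"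
proof (rule straight_left_tangent[of T])
  show "T < T + l" using l by simp
  fix t assume "t \<in> {T..T + l}"
  then show "\<gamma> t = \<gamma> T + (t - T) *\<^sub>R e" using bspec[OF seg, of "t - T"] by simp
qed

text \<open>
  Alternately the path follows a chord through the interior and is reflected at its end.
\<close>

lemma hits: "\<gamma> (hit n) = dir (\<alpha> (Suc n)) \<and> left_tangent \<gamma> (hit n) (perp (mid n))"
proof (induction n)
  case 0
  let ?l = "chord 0 / 2"
  have l: "0 < ?l" using chord_pos[of 0] by simp
  have st: "\<gamma> 0 = dir (\<alpha> 0) + ?l *\<^sub>R perp (mid 0)"
    using chord_vector[of 0] by (simp add: start(1) algebra_simps flip: scaleR_left_distrib)
  have seg: "\<forall>t\<in>{0..?l}. \<gamma> (0 + t) = \<gamma> 0 + t *\<^sub>R perp (mid 0)"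
  proof (rule follow_line[OF _ l])
    show "right_tangent \<gamma> 0 (perp (mid 0))" using start(2) by (simp add: mid_def)
    fix t assume "0 < t" "t < ?l"
    then show "\<gamma> 0 + t *\<^sub>R perp (mid 0) \<in> interior table"
      using chord_point_interior[of "?l + t" 0] by (simp add: st scaleR_left_distrib algebra_simps)
  qed
  have "\<gamma> (0 + ?l) = \<gamma> 0 + ?l *\<^sub>R perp (mid 0)" using bspec[OF seg, of ?l] l by simp
  also have "\<dots> = dir (\<alpha> (Suc 0))"
  proof -
    have "?l *\<^sub>R perp (mid 0) + ?l *\<^sub>R perp (mid 0) = chord 0 *\<^sub>R perp (mid 0)"
      by (metis scaleR_left_distrib field_sum_of_halves)
    then show ?thesis unfolding st chord_vector[of 0] by (simp only: add.assoc)
  qed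
  finally show ?case using segment_end[OF seg l] by (simp add: hit_def)
next
  case (Suc n)
  let ?l = "chord (Suc n)"
  have l: "0 < ?l" by (rule chord_pos)
  have seg: "\<forall>t\<in>{0..?l}. \<gamma> (hit n + t) = \<gamma> (hit n) + t *\<^sub>R perp (mid (Suc n))"
  proof (rule follow_line[OF _ l])
    show "right_tangent \<gamma> (hit n) (perp (mid (Suc n)))" using Suc reflection by blast
    fix t assume "0 < t" "t < ?l"
    then show "\<gamma> (hit n) + t *\<^sub>R perp (mid (Suc n)) \<in> interior table"
      using chord_point_interior[of t "Suc n"] Suc by simp
  qed
  have "\<gamma> (hit n + ?l) = \<gamma> (hit n) + ?l *\<^sub>R perp (mid (Suc n))" using bspec[OF seg, of ?l] l by simp
  also have "\<dots> = dir (\<alpha> (Suc (Suc n)))" using Suc by (simp add: chord_vector[of "Suc n"])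
  finally show ?case using segment_end[OF seg l] by (simp add: hit_Suc)
qed

lemma between_hits:
  assumes "hit n < t" "t < hit (Suc n)"
  shows "\<gamma> t \<in> interior table"
proof -
  have l: "0 < chord (Suc n)" by (rule chord_pos)
  have int: "\<gamma> (hit n) + s *\<^sub>R perp (mid (Suc n)) \<in> interior table" if "0 < s" "s < chord (Suc n)" for s
    using chord_point_interior[OF that] hits by simp
  have "\<forall>s\<in>{0..chord (Suc n)}. \<gamma> (hit n + s) = \<gamma> (hit n) + s *\<^sub>R perp (mid (Suc n))"
    using hits reflection int by (intro follow_line l) blast+
  from bspec[OF this, of "t - hit n"] show ?thesis
    using int[of "t - hit n"] assms by (simp add: hit_Suc)
qed

lemma hit_strict: "hit n < hit (Suc n)"
  using chord_pos by (simp add: hit_Suc)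

text \<open>
  Chords are shorter than arcs, so the total length of the infinitely many chords is at most the total angle.
\<close>

lemma hit_limit: "\<exists>T. hit \<longlonglongrightarrow> T \<and> (\<forall>n. hit n < T)"
proof -
  have "hit n \<le> chord 0 / 2 + (\<alpha> (Suc n) - \<alpha> 1)" for n
  proof (induction n)
    case (Suc n)
    then show ?case using chord_le[of "Suc n"] by (simp add: hit_Suc)
  qed (simp add: hit_def)
  then have b: "hit n \<le> chord 0 / 2 + 1" for n
    using neg[of "Suc n"] low[of 1] by (smt (verit))
  have "incseq hit" using hit_strict by (intro incseq_SucI less_imp_le)
  then obtain T where T: "hit \<longlonglongrightarrow> T" "\<forall>n. hit n \<le> T"
    using b incseq_convergent[of hit] by blast
  then have "hit n < T" for n using hit_strict[of n] by (meson less_le_trans)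
  with T show ?thesis by blast
qed

lemma limit_position: "hit \<longlonglongrightarrow> T \<Longrightarrow> \<gamma> T = dir 0"
proof (rule LIMSEQ_unique)
  assume T: "hit \<longlonglongrightarrow> T"
  have "isCont \<gamma> T" using continuous[of UNIV] by (simp add: continuous_on_eq_continuous_at)
  then show "(\<lambda>n. \<gamma> (hit n)) \<longlonglongrightarrow> \<gamma> T" using T by (rule isCont_tendsto_compose)
  have "isCont dir 0" using dir_deriv has_vector_derivative_continuous by blast
  moreover have "(\<lambda>n. \<alpha> (Suc n)) \<longlonglongrightarrow> 0" using lim by (rule LIMSEQ_Suc)
  ultimately have "(\<lambda>n. dir (\<alpha> (Suc n))) \<longlonglongrightarrow> dir 0" by (rule isCont_tendsto_compose)
  then show "(\<lambda>n. \<gamma> (hit n)) \<longlonglongrightarrow> dir 0" using hits by simp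
qed

text \<open>
  The secants from the bounce points to the limit point are chords of the unit circle, whose directions converge to the
  tangent direction.
\<close>

lemma limit_left_tangent:
  assumes T: "hit \<longlonglongrightarrow> T" "\<forall>n. hit n < T"
  shows "left_tangent \<gamma> T (perp 0)"
proof -
  obtain v where v: "left_tangent \<gamma> T v" "norm v = 1" using ex_left_tangent by blast
  define h where "h n = T - hit n" for n
  have h: "h n > 0" for n using T by (simp add: h_def)
  have "(\<lambda>n. T - hit n) \<longlonglongrightarrow> T - T" by (intro tendsto_intros T)
  then have "filterlim h (at_right 0) sequentially"
    using h by (intro tendsto_imp_filterlim_at_right) (simp_all add: h_def[abs_def])
  then have "(\<lambda>n. (\<gamma> T - \<gamma> (T - h n)) /\<^sub>R h n) \<longlonglongrightarrow> v"
    using v(1) unfolding left_tangent_def by (rule filterlim_compose[rotated])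
  moreover define c where "c n = 2 * sin (- \<alpha> (Suc n) / 2) / h n" for n
  have c: "(\<gamma> T - \<gamma> (T - h n)) /\<^sub>R h n = c n *\<^sub>R perp (\<alpha> (Suc n) / 2)" for n
  proof -
    have "\<gamma> T - \<gamma> (T - h n) = dir 0 - dir (\<alpha> (Suc n))" using limit_position[OF T(1)] hits[of n] by (simp add: h_def)
    also have "\<dots> = (2 * sin (- \<alpha> (Suc n) / 2)) *\<^sub>R perp (\<alpha> (Suc n) / 2)" using chord_eq[of 0 "\<alpha> (Suc n)"] by simp
    finally have eq: "\<gamma> T - \<gamma> (T - h n) = (2 * sin (- \<alpha> (Suc n) / 2)) *\<^sub>R perp (\<alpha> (Suc n) / 2)" .
    show ?thesis unfolding eq c_def scaleR_scaleR by (simp only: divide_inverse mult.commute)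
  qed
  ultimately have lv: "(\<lambda>n. c n *\<^sub>R perp (\<alpha> (Suc n) / 2)) \<longlonglongrightarrow> v" by simp
  have "c n > 0" for n
  proof -
    have "0 < sin (- \<alpha> (Suc n) / 2)" using neg[of "Suc n"] low[of "Suc n"] pi_gt3 by (intro sin_gt_zero) auto
    then show ?thesis unfolding c_def by (intro divide_pos_pos mult_pos_pos h) simp_all
  qed
  then have "norm (c n *\<^sub>R perp (\<alpha> (Suc n) / 2)) = c n" for n by (simp add: less_imp_le)
  then have "c \<longlonglongrightarrow> 1" using tendsto_norm[OF lv] v(2) by simp
  moreover have "(\<lambda>n. perp (\<alpha> (Suc n) / 2)) \<longlonglongrightarrow> perp 0"
  proof -
    have "isCont perp 0" using perp_deriv has_vector_derivative_continuous by blast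
    moreover have "(\<lambda>n. \<alpha> (Suc n) / 2) \<longlonglongrightarrow> 0"
      using tendsto_divide[OF LIMSEQ_Suc[OF lim] tendsto_const, of 2] by simp
    ultimately show ?thesis by (rule isCont_tendsto_compose)
  qed
  ultimately have "(\<lambda>n. c n *\<^sub>R perp (\<alpha> (Suc n) / 2)) \<longlonglongrightarrow> 1 *\<^sub>R perp 0" by (intro tendsto_scaleR)
  then have "v = perp 0" using LIMSEQ_unique[OF lv] by simp
  then show ?thesis using v by simp
qed

text \<open>
  A path which arrives tangentially keeps its velocity, because the tangential component is preserved and the speed is 1.
\<close>

lemma limit_right_tangent:
  assumes T: "hit \<longlonglongrightarrow> T" "\<forall>n. hit n < T"
  shows "right_tangent \<gamma> T (perp 0)"
proof -
  obtain w where w: "right_tangent \<gamma> T w" "norm w = 1" using ex_right_tangent by blast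
  have "\<gamma> T = boundary 0" using limit_position[OF T(1)] by (simp add: boundary_def on_circle)
  then have "(w - perp 0) \<bullet> boundary_velocity 0 = 0"
    using bounce_tangential limit_left_tangent[OF T] w by blast
  then have "w \<bullet> perp 0 = 1"
    by (simp add: boundary_velocity_def r1_def on_circle inner_diff_left perp_inner_perp)
  then have "(w - perp 0) \<bullet> (w - perp 0) = 0"
    using w(2) by (simp add: inner_diff inner_commute norm_eq_1 perp_inner_perp)
  then have "w = perp 0" by simp
  then show ?thesis using w by simp
qed

end

section \<open>Trains of bumps\<close>

text \<open>
  At 0 both one-sided difference quotients tend to 0, because the exponent exceeds 1.
\<close>

lemma has_derivative_positive_part_power:
  assumes "n > 0"
  shows "((\<lambda>x::real. max 0 x ^ Suc n) has_real_derivative real (Suc n) * max 0 x ^ n) (at x)"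
proof -
  consider "x > 0" | "x < 0" | "x = 0" by linarith
  then show ?thesis
  proof cases
    case 1
    have "((\<lambda>x::real. x ^ Suc n) has_real_derivative real (Suc n) * x ^ n) (at x)"
      using DERIV_pow[of "Suc n" x UNIV] by simp
    then have "((\<lambda>x::real. max 0 x ^ Suc n) has_real_derivative real (Suc n) * x ^ n) (at x)"
      by (rule has_field_derivative_transform_within_open[of _ _ _ "{0<..}"]) (use 1 in auto)
    then show ?thesis using 1 by (simp add: max_def)
  next
    case 2
    have "((\<lambda>x::real. max 0 x ^ Suc n) has_real_derivative 0) (at x)"
      by (rule has_field_derivative_transform_within_open[OF DERIV_const[of 0], of "{..<0}"]) (use 2 in auto)
    moreover have "real (Suc n) * max 0 x ^ n = 0" using 2 assms by (simp add: max_absorb1)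
    ultimately show ?thesis by (simp only:)
  next
    case 3
    have "((\<lambda>h::real. max 0 h ^ Suc n / h) \<longlongrightarrow> 0) (at 0)"
    proof (rule Lim_null_comparison)
      show "\<forall>\<^sub>F h::real in at 0. norm (max 0 h ^ Suc n / h) \<le> \<bar>h\<bar> ^ n"
        by (intro always_eventually allI) (auto simp: max_def power_abs)
      have "((\<lambda>h::real. \<bar>h\<bar> ^ n) \<longlongrightarrow> \<bar>0\<bar> ^ n) (at 0)" by (intro tendsto_intros)
      moreover have "\<bar>0::real\<bar> ^ n = 0" using assms by simp
      ultimately show "((\<lambda>h::real. \<bar>h\<bar> ^ n) \<longlongrightarrow> 0) (at 0)" by (simp only:)
    qed
    moreover have "real (Suc n) * max 0 x ^ n = 0" using 3 assms by simp
    ultimately show ?thesis unfolding DERIV_def using 3 by (simp only: max.idem) (simp add: assms)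
  qed
qed

definition bump_part :: "real \<Rightarrow> real" where "bump_part x = max 0 (1 - x\<^sup>2)"

text \<open>
  The profile \<open>x * (1 - x\<^sup>2) ^ 4\<close>, cut off outside the unit interval, together with its first three derivatives.  It
  vanishes at 0 with slope 1, and the fourth power makes the cut-off three times differentiable.
\<close>

definition bump :: "nat \<Rightarrow> real \<Rightarrow> real" where
  "bump j x = (if j = 0 then x * bump_part x ^ 4
     else if j = 1 then bump_part x ^ 4 - 8 * x\<^sup>2 * bump_part x ^ 3
     else if j = 2 then 48 * x ^ 3 * bump_part x ^ 2 - 24 * x * bump_part x ^ 3
     else 288 * x\<^sup>2 * bump_part x ^ 2 - 24 * bump_part x ^ 3 - 192 * x ^ 4 * bump_part x)"

lemma bump_part_power_deriv:
  assumes "n > 0"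
  shows "((\<lambda>x. bump_part x ^ Suc n) has_real_derivative (real (Suc n) * bump_part x ^ n) * (- 2 * x)) (at x)"
proof -
  have "((\<lambda>x::real. 1 - x\<^sup>2) has_real_derivative (- 2 * x)) (at x)"
    by (auto intro!: derivative_eq_intros)
  from DERIV_chain2[OF has_derivative_positive_part_power[OF assms] this]
  show ?thesis by (simp add: bump_part_def)
qed

lemma bump_deriv:
  assumes "j < 3"
  shows "(bump j has_real_derivative bump (Suc j) x) (at x)"
proof -
  have m2: "((\<lambda>x. bump_part x ^ 2) has_real_derivative (2 * bump_part x) * (- 2 * x)) (at x)"
    using bump_part_power_deriv[of 1 x] by (simp add: numeral_2_eq_2)
  have m3: "((\<lambda>x. bump_part x ^ 3) has_real_derivative (3 * bump_part x ^ 2) * (- 2 * x)) (at x)"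
    using bump_part_power_deriv[of 2 x] by (simp add: numeral_3_eq_3)
  have m4: "((\<lambda>x. bump_part x ^ 4) has_real_derivative (4 * bump_part x ^ 3) * (- 2 * x)) (at x)"
    using bump_part_power_deriv[of 3 x] by (simp add: eval_nat_numeral)
  have x3: "((\<lambda>x::real. x ^ 3) has_real_derivative 3 * x\<^sup>2) (at x)"
    by (auto intro!: derivative_eq_intros)
  have x2: "((\<lambda>x::real. x\<^sup>2) has_real_derivative 2 * x) (at x)"
    by (auto intro!: derivative_eq_intros)
  have "j = 0 \<or> j = 1 \<or> j = 2" using assms by auto
  then show ?thesis
  proof (elim disjE)
    assume j: "j = 0"
    have "((\<lambda>x. x * bump_part x ^ 4) has_real_derivative (1 * bump_part x ^ 4 + ((4 * bump_part x ^ 3) * (- 2 * x)) * x)) (at x)"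
      by (rule DERIV_mult[OF DERIV_ident m4])
    moreover have "1 * bump_part x ^ 4 + ((4 * bump_part x ^ 3) * (- 2 * x)) * x = bump 1 x"
      by (simp add: bump_def power2_eq_square)
    moreover have "bump 0 = (\<lambda>x. x * bump_part x ^ 4)" by (auto simp: bump_def)
    ultimately show ?thesis using j by simp
  next
    assume j: "j = 1"
    have "((\<lambda>x. bump_part x ^ 4 - 8 * (x\<^sup>2 * bump_part x ^ 3)) has_real_derivative
        ((4 * bump_part x ^ 3) * (- 2 * x) - 8 * ((2 * x) * bump_part x ^ 3 + ((3 * bump_part x ^ 2) * (- 2 * x)) * x\<^sup>2))) (at x)"
      by (intro DERIV_diff m4 DERIV_cmult DERIV_mult x2 m3)
    moreover have "(4 * bump_part x ^ 3) * (- 2 * x) - 8 * ((2 * x) * bump_part x ^ 3 + ((3 * bump_part x ^ 2) * (- 2 * x)) * x\<^sup>2) = bump 2 x"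
      by (simp add: bump_def power2_eq_square power3_eq_cube algebra_simps)
    moreover have "bump 1 = (\<lambda>x. bump_part x ^ 4 - 8 * (x\<^sup>2 * bump_part x ^ 3))" by (auto simp: bump_def)
    ultimately show ?thesis using j by (simp add: numeral_2_eq_2)
  next
    assume j: "j = 2"
    have "((\<lambda>x. 48 * (x ^ 3 * bump_part x ^ 2) - 24 * (x * bump_part x ^ 3)) has_real_derivative
        (48 * ((3 * x\<^sup>2) * bump_part x ^ 2 + ((2 * bump_part x) * (- 2 * x)) * x ^ 3)
          - 24 * (1 * bump_part x ^ 3 + ((3 * bump_part x ^ 2) * (- 2 * x)) * x))) (at x)"
      by (intro DERIV_diff DERIV_cmult DERIV_mult x3 m2 m3 DERIV_ident)
    moreover have "48 * ((3 * x\<^sup>2) * bump_part x ^ 2 + ((2 * bump_part x) * (- 2 * x)) * x ^ 3)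
          - 24 * (1 * bump_part x ^ 3 + ((3 * bump_part x ^ 2) * (- 2 * x)) * x) = bump 3 x"
      by (simp add: bump_def power2_eq_square power3_eq_cube power4_eq_xxxx algebra_simps)
    moreover have "bump 2 = (\<lambda>x. 48 * (x ^ 3 * bump_part x ^ 2) - 24 * (x * bump_part x ^ 3))" by (auto simp: bump_def)
    ultimately show ?thesis using j by (simp add: numeral_3_eq_3)
  qed
qed

lemma bump_outside: "1 \<le> \<bar>x\<bar> \<Longrightarrow> bump j x = 0"
proof -
  assume "1 \<le> \<bar>x\<bar>"
  then have "1 \<le> x\<^sup>2" by (simp add: abs_le_square_iff[of 1 x, simplified])
  then have "bump_part x = 0" by (simp add: bump_part_def)
  then show ?thesis by (simp add: bump_def)
qed

lemma bump_bound:
  assumes "j < 3"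
  shows "\<bar>bump j x\<bar> \<le> 72"
proof (cases "1 \<le> \<bar>x\<bar>")
  case True
  then show ?thesis by (simp add: bump_outside)
next
  case False
  then have x: "\<bar>x\<bar> \<le> 1" by simp
  have m: "0 \<le> bump_part x" "bump_part x \<le> 1" by (auto simp: bump_part_def)
  have p: "\<bar>x ^ i * bump_part x ^ k\<bar> \<le> 1" for i k
    using x m by (simp add: abs_mult power_abs power_le_one mult_le_one)
  have "j = 0 \<or> j = 1 \<or> j = 2" using assms by auto
  then show ?thesis
  proof (elim disjE)
    assume "j = 0"
    then show ?thesis using p[of 1 4] by (simp add: bump_def)
  next
    assume "j = 1"
    then have "bump j x = x ^ 0 * bump_part x ^ 4 - 8 * (x ^ 2 * bump_part x ^ 3)"
      by (simp add: bump_def)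
    then show ?thesis using p[of 0 4] p[of 2 3] by linarith
  next
    assume "j = 2"
    then have "bump j x = 48 * (x ^ 3 * bump_part x ^ 2) - 24 * (x ^ 1 * bump_part x ^ 3)"
      by (simp add: bump_def)
    then show ?thesis using p[of 3 2] p[of 1 3] by linarith
  qed
qed

lemma bump_at_0: "bump 0 0 = 0" "bump 1 0 = 1"
  by (simp_all add: bump_def bump_part_def)

text \<open>
  Bumps with centers \<open>\<sigma> k\<close>, half widths \<open>w k\<close>, disjoint supports and prescribed slopes \<open>s k\<close> at the centers accumulate
  at 0 from the left.  The second derivative of a bump is of size \<open>s k / w k\<close>, the third one of size \<open>s k / (w k)\<^sup>2\<close>.
  The decay condition makes the second derivative \<open>O(x\<^sup>2)\<close>, so that it is differentiable at 0, even if the third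
  derivatives are unbounded there.
\<close>

locale bump_train =
  fixes \<sigma> w s :: "nat \<Rightarrow> real" and B :: real
  assumes center_neg: "\<sigma> k < 0" and center_lim: "\<sigma> \<longlonglongrightarrow> 0"
    and width: "0 < w k" "w k \<le> 1"
    and separated: "\<sigma> k + w k \<le> \<sigma> (Suc k) - w (Suc k)"
    and slope_small: "300 * \<bar>s k\<bar> \<le> w k"
    and slope_decay: "\<bar>s k\<bar> \<le> B * w k * (\<sigma> k + w k)\<^sup>2"
begin

definition summand :: "nat \<Rightarrow> nat \<Rightarrow> real \<Rightarrow> real" where
  "summand j k x = s k * w k / w k ^ j * bump j ((x - \<sigma> k) / w k)"

definition train :: "nat \<Rightarrow> real \<Rightarrow> real" where
  "train j x = (\<Sum>k. summand j k x)"

lemma summand_outside: "w k \<le> \<bar>x - \<sigma> k\<bar> \<Longrightarrow> summand j k x = 0"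
proof -
  assume "w k \<le> \<bar>x - \<sigma> k\<bar>"
  then have "1 \<le> \<bar>(x - \<sigma> k) / w k\<bar>" using width(1)[of k] by (simp add: abs_divide pos_le_divide_eq)
  then show ?thesis by (simp add: summand_def bump_outside)
qed

lemma separated_less: "k < l \<Longrightarrow> \<sigma> k + w k \<le> \<sigma> l - w l"
proof (induction l)
  case (Suc l)
  show ?case
  proof (cases "k = l")
    case False
    then have "\<sigma> k + w k \<le> \<sigma> l - w l" using Suc by simp
    also have "\<dots> \<le> \<sigma> l + w l" using width(1)[of l] by simp
    also have "\<dots> \<le> \<sigma> (Suc l) - w (Suc l)" by (rule separated)
    finally show ?thesis .
  qed (use separated in simp)
qed simp

lemma support_neg: "\<sigma> k + w k < 0"
  using separated[of k] center_neg[of "Suc k"] width(1)[of "Suc k"] by linarith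

lemma summand_deriv:
  assumes "j < 3"
  shows "(summand j k has_real_derivative summand (Suc j) k x) (at x)"
proof -
  have w: "w k \<noteq> 0" using width(1)[of k] by simp
  have lin: "((\<lambda>x. (x - \<sigma> k) / w k) has_real_derivative 1 / w k) (at x)"
    by (rule DERIV_cdivide) (auto intro!: derivative_eq_intros)
  have "((\<lambda>x. s k * w k / w k ^ j * bump j ((x - \<sigma> k) / w k)) has_real_derivative
      s k * w k / w k ^ j * (bump (Suc j) ((x - \<sigma> k) / w k) * (1 / w k))) (at x)"
    by (rule DERIV_cmult[OF DERIV_chain2[OF bump_deriv[OF assms] lin]])
  moreover have "s k * w k / w k ^ j * (bump (Suc j) ((x - \<sigma> k) / w k) * (1 / w k)) = summand (Suc j) k x"
    using w by (simp add: summand_def)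
  moreover have "summand j k = (\<lambda>x. s k * w k / w k ^ j * bump j ((x - \<sigma> k) / w k))" by (auto simp: summand_def)
  ultimately show ?thesis by simp
qed

lemma train_single:
  "train j x = 0 \<or> (\<exists>k. \<bar>x - \<sigma> k\<bar> < w k \<and> train j x = summand j k x)"
proof (cases "\<exists>k. \<bar>x - \<sigma> k\<bar> < w k")
  case True
  then obtain k where k: "\<bar>x - \<sigma> k\<bar> < w k" by blast
  have "summand j l x = 0" if "l \<notin> {k}" for l
  proof (rule summand_outside, rule ccontr)
    assume "\<not> w l \<le> \<bar>x - \<sigma> l\<bar>"
    then show False using k separated_less[of k l] separated_less[of l k] that by (cases "k < l") auto
  qed
  then have "train j x = (\<Sum>l\<in>{k}. summand j l x)" unfolding train_def by (intro suminf_finite) auto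
  then show ?thesis using k by auto
next
  case False
  then have "summand j l x = 0" for l by (intro summand_outside) (simp add: not_less)
  then show ?thesis by (simp add: train_def)
qed

lemma summand_bound:
  assumes "j < 3"
  shows "\<bar>summand j k x\<bar> \<le> 72 * (\<bar>s k\<bar> / w k)"
proof -
  have w: "0 < w k" "w k \<le> 1" by (rule width)+
  have j: "j = 0 \<or> j = 1 \<or> j = 2" using assms by auto
  have "w k / w k ^ j \<le> 1 / w k"
  proof -
    have "w k * w k \<le> 1" using w by (simp add: mult_le_one)
    then show ?thesis using j w by (auto simp: field_simps power2_eq_square)
  qed
  then have "\<bar>s k\<bar> * (w k / w k ^ j) \<le> \<bar>s k\<bar> * (1 / w k)" by (intro mult_left_mono) auto
  then have "\<bar>s k * w k / w k ^ j\<bar> \<le> \<bar>s k\<bar> / w k" using w by (simp add: abs_mult)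
  then have "\<bar>bump j ((x - \<sigma> k) / w k)\<bar> * \<bar>s k * w k / w k ^ j\<bar> \<le> 72 * (\<bar>s k\<bar> / w k)"
    using bump_bound[OF assms] w by (intro mult_mono) auto
  then show ?thesis by (simp only: summand_def abs_mult[symmetric] mult.commute)
qed

lemma train_bound: "j < 3 \<Longrightarrow> \<bar>train j x\<bar> \<le> 1 / 4"
proof -
  assume j: "j < 3"
  have "72 * (\<bar>s k\<bar> / w k) \<le> 1 / 4" for k
    using slope_small[of k] width(1)[of k] by (simp add: field_simps)
  then have "\<bar>summand j k x\<bar> \<le> 1 / 4" for k using summand_bound[OF j, of k x] order_trans by blast
  then show ?thesis using train_single[of j x] by auto
qed

lemma B_nonneg: "0 \<le> B"
proof -
  have "0 \<le> B * (w 0 * (\<sigma> 0 + w 0)\<^sup>2)" using slope_decay[of 0] by (simp add: mult.assoc)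
  moreover have "0 < w 0 * (\<sigma> 0 + w 0)\<^sup>2" using width(1)[of 0] support_neg[of 0] by simp
  ultimately show ?thesis by (simp add: zero_le_mult_iff)
qed

lemma train_decay: "j < 3 \<Longrightarrow> \<bar>train j x\<bar> \<le> 72 * B * x\<^sup>2"
proof -
  assume j: "j < 3"
  from train_single[of j x] show ?thesis
  proof
    assume "\<exists>k. \<bar>x - \<sigma> k\<bar> < w k \<and> train j x = summand j k x"
    then obtain k where k: "\<bar>x - \<sigma> k\<bar> < w k" "train j x = summand j k x" by blast
    have "\<bar>s k\<bar> / w k \<le> B * (\<sigma> k + w k)\<^sup>2"
      using slope_decay[of k] width(1)[of k] by (simp add: field_simps)
    also have "\<dots> \<le> B * x\<^sup>2"
    proof (rule mult_left_mono[OF _ B_nonneg])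
      have "\<bar>\<sigma> k + w k\<bar> \<le> \<bar>x\<bar>" using k support_neg[of k] by linarith
      then show "(\<sigma> k + w k)\<^sup>2 \<le> x\<^sup>2" by (simp add: abs_le_square_iff)
    qed
    finally show ?thesis using summand_bound[OF j, of k x] k by simp
  qed (use B_nonneg in simp)
qed

lemma locally_finite:
  assumes "x \<noteq> 0"
  shows "\<exists>U N. open U \<and> x \<in> U \<and> (\<forall>y\<in>U. \<forall>j. train j y = (\<Sum>k<N. summand j k y))"
proof (cases "0 < x")
  case True
  have "summand j k y = 0" if "0 < y" for j k y
    using that support_neg[of k] by (intro summand_outside) linarith
  then show ?thesis using True by (intro exI[of _ "{0<..}"] exI[of _ 0]) (auto simp: train_def)
next
  case False
  then have x: "x / 2 < 0" using assms by simp
  have "\<forall>\<^sub>F k in sequentially. x / 2 < \<sigma> k" using center_lim x by (rule order_tendstoD)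
  then obtain N where N: "\<And>k. N \<le> k \<Longrightarrow> x / 2 < \<sigma> k" by (auto simp: eventually_sequentially)
  have "train j y = (\<Sum>k<Suc N. summand j k y)" if y: "y < x / 2" for j y
    unfolding train_def
  proof (rule suminf_finite)
    fix k assume "k \<notin> {..<Suc N}"
    then have "N < k" by simp
    then have "\<sigma> N + w N \<le> \<sigma> k - w k" by (rule separated_less)
    then show "summand j k y = 0"
      using N[of N] width(1)[of N] y by (intro summand_outside) linarith
  qed simp
  then show ?thesis using False assms by (intro exI[of _ "{..<x / 2}"] exI[of _ "Suc N"]) auto
qed

text \<open>
  Away from 0 the series is locally a finite sum; at 0 the quadratic decay gives the derivative 0.
\<close>

lemma train_deriv:
  assumes j: "j < 3"
  shows "(train j has_real_derivative train (Suc j) x) (at x)"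
proof (cases "x = 0")
  case True
  have z: "train i 0 = 0" for i
  proof -
    have "summand i k 0 = 0" for k using support_neg[of k] center_neg[of k] by (intro summand_outside) linarith
    then show ?thesis by (simp add: train_def)
  qed
  have "((\<lambda>h. train j h / h) \<longlongrightarrow> 0) (at 0)"
  proof (rule Lim_null_comparison)
    show "\<forall>\<^sub>F h in at 0. norm (train j h / h) \<le> 72 * B * \<bar>h\<bar>"
    proof (intro always_eventually allI)
      fix h :: real
      show "norm (train j h / h) \<le> 72 * B * \<bar>h\<bar>"
      proof (cases "h = 0")
        case False
        have "\<bar>train j h\<bar> \<le> 72 * B * \<bar>h\<bar> * \<bar>h\<bar>" using train_decay[OF j, of h] by (simp add: power2_eq_square mult.assoc)
        then show ?thesis using False by (simp add: abs_divide pos_divide_le_eq)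
      qed simp
    qed
    have "((\<lambda>h. 72 * B * \<bar>h\<bar>) \<longlongrightarrow> 72 * B * \<bar>0\<bar>) (at 0)" by (intro tendsto_intros)
    then show "((\<lambda>h. 72 * B * \<bar>h\<bar>) \<longlongrightarrow> 0) (at 0)" by simp
  qed
  then show ?thesis using True by (simp add: DERIV_def z)
next
  case False
  then obtain U N where U: "open U" "x \<in> U" "\<forall>y\<in>U. \<forall>j. train j y = (\<Sum>k<N. summand j k y)"
    using locally_finite by blast
  have "((\<lambda>y. \<Sum>k<N. summand j k y) has_real_derivative (\<Sum>k<N. summand (Suc j) k x)) (at x)"
    by (intro DERIV_sum summand_deriv j)
  then have "(train j has_real_derivative (\<Sum>k<N. summand (Suc j) k x)) (at x)"
    by (rule has_field_derivative_transform_within_open[of _ _ _ U]) (use U in auto)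
  then show ?thesis using U by simp
qed

lemma train_at_center: "train 0 (\<sigma> k) = 0" "train 1 (\<sigma> k) = s k"
proof -
  have "train j (\<sigma> k) = summand j k (\<sigma> k)" for j
  proof -
    have "summand j l (\<sigma> k) = 0" if "l \<notin> {k}" for l
      using that separated_less[of k l] separated_less[of l k] width(1)[of k] width(1)[of l]
      by (intro summand_outside, cases "k < l") auto
    then have "train j (\<sigma> k) = (\<Sum>l\<in>{k}. summand j l (\<sigma> k))" unfolding train_def by (intro suminf_finite) auto
    then show ?thesis by simp
  qed
  then show "train 0 (\<sigma> k) = 0" "train 1 (\<sigma> k) = s k"
    using width(1)[of k] by (simp_all add: summand_def bump_at_0 bump_at_0[unfolded One_nat_def])
qed

lemma train_at_0: "train 0 0 = 0" "train 1 0 = 0"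
  using train_decay[of 0 0] train_decay[of 1 0] by simp_all

end

context bump_train
begin

text \<open>
  Substituting the sine makes the bumps periodic, and repeats them as a mirror image near the angle \<open>pi\<close>.
  As the bumps and their first two derivatives are at most 1/4, \<open>u + u''\<close> stays positive.
\<close>

lemma polar_table:
  "polar_table (\<lambda>t. 1 + train 0 (sin t)) (\<lambda>t. train 1 (sin t) * cos t)
     (\<lambda>t. train 2 (sin t) * (cos t)\<^sup>2 - train 1 (sin t) * sin t)
     (\<lambda>t. train 3 (sin t) * cos t ^ 3 - 3 * train 2 (sin t) * sin t * cos t - train 1 (sin t) * cos t)"
proof
  have d: "((\<lambda>t. train j (sin t)) has_real_derivative train (Suc j) (sin t) * cos t) (at t)" if "j < 3" for j t
    by (rule DERIV_chain2[OF train_deriv[OF that] DERIV_sin])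
  have d0: "((\<lambda>t. train 0 (sin t)) has_real_derivative train 1 (sin t) * cos t) (at t)" for t
    using d[of 0 t] by simp
  have d1: "((\<lambda>t. train 1 (sin t)) has_real_derivative train 2 (sin t) * cos t) (at t)" for t
    using d[of 1 t] by (simp add: numeral_2_eq_2)
  have d2: "((\<lambda>t. train 2 (sin t)) has_real_derivative train 3 (sin t) * cos t) (at t)" for t
    using d[of 2 t] by (simp add: numeral_3_eq_3)
  fix t :: real and m :: int
  show "((\<lambda>t. 1 + train 0 (sin t)) has_real_derivative train 1 (sin t) * cos t) (at t)"
    by (auto intro!: derivative_eq_intros d0)
  have "((\<lambda>t. train 1 (sin t) * cos t) has_real_derivative
      (train 2 (sin t) * cos t) * cos t + (- sin t) * train 1 (sin t)) (at t)"
    by (rule DERIV_mult[OF d1 DERIV_cos])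
  then show "((\<lambda>t. train 1 (sin t) * cos t) has_real_derivative
      train 2 (sin t) * (cos t)\<^sup>2 - train 1 (sin t) * sin t) (at t)"
    by (simp add: power2_eq_square algebra_simps)
  have c2: "((\<lambda>t. (cos t)\<^sup>2) has_real_derivative - (2 * cos t * sin t)) (at t)"
    by (auto intro!: derivative_eq_intros)
  have "((\<lambda>t. train 2 (sin t) * (cos t)\<^sup>2 - train 1 (sin t) * sin t) has_real_derivative
      ((train 3 (sin t) * cos t) * (cos t)\<^sup>2 + (- (2 * cos t * sin t)) * train 2 (sin t))
      - ((train 2 (sin t) * cos t) * sin t + cos t * train 1 (sin t))) (at t)"
    by (rule DERIV_diff[OF DERIV_mult[OF d2 c2] DERIV_mult[OF d1 DERIV_sin]])
  then show "((\<lambda>t. train 2 (sin t) * (cos t)\<^sup>2 - train 1 (sin t) * sin t) has_real_derivative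
      train 3 (sin t) * cos t ^ 3 - 3 * train 2 (sin t) * sin t * cos t - train 1 (sin t) * cos t) (at t)"
    by (simp add: power2_eq_square power3_eq_cube algebra_simps)
  have per: "sin (t + 2 * pi * of_int m) = sin t" "cos (t + 2 * pi * of_int m) = cos t"
    by (simp_all add: sin_add cos_add)
  show "1 + train 0 (sin (t + 2 * pi * of_int m)) = 1 + train 0 (sin t)"
    "train 1 (sin (t + 2 * pi * of_int m)) * cos (t + 2 * pi * of_int m) = train 1 (sin t) * cos t"
    by (simp_all only: per)
  have b: "\<bar>train 0 (sin t)\<bar> \<le> 1 / 4" "\<bar>train 1 (sin t)\<bar> \<le> 1 / 4" "\<bar>train 2 (sin t)\<bar> \<le> 1 / 4"
    by (rule train_bound, simp)+
  have m: "\<bar>x * y\<bar> \<le> 1 / 4" if "\<bar>x\<bar> \<le> 1 / 4" "\<bar>y\<bar> \<le> 1" for x y :: real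
    using mult_mono[OF that] by (simp add: abs_mult)
  have "\<bar>(cos t)\<^sup>2\<bar> \<le> 1" using abs_cos_le_one[of t] by (simp add: abs_square_le_1)
  then have "\<bar>train 2 (sin t) * (cos t)\<^sup>2\<bar> \<le> 1 / 4" using b by (intro m)
  moreover have "\<bar>train 1 (sin t) * sin t\<bar> \<le> 1 / 4" using b by (intro m) auto
  ultimately show "0 < 1 + train 0 (sin t) + (train 2 (sin t) * (cos t)\<^sup>2 - train 1 (sin t) * sin t)"
    using b by linarith
  show "1 / 2 \<le> 1 + train 0 (sin t)" "1 + train 0 (sin t) \<le> 2" using b by linarith+
  have "\<bar>train 1 (sin t) * cos t\<bar> \<le> 1 / 4" using b by (intro m) auto
  then show "\<bar>train 1 (sin t) * cos t\<bar> \<le> 2" by linarith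
qed

end

section \<open>The bounce angles\<close>

lemma cos_ge_half: "\<bar>z\<bar> \<le> 1 \<Longrightarrow> 1 / 2 \<le> cos (z::real)"
proof -
  assume z: "\<bar>z\<bar> \<le> 1"
  have "cos z = 1 - 2 * (sin (z / 2))\<^sup>2" using cos_double_sin[of "z / 2"] by simp
  moreover have "(sin (z / 2))\<^sup>2 \<le> (z / 2)\<^sup>2"
    using abs_sin_x_le_abs_x[of "z / 2"] by (simp only: abs_le_square_iff)
  moreover have "z\<^sup>2 \<le> 1" using z by (simp add: abs_square_le_1)
  ultimately show ?thesis by (simp add: power_divide)
qed

lemma abs_tan_le: "\<bar>y\<bar> \<le> 1 \<Longrightarrow> \<bar>tan (y::real)\<bar> \<le> 2 * \<bar>y\<bar>"
proof -
  assume y: "\<bar>y\<bar> \<le> 1"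
  have c: "1 / 2 \<le> cos y" using y by (rule cos_ge_half)
  have "\<bar>tan y\<bar> = \<bar>sin y\<bar> / cos y" using c by (simp add: tan_def abs_divide)
  also have "\<dots> \<le> \<bar>y\<bar> / (1 / 2)" using c abs_sin_x_le_abs_x[of y] by (intro frac_le) auto
  finally show ?thesis by simp
qed

lemma sin_increment:
  fixes x y :: real
  assumes "- 1 \<le> x" "x < y" "y \<le> 0"
  shows "(y - x) / 2 \<le> sin y - sin x"
proof -
  obtain z where z: "x < z" "z < y" "sin y - sin x = (y - x) * cos z"
    using MVT2[OF assms(2), of sin cos] DERIV_sin by blast
  have "1 / 2 \<le> cos z" using z assms by (intro cos_ge_half) auto
  then have "(y - x) * (1 / 2) \<le> (y - x) * cos z" using assms by (intro mult_left_mono) auto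
  then show ?thesis using z by simp
qed

lemma inverse_sqrt_decrement:
  fixes a :: real
  assumes "0 < a"
  shows "(a + 1) powr (- 3 / 2) / 2 \<le> a powr (- 1 / 2) - (a + 1) powr (- 1 / 2)"
proof -
  have d: "((\<lambda>x. x powr (- 1 / 2)) has_real_derivative (- 1 / 2) * x powr (- 3 / 2)) (at x)" if "a \<le> x" for x :: real
    using has_real_derivative_powr[of x "- 1 / 2"] that assms by simp
  have "a < a + 1" by simp
  from MVT2[OF this, of "\<lambda>x. x powr (- 1 / 2)" "\<lambda>x. (- 1 / 2) * x powr (- 3 / 2)"] d
  obtain z where z: "a < z" "z < a + 1"
    "(a + 1) powr (- 1 / 2) - a powr (- 1 / 2) = (a + 1 - a) * ((- 1 / 2) * z powr (- 3 / 2))" by blast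
  have "(a + 1) powr (- 3 / 2) \<le> z powr (- 3 / 2)" using z assms by (intro powr_mono2') auto
  then show ?thesis using z by simp
qed

text \<open>
  The constant is \<open>8 * (3 / 4)\<close>: the difference of two increments over steps of length 2 is twice the variation
  of the derivative between points at distance at most 4, and \<open>3 / 4\<close> is the factor of the second derivative.
\<close>

lemma inverse_sqrt_second_difference:
  fixes a :: real
  assumes "2 < a"
  shows "\<bar>2 * a powr (- 1 / 2) - (a - 2) powr (- 1 / 2) - (a + 2) powr (- 1 / 2)\<bar> \<le> 6 * (a - 2) powr (- 5 / 2)"
proof -
  let ?X = "\<lambda>x::real. x powr (- 1 / 2)" and ?Y = "\<lambda>x::real. (- 1 / 2) * x powr (- 3 / 2)"
  have d: "(?X has_real_derivative ?Y x) (at x)" if "a - 2 \<le> x" for x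
    using has_real_derivative_powr[of x "- 1 / 2"] that assms by simp
  have e: "(?Y has_real_derivative (3 / 4) * x powr (- 5 / 2)) (at x)" if "a - 2 \<le> x" for x
    using DERIV_cmult[OF has_real_derivative_powr[of x "- 3 / 2"], of "- 1 / 2"] that assms by simp
  have l: "a - 2 < a" "a < a + 2" by simp_all
  obtain p where p: "a - 2 < p" "p < a" "?X a - ?X (a - 2) = (a - (a - 2)) * ?Y p"
    using MVT2[OF l(1), of ?X ?Y] d by blast
  obtain q where q: "a < q" "q < a + 2" "?X (a + 2) - ?X a = (a + 2 - a) * ?Y q"
  proof -
    have "(?X has_real_derivative ?Y x) (at x)" if "a \<le> x" for x using d that by simp
    then show ?thesis using that MVT2[OF l(2), of ?X ?Y] by blast
  qed
  have "p < q" using p q by simp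
  obtain z where z: "p < z" "z < q" "?Y q - ?Y p = (q - p) * ((3 / 4) * z powr (- 5 / 2))"
  proof -
    have "(?Y has_real_derivative (3 / 4) * x powr (- 5 / 2)) (at x)" if "p \<le> x" for x
      by (rule e) (use that p in simp)
    then show ?thesis using that MVT2[OF \<open>p < q\<close>, of ?Y "\<lambda>z. (3 / 4) * z powr (- 5 / 2)"] by blast
  qed
  define W where "W = z powr (- 5 / 2)"
  have W: "0 \<le> W" "W \<le> (a - 2) powr (- 5 / 2)" unfolding W_def using z p assms by (auto intro!: powr_mono2')
  have "2 * ?X a - ?X (a - 2) - ?X (a + 2) = - (2 * (?Y q - ?Y p))" using p q by simp
  also have "\<dots> = - (2 * ((q - p) * ((3 / 4) * W)))" using z by (simp add: W_def)
  finally have "\<bar>2 * ?X a - ?X (a - 2) - ?X (a + 2)\<bar> = 2 * ((q - p) * ((3 / 4) * W))"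
    using W \<open>p < q\<close> by (simp add: abs_mult)
  also have "\<dots> \<le> 2 * (4 * ((3 / 4) * W))" using p q W by (intro mult_left_mono mult_right_mono) auto
  also have "\<dots> \<le> 6 * (a - 2) powr (- 5 / 2)" using W by simp
  finally show ?thesis .
qed

text \<open>
  The angles of the bounce points are \<open>- 1 / sqrt k\<close>, beginning at a large index.  Gaps are of order \<open>k powr (-3/2)\<close> and
  second differences of order \<open>k powr (-5/2)\<close>; so bumps with the required slopes that fit between the points have second
  derivatives of order \<open>1 / k\<close>, which is the square of the angle.  The index begins at \<open>10 ^ 8\<close> to keep
  the slopes below 1/300 of the widths.
\<close>

definition base :: "nat \<Rightarrow> real" where "base k = 10 ^ 8 + real k"
definition angle :: "nat \<Rightarrow> real" where "angle k = - (base k powr (- 1 / 2))"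
text \<open>
  The second difference has steps of length 2, since even and odd indices belong to different orbits.
\<close>

definition bend :: "nat \<Rightarrow> real" where
  "bend k = 2 * base k powr (- 1 / 2) - (base k - 2) powr (- 1 / 2) - (base k + 2) powr (- 1 / 2)"
definition width :: "nat \<Rightarrow> real" where "width k = (base k + 1) powr (- 3 / 2) / 8"
text \<open>
  The division by the cosine compensates for the substitution of the sine in the table.
\<close>

definition tilt :: "nat \<Rightarrow> real" where "tilt k = tan (bend k / 4) / cos (angle k)"

lemma base_ge: "10 ^ 8 \<le> base k" and base_Suc: "base (Suc k) = base k + 1"
  by (simp_all add: base_def)

lemma angle_range: "- 1 / 2 \<le> angle k" "angle k < 0"
proof -
  have "base k powr (- 1 / 2) \<le> (10 ^ 8) powr (- 1 / 2)"
    using base_ge[of k] by (intro powr_mono2') auto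
  also have "\<dots> \<le> 4 powr (- 1 / 2)" by (intro powr_mono2') auto
  also have "(4::real) powr (- 1 / 2) = 1 / 2"
    using powr_half_sqrt[of 4] by (simp add: powr_minus inverse_eq_divide)
  finally show "- 1 / 2 \<le> angle k" by (simp add: angle_def)
  show "angle k < 0" using base_ge[of k] by (simp add: angle_def)
qed

lemma angle_gap: "4 * width k \<le> angle (Suc k) - angle k"
  using inverse_sqrt_decrement[of "base k"] base_ge[of k] by (simp add: angle_def width_def base_Suc)

lemma width_pos: "0 < width k"
  using base_ge[of k] by (simp add: width_def)

lemma width_decreasing: "width (Suc k) \<le> width k"
  unfolding width_def base_Suc using base_ge[of k] by (intro divide_right_mono powr_mono2') auto

lemma width_le_angle: "8 * width k \<le> - angle k"
proof -
  have "(base k + 1) powr (- 3 / 2) \<le> (base k + 1) powr (- 1 / 2)"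
    using base_ge[of k] by (intro powr_mono) auto
  also have "\<dots> \<le> base k powr (- 1 / 2)" using base_ge[of k] by (intro powr_mono2') auto
  finally show ?thesis by (simp add: width_def angle_def)
qed

lemma angle_strict: "angle k < angle (Suc k)"
  using angle_gap[of k] width_pos[of k] by linarith

lemma angle_less: "k < l \<Longrightarrow> angle k < angle l"
  using angle_strict by (metis lift_Suc_mono_less)

lemma angle_lim: "angle \<longlonglongrightarrow> 0"
proof -
  have "filterlim base at_top sequentially"
    unfolding base_def[abs_def] by (rule filterlim_tendsto_add_at_top[OF tendsto_const filterlim_real_sequentially])
  then have "(\<lambda>k. base k powr (- 1 / 2)) \<longlonglongrightarrow> 0" by (intro tendsto_neg_powr) auto
  then have "(\<lambda>k. - (base k powr (- 1 / 2))) \<longlonglongrightarrow> - 0" by (rule tendsto_minus)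
  then show ?thesis by (simp add: angle_def[abs_def])
qed

lemma bend_le: "\<bar>bend k\<bar> \<le> 192 * width k / (base k - 2)"
proof -
  define b where "b = base k - 2"
  have b: "10 < b" "base k + 1 = b + 3" using base_ge[of k] by (simp_all add: b_def)
  have "b powr (- 5 / 2) = b powr (- 3 / 2 + - 1)" by simp
  also have "\<dots> = b powr (- 3 / 2) * b powr (- 1)" by (rule powr_add)
  also have "b powr (- 1) = 1 / b" using b by (simp add: powr_minus inverse_eq_divide)
  also have "b powr (- 3 / 2) \<le> 4 * (b + 3) powr (- 3 / 2)"
  proof -
    have "b powr (- 3 / 2) \<le> ((b + 3) / 2) powr (- 3 / 2)" using b by (intro powr_mono2') auto
    also have "\<dots> = (b + 3) powr (- 3 / 2) / 2 powr (- 3 / 2)" by (rule powr_divide)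
    also have "\<dots> \<le> (b + 3) powr (- 3 / 2) / (1 / 4)"
    proof (rule divide_left_mono)
      have "(2::real) powr (- 2) \<le> 2 powr (- 3 / 2)" by (rule powr_mono) auto
      moreover have "(2::real) powr (- 2) = 1 / 4" by (simp add: powr_neg_numeral)
      ultimately show "1 / 4 \<le> (2::real) powr (- 3 / 2)" by simp
    qed auto
    finally show ?thesis by simp
  qed
  finally have *: "b powr (- 5 / 2) \<le> 4 * (b + 3) powr (- 3 / 2) * (1 / b)" using b by (simp add: divide_right_mono)
  have "\<bar>bend k\<bar> \<le> 6 * b powr (- 5 / 2)"
    unfolding bend_def b_def using base_ge[of k] by (intro inverse_sqrt_second_difference) auto
  also have "\<dots> \<le> 6 * (4 * (b + 3) powr (- 3 / 2) * (1 / b))" by (rule mult_left_mono[OF *]) simp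
  also have "\<dots> = 192 * width k / (base k - 2)" unfolding width_def b b_def[symmetric] by simp
  finally show ?thesis .
qed

lemma bend_small: "\<bar>bend k\<bar> \<le> 1"
proof -
  have "192 * width k / (base k - 2) \<le> 192 * (1 / 16) / 12"
    using base_ge[of k] width_le_angle[of k] angle_range(1)[of k] by (intro frac_le mult_left_mono) auto
  then show ?thesis using bend_le[of k] by simp
qed

lemma tilt_le: "\<bar>tilt k\<bar> \<le> 192 * width k / (base k - 2)"
proof -
  have c: "1 / 2 \<le> cos (angle k)" using angle_range[of k] by (intro cos_ge_half) auto
  have "\<bar>tilt k\<bar> = \<bar>tan (bend k / 4)\<bar> / cos (angle k)" using c by (simp add: tilt_def abs_divide)
  also have "\<dots> \<le> (2 * \<bar>bend k / 4\<bar>) / (1 / 2)"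
    using c bend_small[of k] by (intro frac_le abs_tan_le) auto
  also have "\<dots> = \<bar>bend k\<bar>" by simp
  finally show ?thesis using bend_le[of k] by simp
qed

text \<open>
  The slopes are at most \<open>192 * width k / base k\<close>, up to a shift of the base, and the centers have size at least a fixed
  multiple of \<open>1 / sqrt (base k)\<close>; the constant 6144 is 32 times 192.
\<close>

lemma bump_train_angles: "bump_train (\<lambda>k. sin (angle k)) width tilt 6144"
proof
  fix k
  have inc: "- angle k / 2 \<le> - sin (angle k)"
    using sin_increment[of "angle k" 0] angle_range[of k] by simp
  then show "sin (angle k) < 0" using angle_range[of k] by linarith
  show "(\<lambda>k. sin (angle k)) \<longlonglongrightarrow> 0" using tendsto_sin[OF angle_lim] by simp
  show "0 < width k" by (rule width_pos)
  show "width k \<le> 1" using width_le_angle[of k] angle_range[of k] by linarith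
  have "2 * width k \<le> (angle (Suc k) - angle k) / 2" using angle_gap[of k] by simp
  also have "\<dots> \<le> sin (angle (Suc k)) - sin (angle k)"
    using angle_range[of k] angle_range[of "Suc k"] angle_strict by (intro sin_increment) auto
  finally have "2 * width k \<le> sin (angle (Suc k)) - sin (angle k)" .
  then show "sin (angle k) + width k \<le> sin (angle (Suc k)) - width (Suc k)"
    using width_decreasing[of k] by linarith
  have b: "10 ^ 7 \<le> base k - 2" using base_ge[of k] by simp
  have "300 * (192 * width k / (base k - 2)) \<le> width k"
    using b width_pos[of k] by (simp add: pos_divide_le_eq)
  then show "300 * \<bar>tilt k\<bar> \<le> width k" using tilt_le[of k] by linarith
  have sq: "(angle k)\<^sup>2 = 1 / base k"
    using base_ge[of k] by (simp add: angle_def power2_eq_square powr_minus inverse_eq_divide flip: powr_add)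
  have "- angle k * (3 / 8) \<le> - (sin (angle k) + width k)" using inc width_le_angle[of k] by linarith
  then have "(- angle k * (3 / 8))\<^sup>2 \<le> (- (sin (angle k) + width k))\<^sup>2"
    using angle_range(2)[of k] by (intro power_mono) auto
  then have "(- angle k * (3 / 8))\<^sup>2 \<le> (sin (angle k) + width k)\<^sup>2" by (simp only: power2_minus)
  then have "9 / 64 * (1 / base k) \<le> (sin (angle k) + width k)\<^sup>2" 
    by (simp add: power_mult_distrib sq power_divide power2_eq_square[of "3::real"] mult.commute)
  moreover have "1 / (32 * (base k - 2)) \<le> 9 / 64 * (1 / base k)"
    using b by (simp add: field_simps)
  ultimately have "1 / (32 * (base k - 2)) \<le> (sin (angle k) + width k)\<^sup>2" by linarith
  then have "6144 * width k * (1 / (32 * (base k - 2))) \<le> 6144 * width k * (sin (angle k) + width k)\<^sup>2"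
    using width_pos[of k] by (intro mult_left_mono) auto
  moreover have "6144 * x * (1 / (32 * c)) = 192 * x / c" for x c :: real by simp
  then have "6144 * width k * (1 / (32 * (base k - 2))) = 192 * width k / (base k - 2)" .
  ultimately show "\<bar>tilt k\<bar> \<le> 6144 * width k * (sin (angle k) + width k)\<^sup>2" using tilt_le[of k] by linarith
qed

section \<open>Two orbits with the same arrival\<close>

lemma right_tangent_const: "right_tangent (\<lambda>t. x) T 0"
  by (simp add: right_tangent_def)

lemma right_tangent_rescale:
  assumes "right_tangent c 0 e" "0 < \<sigma>"
  shows "right_tangent (\<lambda>s. c (s / \<sigma>)) 0 (e /\<^sub>R \<sigma>)"
proof -
  have "((\<lambda>h. h / \<sigma>) \<longlongrightarrow> 0 / \<sigma>) (at_right 0)" using assms by (intro tendsto_intros) auto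
  then have "filterlim (\<lambda>h. h / \<sigma>) (at_right 0) (at_right 0)"
    using assms(2) by (intro tendsto_imp_filterlim_at_right)
      (auto intro!: eventually_mono[OF eventually_at_right_less])
  then have "((\<lambda>h. (c (0 + h / \<sigma>) - c 0) /\<^sub>R (h / \<sigma>)) \<longlongrightarrow> e) (at_right 0)"
    using assms(1) unfolding right_tangent_def by (rule filterlim_compose[rotated])
  then have "((\<lambda>h. ((c (0 + h / \<sigma>) - c 0) /\<^sub>R (h / \<sigma>)) /\<^sub>R \<sigma>) \<longlongrightarrow> e /\<^sub>R \<sigma>) (at_right 0)"
    by (intro tendsto_intros)
  moreover have "((c (0 + h / \<sigma>) - c 0) /\<^sub>R (h / \<sigma>)) /\<^sub>R \<sigma> = (c ((0 + h) / \<sigma>) - c (0 / \<sigma>)) /\<^sub>R h" for h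
    using assms(2) by (simp add: inverse_eq_divide)
  ultimately show ?thesis by (simp only: right_tangent_def)
qed

context polar_table
begin

definition bouncing_angles :: "(nat \<Rightarrow> real) \<Rightarrow> bool" where
  "bouncing_angles \<alpha> \<longleftrightarrow> \<alpha> \<longlonglongrightarrow> 0 \<and> (\<forall>n. \<alpha> n < \<alpha> (Suc n) \<and> \<alpha> n < 0 \<and> - 1 \<le> \<alpha> n \<and> u (\<alpha> n) = 1 \<and>
     u1 (\<alpha> (Suc n)) = tan ((\<alpha> n - 2 * \<alpha> (Suc n) + \<alpha> (Suc (Suc n))) / 4))"

definition launch :: "(nat \<Rightarrow> real) \<Rightarrow> plane \<times> plane" where
  "launch \<alpha> = ((1 / 2) *\<^sub>R (dir (\<alpha> 0) + dir (\<alpha> 1)), perp ((\<alpha> 0 + \<alpha> 1) / 2))"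

text \<open>
  The curve of a flow with initial vector \<open>e\<close> of unit length is a quasigeodesic after rescaling by some speed.  Since
  quasigeodesics have unit tangents, the speed is 1.
\<close>

lemma launch_path:
  assumes flow: "quasigeodesic_flow table \<Phi>" and \<alpha>: "bouncing_angles \<alpha>" and u0: "u 0 = 1" "u1 0 = 0"
  shows "launch \<alpha> \<in> tangent_bundle table"
    and "bouncing_path u u1 u2 u3 (\<lambda>t. fst (\<Phi> (launch \<alpha>) t)) \<alpha>"
proof -
  define x where "x = (1 / 2) *\<^sub>R (dir (\<alpha> 0) + dir (\<alpha> 1))"
  define e where "e = perp ((\<alpha> 0 + \<alpha> 1) / 2)"
  have v: "launch \<alpha> = (x, e)" by (simp add: launch_def x_def e_def)
  have A: "\<alpha> n < \<alpha> (Suc n)" "\<alpha> n < 0" "- 1 \<le> \<alpha> n" "u (\<alpha> n) = 1" for n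
    using \<alpha> by (simp_all add: bouncing_angles_def)
  then have ab: "\<alpha> 0 < \<alpha> 1" "\<alpha> 1 < 0" "- 1 \<le> \<alpha> 0" "u (\<alpha> 0) = 1" "u (\<alpha> 1) = 1"
    using A(1)[of 0] by simp_all
  have bd: "boundary (\<alpha> 0) = dir (\<alpha> 0)" "boundary (\<alpha> 1) = dir (\<alpha> 1)" using ab by (simp_all add: boundary_def)
  have "dir (\<alpha> 0) \<noteq> dir (\<alpha> 1)"
    using dir_same_angle[of 1 "\<alpha> 0" 1 "\<alpha> 1"] ab pi_gt3 by auto
  then have "(1 - 1 / 2) *\<^sub>R boundary (\<alpha> 0) + (1 / 2) *\<^sub>R boundary (\<alpha> 1) \<in> interior table"
    using bd by (intro chord_interior) auto
  then have xi: "x \<in> interior table" by (simp add: bd bd[unfolded One_nat_def] x_def scaleR_add_right)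
  show inb: "launch \<alpha> \<in> tangent_bundle table"
  proof -
    obtain r where r: "r > 0" "cball x r \<subseteq> table" using xi unfolding mem_interior_cball by blast
    have "x + r *\<^sub>R e \<in> table" using r by (intro subsetD[OF r(2)]) (simp add: dist_norm e_def)
    then have "e = (1 / r) *\<^sub>R ((x + r *\<^sub>R e) - x) \<and> 0 \<le> 1 / r \<and> x + r *\<^sub>R e \<in> table" using r by simp
    then have "e \<in> {l *\<^sub>R (q - x) |l q. 0 \<le> l \<and> q \<in> table}" by blast
    then have "e \<in> tangent_cone table x" unfolding tangent_cone_def by (rule subsetD[OF closure_subset])
    moreover have "x \<in> table" using xi interior_subset by blast
    ultimately show ?thesis unfolding v tangent_bundle_def by simp
  qed
  define c where "c t = fst (\<Phi> (launch \<alpha>) t)" for t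
  have fl: "\<Phi> (launch \<alpha>) 0 = launch \<alpha>"
    "(\<exists>x. \<forall>t. c t = x) \<or> (\<exists>\<sigma>>0. quasigeodesic table UNIV (\<lambda>s. c (s / \<sigma>)))"
    "(c has_vector_derivative snd (\<Phi> (launch \<alpha>) 0)) (at_right 0)"
    using bspec[OF flow[unfolded quasigeodesic_flow_def] inb] unfolding Let_def c_def by blast+
  have rt: "right_tangent c 0 e" using fl(3) unfolding fl(1) right_tangent_iff_has_vector_derivative by (simp add: v)
  have ne: "norm e = 1" by (simp add: e_def)
  have "\<not> (\<exists>x. \<forall>t. c t = x)"
  proof
    assume "\<exists>x. \<forall>t. c t = x"
    then obtain x where "c = (\<lambda>t. x)" by auto
    then have "e = 0" using right_tangent_unique[OF rt] right_tangent_const by simp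
    then show False using ne by simp
  qed
  then obtain \<sigma> where \<sigma>: "\<sigma> > 0" "quasigeodesic table UNIV (\<lambda>s. c (s / \<sigma>))" using fl(2) by blast
  have bp: "billiard_path table (\<lambda>s. c (s / \<sigma>))" by (rule quasigeodesic_billiard_path[OF table_convex_body \<sigma>(2)])
  then obtain w where w: "right_tangent (\<lambda>s. c (s / \<sigma>)) 0 w" "norm w = 1" using billiard_path.ex_right_tangent by blast
  have "w = e /\<^sub>R \<sigma>" using right_tangent_unique[OF w(1) right_tangent_rescale[OF rt \<sigma>(1)]] .
  then have "\<sigma> = 1" using w(2) ne \<sigma>(1) by (simp add: divide_eq_1_iff inverse_eq_divide)
  then have bc: "billiard_path table c" using bp by simp
  have "bouncing_path u u1 u2 u3 c \<alpha>"
  proof (intro bouncing_path.intro table_path.intro bouncing_path_axioms.intro bc polar_table_axioms)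
    show "c 0 = (1 / 2) *\<^sub>R (dir (\<alpha> 0) + dir (\<alpha> 1))" unfolding c_def fl(1) unfolding v by (simp add: x_def)
    show "right_tangent c 0 (perp ((\<alpha> 0 + \<alpha> 1) / 2))" using rt by (simp add: e_def)
  qed (use \<alpha> u0 in \<open>simp_all add: bouncing_angles_def\<close>)
  then show "bouncing_path u u1 u2 u3 (\<lambda>t. fst (\<Phi> (launch \<alpha>) t)) \<alpha>" by (simp add: c_def[abs_def])
qed

text \<open>
  Both orbits reach the same boundary point with the same velocity, so the group property makes them coincide backwards in
  time.  But shortly before the arrival each orbit touches the boundary only at its own angles.
\<close>

lemma two_arrivals_exclude_flow:
  assumes \<alpha>: "bouncing_angles \<alpha>" and \<beta>: "bouncing_angles \<beta>" and u0: "u 0 = 1" "u1 0 = 0"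
    and disjoint: "\<And>m n. \<alpha> m \<noteq> \<beta> n"
  shows "\<not> quasigeodesic_flow table \<Phi>"
proof
  assume flow: "quasigeodesic_flow table \<Phi>"
  interpret a: bouncing_path u u1 u2 u3 "\<lambda>t. fst (\<Phi> (launch \<alpha>) t)" \<alpha>
    by (rule launch_path(2)[OF flow \<alpha> u0])
  interpret b: bouncing_path u u1 u2 u3 "\<lambda>t. fst (\<Phi> (launch \<beta>) t)" \<beta>
    by (rule launch_path(2)[OF flow \<beta> u0])
  have group: "\<Phi> (\<Phi> v s) t = \<Phi> v (s + t)" and tang: "((\<lambda>t. fst (\<Phi> v t)) has_vector_derivative snd (\<Phi> v t)) (at_right t)"
    if "v \<in> tangent_bundle table" for v s t
    using bspec[OF flow[unfolded quasigeodesic_flow_def] that] unfolding Let_def by blast+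
  note vs = launch_path(1)[OF flow \<alpha> u0] launch_path(1)[OF flow \<beta> u0]
  obtain T where T: "a.hit \<longlonglongrightarrow> T" "\<forall>n. a.hit n < T" using a.hit_limit by blast
  obtain S where S: "b.hit \<longlonglongrightarrow> S" "\<forall>n. b.hit n < S" using b.hit_limit by blast
  have "snd (\<Phi> (launch \<alpha>) T) = perp 0"
    using tang[OF vs(1), of T] a.limit_right_tangent[OF T] right_tangent_unique
    unfolding right_tangent_iff_has_vector_derivative by blast
  then have aT: "\<Phi> (launch \<alpha>) T = (dir 0, perp 0)"
    using a.limit_position[OF T(1)] by (simp add: prod_eq_iff)
  have "snd (\<Phi> (launch \<beta>) S) = perp 0"
    using tang[OF vs(2), of S] b.limit_right_tangent[OF S] right_tangent_unique
    unfolding right_tangent_iff_has_vector_derivative by blast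
  then have bS: "\<Phi> (launch \<beta>) S = (dir 0, perp 0)"
    using b.limit_position[OF S(1)] by (simp add: prod_eq_iff)
  have same: "\<Phi> (launch \<alpha>) (T - t) = \<Phi> (launch \<beta>) (S - t)" for t
    using group[OF vs(1), of T "- t"] group[OF vs(2), of S "- t"] aT bS by simp
  have "\<forall>\<^sub>F n in sequentially. T - (S - b.hit 0) < a.hit n"
    using T(1) S(2) by (intro order_tendstoD(1)[OF T(1)]) simp
  then obtain n where n: "T - (S - b.hit 0) < a.hit n" by (auto simp: eventually_sequentially)
  define t where "t = S - (T - a.hit n)"
  have t: "b.hit 0 < t" "t < S" using n T(2) by (auto simp: t_def)
  have pos: "fst (\<Phi> (launch \<beta>) t) = dir (\<alpha> (Suc n))"
    using same[of "T - a.hit n"] a.hits[of n] by (simp add: t_def)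
  have "\<forall>\<^sub>F m in sequentially. t < b.hit m" using S(1) t(2) by (rule order_tendstoD(1))
  then obtain m0 where m0: "t < b.hit m0" by (auto simp: eventually_sequentially)
  define m where "m = (LEAST m. t < b.hit m)"
  have m: "t < b.hit m" unfolding m_def by (rule LeastI[of _ m0]) (rule m0)
  have "m \<noteq> 0" using m t(1) by (metis less_asym)
  then obtain k where k: "m = Suc k" by (cases m) auto
  have "\<not> t < b.hit k" using not_less_Least[of k "\<lambda>m. t < b.hit m"] k by (simp add: m_def)
  then consider "t = b.hit k" | "b.hit k < t" by linarith
  then show False
  proof cases
    case 1
    then have "dir (\<alpha> (Suc n)) = dir (\<beta> (Suc k))" using pos b.hits[of k] by simp
    moreover have "\<bar>\<alpha> (Suc n) - \<beta> (Suc k)\<bar> < 2 * pi"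
      using a.neg[of "Suc n"] a.low[of "Suc n"] b.neg[of "Suc k"] b.low[of "Suc k"] pi_gt3 by linarith
    ultimately show False using dir_same_angle[of 1 "\<alpha> (Suc n)" 1 "\<beta> (Suc k)"] disjoint by simp
  next
    case 2
    then have "boundary (\<alpha> (Suc n)) \<in> interior table"
      using b.between_hits[of k t] m k pos a.boundary_point by simp
    then show False using interior_strict normal_inner_boundary by (metis less_irrefl)
  qed
qed

end

theorem proposition5p6:
  shows "\<exists>K. convex_body K \<and> D3_positively_curved_boundary K \<and>
           \<not> (\<exists>\<Phi>. continuous_quasigeodesic_flow K \<Phi>) \<and>
           \<not> admits_continuous_billiard_evolution K"
proof -
  interpret bump_train "\<lambda>k. sin (angle k)" width tilt 6144 by (rule bump_train_angles)
  define u where "u t = 1 + train 0 (sin t)" for t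
  define u1 where "u1 t = train 1 (sin t) * cos t" for t
  define u2 where "u2 t = train 2 (sin t) * (cos t)\<^sup>2 - train 1 (sin t) * sin t" for t
  define u3 where "u3 t = train 3 (sin t) * cos t ^ 3 - 3 * train 2 (sin t) * sin t * cos t - train 1 (sin t) * cos t" for t
  interpret polar_table u u1 u2 u3
    using polar_table unfolding u_def[abs_def] u1_def[abs_def] u2_def[abs_def] u3_def[abs_def] .
  have u0: "u 0 = 1" "u1 0 = 0" by (simp_all add: u_def u1_def train_at_0 train_at_0[unfolded One_nat_def])
  have at: "u (angle k) = 1" "u1 (angle k) = tan (bend k / 4)" for k
  proof -
    have "cos (angle k) \<noteq> 0" using cos_ge_half[of "angle k"] angle_range[of k] by auto
    then show "u (angle k) = 1" "u1 (angle k) = tan (bend k / 4)"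
      by (simp_all add: u_def u1_def train_at_center train_at_center[unfolded One_nat_def] tilt_def)
  qed
  have bouncing: "bouncing_angles (\<lambda>n. angle (2 * n + i))" for i
    unfolding bouncing_angles_def
  proof (intro conjI allI)
    have "filterlim (\<lambda>n. 2 * n + i) at_top sequentially"
      by (rule filterlim_subseq) (simp add: strict_mono_def)
    then show "(\<lambda>n. angle (2 * n + i)) \<longlonglongrightarrow> 0" by (rule filterlim_compose[OF angle_lim])
    fix n
    show "angle (2 * n + i) < angle (2 * Suc n + i)" by (rule angle_less) simp
    show "angle (2 * n + i) < 0" "- 1 \<le> angle (2 * n + i)" using angle_range[of "2 * n + i"] by auto
    show "u (angle (2 * n + i)) = 1" by (rule at)
    have "base (2 * n + i) = base (2 * Suc n + i) - 2" "base (2 * Suc (Suc n) + i) = base (2 * Suc n + i) + 2"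
      by (simp_all add: base_def)
    then have "bend (2 * Suc n + i) = angle (2 * n + i) - 2 * angle (2 * Suc n + i) + angle (2 * Suc (Suc n) + i)"
      by (simp only: bend_def angle_def)
    then show "u1 (angle (2 * Suc n + i)) = tan ((angle (2 * n + i) - 2 * angle (2 * Suc n + i) + angle (2 * Suc (Suc n) + i)) / 4)"
      using at by simp
  qed
  have "angle (2 * m + 0) \<noteq> angle (2 * n + 1)" for m n
  proof -
    have "2 * m + 0 < 2 * n + 1 \<or> 2 * n + 1 < 2 * m + 0" by presburger
    then show ?thesis
    proof
      assume "2 * m + 0 < 2 * n + 1"
      from angle_less[OF this] show ?thesis by simp
    next
      assume "2 * n + 1 < 2 * m + 0"
      from angle_less[OF this] show ?thesis by simp
    qed
  qed
  then have "\<not> quasigeodesic_flow table \<Phi>" for \<Phi>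
    by (intro two_arrivals_exclude_flow[OF bouncing bouncing u0])
  then show ?thesis
    using table_convex_body table_boundary_smooth
    unfolding continuous_quasigeodesic_flow_def admits_continuous_billiard_evolution_def by blast
qed

end
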